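(* Let $L$ be the minimal operator in $H=L^2((a,b),\mathbb{R}^n)$ of a one-sided singular Sturm–Liouville expression $l=-\frac{d}{dt}\big(P\frac{d}{dt}+Q\big)+Q^{T}\frac{d}{dt}+R$ on $(a,b)$ (with regular endpoint $b$). Assume that the quadratic form $u\mapsto\langle lu,u\rangle$ on $C_0^\infty((a,b),\mathbb{R}^n)$ is bounded from below in $L^2$ and that $L$ is a closed symmetric Fredholm operator. Let $D(L^* )=D(L)\oplus W$, let $p:D(L^* )\to W$ be the projection along $D(L)$, let $\Lambda$ be a Lagrangian subspace of $(W,\omega|_W)$, $L_\Lambda:=L^*|_{D(L)\oplus\Lambda}$, and let $L_F$ be the Friedrichs extension of $L$. Then $$\mathrm{n}_-(L_\Lambda)=\mathrm{n}_-(L_F)+\iota\big(p(\ker L^* ),\,p(D(L_\Lambda)),\,p(D(L_F))\big),$$ i.e. $\mathrm{n}_-(L_\Lambda)-\mathrm{n}_-(L_F)=\iota\big(p(\ker L^* ),p(D(L_\Lambda)),p(D(L_F))\big)$ when the indices are finite.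
   Context: $a<b$ in $[-\infty,\infty]$; $P(t)$ invertible with $P^{-1}\in C^1((a,b),\mathrm{Sym}_n(\mathbb{R}))$, $Q\in C^1((a,b),\mathrm{Mat}_n(\mathbb{R}))$, $R\in C^0((a,b),\mathrm{Sym}_n(\mathbb{R}))$. Regular endpoint $b$: $b$ is finite and $P$ (as a path of invertible matrices), $Q$, $R$ are continuous up to $b$. $L$ is the closure of $l$ on $C_0^\infty((a,b),\mathbb{R}^n)$; $L^*$ its adjoint; $D(\cdot)$ domains. $\omega(x,y)=\langle x,L^*y\rangle-\langle L^*x,y\rangle$ on $D(L^* )$ has radical $D(L)$; $W$ is a (finite-dimensional) complement of $D(L)$ in $D(L^* )$, so $(W,\omega|_W)$ is symplectic. The three subspaces $p(\ker L^* )$, $p(D(L_\Lambda))=\Lambda$, $p(D(L_F))$ are Lagrangian in $W$. $\mathrm{n}_-$ is the Morse index (maximal dimension of the negative spectral subspace, in $\mathbb{N}\cup\{\infty\}$). Triple index: for Lagrangian subspaces $\alpha,\beta,\gamma$ of a finite-dimensional symplectic space, define the quadratic form $Q(\alpha,\beta;\gamma)$ on $\alpha\cap(\beta+\gamma)$ by $Q[u]=\omega(u,v)$ where $v\in\beta$ is such that $u+v\in\gamma$ (independent of choices). Then $\iota(\alpha,\beta,\gamma)=n_+\big(Q(\alpha,\beta;\gamma)\big)+\dim(\alpha\cap\gamma)-\dim(\alpha\cap\beta\cap\gamma)$, $n_+$ being the dimension of a maximal positive definite subspace. *)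

theory Defs
  imports "HOL-Analysis.Analysis"
begin

section \<open>The Hilbert space of square-integrable functions\<close>

definition square_integrable :: "(real \<Rightarrow> 'v::euclidean_space) \<Rightarrow> bool" where
  "square_integrable f \<longleftrightarrow>
     f \<in> borel_measurable lborel \<and> integrable lborel (\<lambda>t. (norm (f t))\<^sup>2)"

definition l2_rel :: "(real \<Rightarrow> 'v::euclidean_space) \<Rightarrow> (real \<Rightarrow> 'v) \<Rightarrow> bool" where
  "l2_rel f g \<longleftrightarrow> square_integrable f \<and> square_integrable g \<and> (AE t in lborel. f t = g t)"

lemma square_integrable_zero: "square_integrable (\<lambda>t. 0)"
  by (simp add: square_integrable_def)

lemma square_integrable_add:
  assumes "square_integrable f" "square_integrable g"
  shows "square_integrable (\<lambda>t. f t + g t)"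
proof -
  have [measurable]: "f \<in> borel_measurable borel" "g \<in> borel_measurable borel"
    using assms by (auto simp: square_integrable_def)
  have "integrable lborel (\<lambda>t. 2 * (norm (f t))\<^sup>2 + 2 * (norm (g t))\<^sup>2)"
    using assms by (auto simp: square_integrable_def)
  moreover have "(norm (f t + g t))\<^sup>2 \<le> 2 * (norm (f t))\<^sup>2 + 2 * (norm (g t))\<^sup>2" for t
  proof -
    have "(norm (f t + g t))\<^sup>2 \<le> (norm (f t) + norm (g t))\<^sup>2"
      by (simp add: norm_triangle_ineq power_mono)
    also have "\<dots> \<le> 2 * (norm (f t))\<^sup>2 + 2 * (norm (g t))\<^sup>2"
      using sum_squares_bound[of "norm (f t)" "norm (g t)"] by (simp add: power2_sum)
    finally show ?thesis .
  qed
  ultimately have "integrable lborel (\<lambda>t. (norm (f t + g t))\<^sup>2)"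
    by (elim Bochner_Integration.integrable_bound) (auto intro!: AE_I2)
  then show ?thesis by (simp add: square_integrable_def)
qed

lemma square_integrable_scaleR:
  "square_integrable f \<Longrightarrow> square_integrable (\<lambda>t. c *\<^sub>R f t)"
  by (auto simp: square_integrable_def power_mult_distrib)

lemma integrable_inner_square_integrable:
  assumes "square_integrable f" "square_integrable g"
  shows "integrable lborel (\<lambda>t. inner (f t) (g t))"
proof -
  have [measurable]: "f \<in> borel_measurable borel" "g \<in> borel_measurable borel"
    using assms by (auto simp: square_integrable_def)
  have "integrable lborel (\<lambda>t. (norm (f t))\<^sup>2 + (norm (g t))\<^sup>2)"
    using assms by (auto simp: square_integrable_def)
  moreover have "\<bar>inner (f t) (g t)\<bar> \<le> (norm (f t))\<^sup>2 + (norm (g t))\<^sup>2" for t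
  proof -
    have "\<bar>inner (f t) (g t)\<bar> \<le> norm (f t) * norm (g t)"
      by (rule Cauchy_Schwarz_ineq2)
    also have "\<dots> \<le> (norm (f t))\<^sup>2 + (norm (g t))\<^sup>2"
      using sum_squares_bound[of "norm (f t)" "norm (g t)"]
        mult_nonneg_nonneg[OF norm_ge_zero[of "f t"] norm_ge_zero[of "g t"]]
      unfolding mult.assoc by linarith
    finally show ?thesis .
  qed
  ultimately show ?thesis
    by (elim Bochner_Integration.integrable_bound) (auto intro!: AE_I2)
qed

quotient_type (overloaded) 'v l2 = "real \<Rightarrow> 'v::euclidean_space" / partial: l2_rel
  morphisms rep_l2 to_l2
proof (rule part_equivpI)
  show "\<exists>x. l2_rel x (x :: real \<Rightarrow> 'v)"
    using square_integrable_zero by (auto simp: l2_rel_def)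
  show "symp (l2_rel :: (real \<Rightarrow> 'v) \<Rightarrow> _)"
    by (auto simp: l2_rel_def symp_def elim: eventually_mono)
  show "transp (l2_rel :: (real \<Rightarrow> 'v) \<Rightarrow> _)"
  proof (rule transpI)
    fix f g h :: "real \<Rightarrow> 'v"
    assume fg: "l2_rel f g" and gh: "l2_rel g h"
    then have "AE t in lborel. f t = g t" "AE t in lborel. g t = h t"
      by (auto simp: l2_rel_def)
    then have "AE t in lborel. f t = h t" by eventually_elim simp
    then show "l2_rel f h" using fg gh by (auto simp: l2_rel_def)
  qed
qed

instantiation l2 :: (euclidean_space) real_inner
begin

lift_definition zero_l2 :: "'a l2" is "\<lambda>t. 0"
  by (simp add: l2_rel_def square_integrable_zero)

lift_definition plus_l2 :: "'a l2 \<Rightarrow> 'a l2 \<Rightarrow> 'a l2" is "\<lambda>f g t. f t + g t"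
proof -
  fix f f' g g' :: "real \<Rightarrow> 'a"
  assume *: "l2_rel f f'" "l2_rel g g'"
  then have "AE t in lborel. f t = f' t" "AE t in lborel. g t = g' t"
    by (auto simp: l2_rel_def)
  then have "AE t in lborel. f t + g t = f' t + g' t" by eventually_elim simp
  with * show "l2_rel (\<lambda>t. f t + g t) (\<lambda>t. f' t + g' t)"
    by (auto simp: l2_rel_def square_integrable_add)
qed

lift_definition scaleR_l2 :: "real \<Rightarrow> 'a l2 \<Rightarrow> 'a l2" is "\<lambda>c f t. c *\<^sub>R f t"
proof -
  fix c :: real and f f' :: "real \<Rightarrow> 'a"
  assume *: "l2_rel f f'"
  then have "AE t in lborel. f t = f' t" by (auto simp: l2_rel_def)
  then have "AE t in lborel. c *\<^sub>R f t = c *\<^sub>R f' t" by eventually_elim simp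
  with * show "l2_rel (\<lambda>t. c *\<^sub>R f t) (\<lambda>t. c *\<^sub>R f' t)"
    unfolding l2_rel_def by (blast intro: square_integrable_scaleR)
qed

lift_definition inner_l2 :: "'a l2 \<Rightarrow> 'a l2 \<Rightarrow> real"
  is "\<lambda>f g. LINT t|lborel. inner (f t) (g t)"
proof -
  fix f f' g g' :: "real \<Rightarrow> 'a"
  assume *: "l2_rel f f'" "l2_rel g g'"
  then have "AE t in lborel. f t = f' t" "AE t in lborel. g t = g' t"
    by (auto simp: l2_rel_def)
  then have "AE t in lborel. inner (f t) (g t) = inner (f' t) (g' t)"
    by eventually_elim simp
  with * show "(LINT t|lborel. inner (f t) (g t)) = (LINT t|lborel. inner (f' t) (g' t))"
    unfolding l2_rel_def
    by (intro integral_cong_AE borel_measurable_integrable integrable_inner_square_integrable) auto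
qed

definition uminus_l2 :: "'a l2 \<Rightarrow> 'a l2" where
  "uminus_l2 x = (-1) *\<^sub>R x"

definition minus_l2 :: "'a l2 \<Rightarrow> 'a l2 \<Rightarrow> 'a l2" where
  "minus_l2 x y = x + (-1) *\<^sub>R y"

definition norm_l2 :: "'a l2 \<Rightarrow> real" where
  "norm_l2 x = sqrt (inner x x)"

definition sgn_l2 :: "'a l2 \<Rightarrow> 'a l2" where
  "sgn_l2 x = inverse (norm x) *\<^sub>R x"

definition dist_l2 :: "'a l2 \<Rightarrow> 'a l2 \<Rightarrow> real" where
  "dist_l2 x y = norm (x - y)"

definition uniformity_l2 :: "('a l2 \<times> 'a l2) filter" where
  "uniformity_l2 = (INF e\<in>{0 <..}. principal {(x, y). dist x y < e})"

definition open_l2 :: "'a l2 set \<Rightarrow> bool" where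
  "open_l2 U \<longleftrightarrow> (\<forall>x\<in>U. \<forall>\<^sub>F (x', y) in uniformity. x' = x \<longrightarrow> y \<in> U)"

instance
proof
  fix x y z :: "'a l2" and r s :: real and U :: "'a l2 set"
  note si = square_integrable_add square_integrable_scaleR square_integrable_zero
  show "x + y + z = x + (y + z)"
    by transfer (simp add: l2_rel_def si add.assoc)
  show "x + y = y + x"
    by transfer (simp add: l2_rel_def si add.commute)
  show "0 + x = x"
    by transfer (simp add: l2_rel_def si)
  show "- x + x = 0"
    unfolding uminus_l2_def
  proof (transfer, goal_cases)
    case (1 f)
    then have "square_integrable (\<lambda>t. (-1) *\<^sub>R f t + f t)"
      unfolding l2_rel_def by (intro square_integrable_add square_integrable_scaleR) auto
    then show ?case by (simp add: l2_rel_def square_integrable_zero)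
  qed
  show "x - y = x + - y"
    by (simp add: minus_l2_def uminus_l2_def)
  show "r *\<^sub>R (x + y) = r *\<^sub>R x + r *\<^sub>R y"
  proof (transfer, goal_cases)
    case (1 r f g)
    then have "square_integrable (\<lambda>t. r *\<^sub>R f t + r *\<^sub>R g t)"
      unfolding l2_rel_def by (intro square_integrable_add square_integrable_scaleR) auto
    then show ?case by (simp add: l2_rel_def scaleR_add_right)
  qed
  show "(r + s) *\<^sub>R x = r *\<^sub>R x + s *\<^sub>R x"
  proof (transfer, goal_cases)
    case (1 r s f)
    then have "square_integrable (\<lambda>t. r *\<^sub>R f t + s *\<^sub>R f t)"
      unfolding l2_rel_def by (intro square_integrable_add square_integrable_scaleR) auto
    then show ?case by (simp add: l2_rel_def scaleR_add_left)
  qed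
  show "r *\<^sub>R s *\<^sub>R x = (r * s) *\<^sub>R x"
  proof (transfer, goal_cases)
    case (1 r s f)
    then have "square_integrable (\<lambda>t. (r * s) *\<^sub>R f t)"
      unfolding l2_rel_def by (intro square_integrable_scaleR) auto
    then show ?case by (simp add: l2_rel_def)
  qed
  show "1 *\<^sub>R x = x"
    by transfer (simp add: l2_rel_def si)
  show "inner x y = inner y x"
    by transfer (simp add: inner_commute)
  show "inner (x + y) z = inner x z + inner y z"
    by transfer (simp add: l2_rel_def inner_add_left integrable_inner_square_integrable)
  show "inner (r *\<^sub>R x) y = r * inner x y"
    by transfer (simp add: l2_rel_def)
  show "0 \<le> inner x x"
    by transfer simp
  show "inner x x = 0 \<longleftrightarrow> x = 0"
  proof (transfer, goal_cases)
    case (1 f)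
    then have f: "square_integrable f" by (simp add: l2_rel_def)
    have "(LINT t|lborel. inner (f t) (f t)) = 0 \<longleftrightarrow> (AE t in lborel. inner (f t) (f t) = 0)"
      using f by (intro integral_nonneg_eq_0_iff_AE integrable_inner_square_integrable) auto
    then show ?case using f by (simp add: l2_rel_def square_integrable_zero)
  qed
  show "norm x = sqrt (inner x x)"
    by (simp add: norm_l2_def)
  show "sgn x = inverse (norm x) *\<^sub>R x"
    by (simp add: sgn_l2_def)
  show "dist x y = norm (x - y)"
    by (simp add: dist_l2_def)
  show "(uniformity :: ('a l2 \<times> 'a l2) filter)
          = (INF e\<in>{0 <..}. principal {(x, y). dist x y < e})"
    by (simp add: uniformity_l2_def)
  show "open U \<longleftrightarrow> (\<forall>x\<in>U. \<forall>\<^sub>F (x', y) in uniformity. x' = x \<longrightarrow> y \<in> U)"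
    by (simp add: open_l2_def)
qed

end

text \<open>
  The interval varies with the statement, so \<open>L\<^sup>2(I)\<close> is realised as the closed subspace of
  \<open>L\<^sup>2(\<real>)\<close> of the classes that have a representative vanishing outside \<open>I\<close>.
\<close>

definition l2_on :: "real set \<Rightarrow> 'v::euclidean_space l2 set" where
  "l2_on I = to_l2 ` {f. square_integrable f \<and> (\<forall>t. t \<notin> I \<longrightarrow> f t = 0)}"


section \<open>Unbounded operators\<close>

text \<open>
  An operator in a Hilbert space \<open>H\<close>, itself a closed subspace of the ambient type, is given by
  its graph \<open>A \<subseteq> H \<times> H\<close>; its domain is \<open>Domain A\<close> and its range is \<open>Range A\<close>.
\<close>

definition op_app :: "('h \<times> 'h) set \<Rightarrow> 'h \<Rightarrow> 'h" where
  "op_app A x = (THE z. (x, z) \<in> A)"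

definition op_kernel :: "('h::zero \<times> 'h) set \<Rightarrow> 'h set" where
  "op_kernel A = {x. (x, 0) \<in> A}"

definition op_restrict :: "('h \<times> 'h) set \<Rightarrow> 'h set \<Rightarrow> ('h \<times> 'h) set" where
  "op_restrict A D = {(x, z) \<in> A. x \<in> D}"

definition linear_operator :: "'h::real_vector set \<Rightarrow> ('h \<times> 'h) set \<Rightarrow> bool" where
  "linear_operator H A \<longleftrightarrow> A \<subseteq> H \<times> H \<and> subspace A \<and> single_valued A"

definition op_adjoint :: "'h::real_inner set \<Rightarrow> ('h \<times> 'h) set \<Rightarrow> ('h \<times> 'h) set" where
  "op_adjoint H A = {(y, w) \<in> H \<times> H. \<forall>(x, z) \<in> A. inner z y = inner x w}"

definition closed_operator :: "'h::real_inner set \<Rightarrow> ('h \<times> 'h) set \<Rightarrow> bool" where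
  "closed_operator H A \<longleftrightarrow> linear_operator H A \<and> closed A"

definition symmetric_operator :: "'h::real_inner set \<Rightarrow> ('h \<times> 'h) set \<Rightarrow> bool" where
  "symmetric_operator H A \<longleftrightarrow>
     linear_operator H A \<and> H \<subseteq> closure (Domain A) \<and>
     (\<forall>(x, z) \<in> A. \<forall>(y, w) \<in> A. inner z y = inner x w)"

definition selfadjoint_operator :: "'h::real_inner set \<Rightarrow> ('h \<times> 'h) set \<Rightarrow> bool" where
  "selfadjoint_operator H A \<longleftrightarrow>
     linear_operator H A \<and> H \<subseteq> closure (Domain A) \<and> op_adjoint H A = A"

text \<open>Finite-dimensional kernel and closed range of finite codimension in \<open>H\<close>.\<close>

definition fredholm_operator :: "'h::real_inner set \<Rightarrow> ('h \<times> 'h) set \<Rightarrow> bool" where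
  "fredholm_operator H A \<longleftrightarrow>
     closed_operator H A \<and>
     (\<exists>B. finite B \<and> op_kernel A \<subseteq> span B) \<and>
     closed (Range A) \<and>
     (\<exists>B. finite B \<and> H \<subseteq> span (Range A \<union> B))"

text \<open>
  Freudenthal's description: the restriction of the adjoint to those elements of its domain
  that are limits of sequences in the domain of \<open>A\<close> which are Cauchy for the quadratic form
  of \<open>A\<close> (for \<open>A\<close> bounded from below).
\<close>

definition friedrichs_extension :: "'h::real_inner set \<Rightarrow> ('h \<times> 'h) set \<Rightarrow> ('h \<times> 'h) set" where
  "friedrichs_extension H A = op_restrict (op_adjoint H A)
     {x. \<exists>u. (\<forall>k. u k \<in> Domain A) \<and> u \<longlonglongrightarrow> x \<and>
         (\<forall>e>0. \<exists>N::nat. \<forall>k\<ge>N. \<forall>m\<ge>N.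
            \<bar>inner (op_app A (u k - u m)) (u k - u m)\<bar> < e)}"


section \<open>Morse index\<close>

definition orthogonal_projection_in :: "'h::real_inner set \<Rightarrow> ('h \<Rightarrow> 'h) \<Rightarrow> bool" where
  "orthogonal_projection_in H F \<longleftrightarrow>
     (\<exists>S. subspace S \<and> closed S \<and> S \<subseteq> H \<and>
        (\<forall>x\<in>H. F x \<in> S \<and> (\<forall>y\<in>S. inner (x - F x) y = 0)))"

text \<open>Right-continuous resolution of the identity of \<open>H\<close>; \<open>E t\<close> is the spectral projection
  of \<open>(-\<infinity>, t]\<close>.\<close>

definition spectral_family :: "'h::real_inner set \<Rightarrow> (real \<Rightarrow> 'h \<Rightarrow> 'h) \<Rightarrow> bool" where
  "spectral_family H E \<longleftrightarrow>
     (\<forall>t. orthogonal_projection_in H (E t)) \<and>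
     (\<forall>s t. s \<le> t \<longrightarrow> E s ` H \<subseteq> E t ` H) \<and>
     (\<forall>x\<in>H. (\<forall>t. ((\<lambda>s. E s x) \<longlongrightarrow> E t x) (at_right t)) \<and>
             ((\<lambda>s. E s x) \<longlongrightarrow> 0) at_bot \<and>
             ((\<lambda>s. E s x) \<longlongrightarrow> x) at_top)"

definition spectral_distribution :: "(real \<Rightarrow> 'h::real_inner \<Rightarrow> 'h) \<Rightarrow> 'h \<Rightarrow> real measure" where
  "spectral_distribution E x = interval_measure (\<lambda>t. inner (E t x) x)"

text \<open>
  \<open>A = \<integral> t dE(t)\<close> for self-adjoint \<open>A\<close>. By polarisation (\<open>A\<close> is symmetric) it suffices to
  describe \<open>\<langle>Ax, x\<rangle>\<close> besides the domain.
\<close>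

definition spectral_resolution ::
  "'h::real_inner set \<Rightarrow> ('h \<times> 'h) set \<Rightarrow> (real \<Rightarrow> 'h \<Rightarrow> 'h) \<Rightarrow> bool" where
  "spectral_resolution H A E \<longleftrightarrow>
     selfadjoint_operator H A \<and> spectral_family H E \<and>
     Domain A = {x \<in> H. integrable (spectral_distribution E x) (\<lambda>t. t\<^sup>2)} \<and>
     (\<forall>(x, z) \<in> A. inner z x = (LINT t|spectral_distribution E x. t))"

text \<open>
  The range of the spectral projection of \<open>(-\<infinity>, 0)\<close>, which is the left limit at \<open>0\<close> of the
  spectral family.
\<close>

definition negative_spectral_subspace :: "'h::real_inner set \<Rightarrow> ('h \<times> 'h) set \<Rightarrow> 'h set" where
  "negative_spectral_subspace H A =
     (let E = (SOME E. spectral_resolution H A E) in closure (\<Union>t\<in>{..<0}. E t ` H))"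

definition edim :: "'h::real_vector set \<Rightarrow> enat" where
  "edim V = (if \<exists>B. finite B \<and> V \<subseteq> span B then enat (dim V) else \<infinity>)"

definition morse_index :: "'h::real_inner set \<Rightarrow> ('h \<times> 'h) set \<Rightarrow> enat" where
  "morse_index H A = edim (negative_spectral_subspace H A)"


section \<open>Symplectic linear algebra\<close>

definition complement_in :: "'h::real_vector set \<Rightarrow> 'h set \<Rightarrow> 'h set \<Rightarrow> bool" where
  "complement_in U V W \<longleftrightarrow> subspace W \<and> V \<inter> W = {0} \<and> V + W = U"

text \<open>Projection onto \<open>W\<close> along \<open>V\<close>, on the direct sum of \<open>V\<close> and \<open>W\<close>.\<close>

definition proj_along :: "'h::real_vector set \<Rightarrow> 'h set \<Rightarrow> 'h \<Rightarrow> 'h" where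
  "proj_along V W x = (THE w. w \<in> W \<and> x - w \<in> V)"

definition boundary_form :: "('h::real_inner \<times> 'h) set \<Rightarrow> 'h \<Rightarrow> 'h \<Rightarrow> real" where
  "boundary_form Ladj x y = inner x (op_app Ladj y) - inner (op_app Ladj x) y"

definition lagrangian :: "('h \<Rightarrow> 'h \<Rightarrow> real) \<Rightarrow> 'h::real_vector set \<Rightarrow> 'h set \<Rightarrow> bool" where
  "lagrangian \<omega> W \<Lambda> \<longleftrightarrow>
     subspace \<Lambda> \<and> \<Lambda> \<subseteq> W \<and> \<Lambda> = {w \<in> W. \<forall>v\<in>\<Lambda>. \<omega> w v = 0}"

definition positive_index :: "'h::real_vector set \<Rightarrow> ('h \<Rightarrow> real) \<Rightarrow> nat" where
  "positive_index V q =
     Max (dim ` {S. subspace S \<and> S \<subseteq> V \<and> (\<forall>u\<in>S. u \<noteq> 0 \<longrightarrow> 0 < q u)})"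

definition triple_form ::
  "('h \<Rightarrow> 'h \<Rightarrow> real) \<Rightarrow> 'h::real_vector set \<Rightarrow> 'h set \<Rightarrow> 'h \<Rightarrow> real" where
  "triple_form \<omega> \<beta> \<gamma> u = \<omega> u (SOME v. v \<in> \<beta> \<and> u + v \<in> \<gamma>)"

definition triple_index ::
  "('h \<Rightarrow> 'h \<Rightarrow> real) \<Rightarrow> 'h::real_vector set \<Rightarrow> 'h set \<Rightarrow> 'h set \<Rightarrow> nat" where
  "triple_index \<omega> \<alpha> \<beta> \<gamma> =
     positive_index (\<alpha> \<inter> (\<beta> + \<gamma>)) (triple_form \<omega> \<beta> \<gamma>)
       + dim (\<alpha> \<inter> \<gamma>) - dim (\<alpha> \<inter> \<beta> \<inter> \<gamma>)"


section \<open>Sturm--Liouville expressions\<close>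

definition sl_coefficients ::
  "ereal \<Rightarrow> ereal \<Rightarrow> (real \<Rightarrow> real^'n^'n) \<Rightarrow> (real \<Rightarrow> real^'n^'n) \<Rightarrow> (real \<Rightarrow> real^'n^'n) \<Rightarrow> bool"
where
  "sl_coefficients a b P Q R \<longleftrightarrow>
     (\<forall>t\<in>einterval a b. invertible (P t) \<and>
        transpose (matrix_inv (P t)) = matrix_inv (P t) \<and> transpose (R t) = R t) \<and>
     (\<lambda>t. matrix_inv (P t)) C1_differentiable_on einterval a b \<and>
     Q C1_differentiable_on einterval a b \<and>
     continuous_on (einterval a b) R"

definition regular_right_endpoint ::
  "ereal \<Rightarrow> (real \<Rightarrow> real^'n^'n) \<Rightarrow> (real \<Rightarrow> real^'n^'n) \<Rightarrow> (real \<Rightarrow> real^'n^'n) \<Rightarrow> bool"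
where
  "regular_right_endpoint b P Q R \<longleftrightarrow>
     (\<exists>b' P\<^sub>b Q\<^sub>b R\<^sub>b. b = ereal b' \<and> invertible P\<^sub>b \<and>
        (P \<longlongrightarrow> P\<^sub>b) (at_left b') \<and> (Q \<longlongrightarrow> Q\<^sub>b) (at_left b') \<and> (R \<longlongrightarrow> R\<^sub>b) (at_left b'))"

definition smooth :: "(real \<Rightarrow> 'v::real_normed_vector) \<Rightarrow> bool" where
  "smooth u \<longleftrightarrow>
     (\<exists>D :: nat \<Rightarrow> real \<Rightarrow> 'v. D 0 = u \<and>
        (\<forall>k t. (D k has_vector_derivative D (Suc k) t) (at t)))"

text \<open>Elements of \<open>C\<^sub>0\<^sup>\<infinity>(I)\<close> are extended by zero to the whole line.\<close>

definition test_functions :: "real set \<Rightarrow> (real \<Rightarrow> 'v::real_normed_vector) set" where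
  "test_functions I =
     {u. smooth u \<and> (\<exists>K. compact K \<and> K \<subseteq> I \<and> (\<forall>t. t \<notin> K \<longrightarrow> u t = 0))}"

definition sl_expr ::
  "(real \<Rightarrow> real^'n^'n) \<Rightarrow> (real \<Rightarrow> real^'n^'n) \<Rightarrow> (real \<Rightarrow> real^'n^'n) \<Rightarrow>
   (real \<Rightarrow> real^'n) \<Rightarrow> real \<Rightarrow> real^'n"
where
  "sl_expr P Q R u t =
     - vector_derivative (\<lambda>s. P s *v vector_derivative u (at s) + Q s *v u s) (at t)
     + transpose (Q t) *v vector_derivative u (at t) + R t *v u t"

definition sl_minimal ::
  "ereal \<Rightarrow> ereal \<Rightarrow> (real \<Rightarrow> real^'n^'n) \<Rightarrow> (real \<Rightarrow> real^'n^'n) \<Rightarrow> (real \<Rightarrow> real^'n^'n) \<Rightarrow>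
   ((real^'n) l2 \<times> (real^'n) l2) set"
where
  "sl_minimal a b P Q R =
     closure ((\<lambda>u. (to_l2 u, to_l2 (sl_expr P Q R u))) ` test_functions (einterval a b))"

definition sl_bounded_below ::
  "ereal \<Rightarrow> ereal \<Rightarrow> (real \<Rightarrow> real^'n^'n) \<Rightarrow> (real \<Rightarrow> real^'n^'n) \<Rightarrow> (real \<Rightarrow> real^'n^'n) \<Rightarrow> bool"
where
  "sl_bounded_below a b P Q R \<longleftrightarrow>
     (\<exists>c. \<forall>u\<in>test_functions (einterval a b).
        c * (norm (to_l2 u))\<^sup>2 \<le> inner (to_l2 (sl_expr P Q R u)) (to_l2 u))"

end

theory Submission
  imports Defs
begin

text \<open>
  Write \<open>A\<close> for the map \<open>L\<^sup>*\<close> on \<open>X = D(L\<^sup>*)\<close>, \<open>N\<close> for its kernel, \<open>M = D(L) + \<Lambda>\<close> for the domain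
  of \<open>L\<^sub>\<Lambda>\<close> and \<open>F\<close> for the domain of the Friedrichs extension. The theorem rests on two facts.

  The first one turns Morse indices into linear algebra: for a self-adjoint operator that is
  bounded from below, the dimension of the negative spectral subspace is the largest dimension of
  a subspace of the domain on which \<open>\<langle>Ax, x\<rangle>\<close> is negative definite (\<open>morse_index_eq_neg_index\<close>).
  This applies to \<open>M\<close> and to \<open>F\<close>: both are self-adjoint domains (for \<open>F\<close> this is Friedrichs'
  theorem, \<open>lagr_MF\<close>), and since \<open>D(L)\<close> has finite codimension in \<open>X\<close>, boundedness from below
  passes from \<open>L\<close> to its extensions (\<open>lagr_bounded_below\<close>). The Morse index is defined by an
  arbitrary spectral resolution, so the spectral theorem has to provide one. It is proved for a
  semibounded operator through the bounded inverse \<open>T = (A + m)\<^sup>-\<^sup>1\<close>: the spectral subspace of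
  \<open>T\<^sup>-\<^sup>1\<close> for \<open>[0, s]\<close> consists of the vectors \<open>x\<close> for which all \<open>T\<^sup>-\<^sup>n x\<close> exist and have norm at most
  \<open>s\<^sup>n \<parallel>x\<parallel>\<close>, and the essential estimate is \<open>norm_le_on_perp\<close> on its orthogonal complement.

  The second fact compares the two forms on \<open>M + F\<close>. The form \<open>\<langle>Ax, x\<rangle>\<close> extends from \<open>M\<close> and
  from \<open>F\<close> to \<open>M + F\<close>, with \<open>\<langle>Ax, y\<rangle>\<close> as the product of \<open>x \<in> M\<close> and \<open>y \<in> F\<close>. The elements of \<open>F\<close>
  are limits of elements of \<open>D(L) \<subseteq> M\<close> in the form norm, so this extension has the same negative
  index as the form on \<open>M\<close> (\<open>neg_index_sum_form\<close>). On the other hand the orthogonal complement of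
  \<open>F\<close> in \<open>M + F\<close> is \<open>F' = N \<inter> (M + F)\<close>, and \<open>F \<inter> F' = N \<inter> F\<close> pairs trivially with \<open>M + F\<close>
  exactly on \<open>N \<inter> F \<inter> M\<close>. For a complement \<open>R\<close> of the latter in \<open>N \<inter> F\<close>, a purely algebraic
  formula (\<open>neg_index_formula\<close>) gives
  \<open>n(M + F) = n(F) + n(F') + dim R\<close>; its hypothesis that everything orthogonal to \<open>R\<close> lies in
  \<open>F + F'\<close> is where the closed range of the Fredholm operator enters (\<open>lagr_range\<close>).

  It remains to recognise the triple index of \<open>\<alpha> = p(N)\<close>, \<open>\<beta> = \<Lambda>\<close> and \<open>\<gamma> = p(F)\<close>
  (\<open>triple_index_eq\<close>). The projection \<open>p\<close> maps \<open>F'\<close> onto \<open>\<alpha> \<inter> (\<beta> + \<gamma>)\<close>, and for \<open>x + y \<in> N\<close>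
  with \<open>x \<in> M\<close>, \<open>y \<in> F\<close> the form of the triple takes the value \<open>- \<omega>(x + y, x)\<close> at \<open>p(x + y)\<close>, which is
  minus the value of the extended form at \<open>x + y\<close>. Hence \<open>n(F')\<close> is the positive index of the triple
  form, and \<open>dim R = dim (\<alpha> \<inter> \<gamma>) - dim (\<alpha> \<inter> \<beta> \<inter> \<gamma>)\<close>.
\<close>

section \<open>Finite-dimensional subspaces of real vector spaces\<close>

text \<open>
  The dimension of an infinite-dimensional space is \<open>0\<close> by convention, so finite-dimensionality
  accompanies every statement about \<open>dim\<close>.
\<close>

definition fin_dim :: "'a::real_vector set \<Rightarrow> bool" where
  "fin_dim V \<longleftrightarrow> (\<exists>B. finite B \<and> V \<subseteq> span B)"

lemma fin_dim_subset: "fin_dim W \<Longrightarrow> V \<subseteq> W \<Longrightarrow> fin_dim V"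
  unfolding fin_dim_def by blast

lemma fin_dim_basis:
  assumes "subspace V" "fin_dim V"
  obtains B where "finite B" "independent B" "span B = V" "card B = dim V"
proof -
  obtain B where B: "B \<subseteq> V" "independent B" "V \<subseteq> span B" "card B = dim V"
    using real_vector.basis_exists by blast
  obtain C where C: "finite C" "V \<subseteq> span C" using assms(2) unfolding fin_dim_def by blast
  have "finite B" using real_vector.independent_span_bound[OF C(1) B(2)] B(1) C(2) by blast
  moreover have "span B = V" using span_subspace[OF B(1,3) assms(1)] .
  ultimately show ?thesis using that B by blast
qed

lemma independent_card_le_dim_fin:
  assumes "fin_dim V" "subspace V" "independent B" "B \<subseteq> V"
  shows "finite B \<and> card B \<le> dim V"
proof -
  obtain C where "finite C" "independent C" "span C = V" "card C = dim V"
    using fin_dim_basis assms by blast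
  then show ?thesis using real_vector.independent_span_bound[of C B] assms by auto
qed

lemma dim_mono_fin:
  assumes "fin_dim W" "subspace W" "subspace V" "V \<subseteq> W"
  shows "dim V \<le> dim W"
proof -
  obtain B where "finite B" "independent B" "span B = V" "card B = dim V"
    using fin_dim_basis[OF assms(3) fin_dim_subset[OF assms(1,4)]] by blast
  moreover have "B \<subseteq> W" using assms(4) span_superset[of B] calculation(3) by blast
  ultimately show ?thesis
    using independent_card_le_dim_fin[OF assms(1,2), of B] by simp
qed

lemma fin_dim_span: "finite B \<Longrightarrow> fin_dim (span B)"
  unfolding fin_dim_def by blast

lemma subspace_set_plus:
  assumes "subspace (V::'a::real_vector set)" "subspace W" shows "subspace (V + W)"
proof -
  have "V + W = {x + y |x y. x \<in> V \<and> y \<in> W}" by (auto simp: set_plus_def)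
  then show ?thesis using subspace_sums[OF assms] by simp
qed

lemma set_plus_span: "span A + span B = span (A \<union> B)"
  by (auto simp: span_Un set_plus_def)

lemma fin_dim_plus:
  assumes "fin_dim V" "fin_dim W" shows "fin_dim (V + W)"
proof -
  obtain A B where "finite A" "V \<subseteq> span A" "finite B" "W \<subseteq> span B"
    using assms unfolding fin_dim_def by blast
  then have "V + W \<subseteq> span (A \<union> B)" "finite (A \<union> B)"
    using set_plus_mono2[of V "span A" W "span B"] by (auto simp: set_plus_span)
  then show ?thesis unfolding fin_dim_def by blast
qed

lemma dim_direct_sum:
  assumes "subspace V" "subspace W" "fin_dim V" "fin_dim W" "V \<inter> W = {0}"
  shows "dim (V + W) = dim V + dim W"
proof -
  obtain A where A: "finite A" "independent A" "span A = V" "card A = dim V"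
    using fin_dim_basis assms by blast
  obtain B where B: "finite B" "independent B" "span B = W" "card B = dim W"
    using fin_dim_basis assms by blast
  have ind: "independent (A \<union> C) \<and> A \<inter> C = {}" if "C \<subseteq> B" for C
    using finite_subset[OF that B(1)] that
  proof (induction C)
    case (insert x C)
    have "x \<notin> span (A \<union> C)"
    proof
      assume "x \<in> span (A \<union> C)"
      then obtain u v where uv: "x = u + v" "u \<in> span A" "v \<in> span C" by (auto simp: span_Un)
      have "u = x - v" using uv by simp
      moreover have "x \<in> span B" "v \<in> span B"
        using insert.prems uv(3) span_mono[of C B] span_superset[of B] by blast+
      ultimately have "u \<in> span B" using span_diff by blast
      then have "u = 0" using uv(2) A(3) B(3) assms(5) by blast
      then have "x \<in> span C" using uv by simp
      moreover have "independent (insert x C)"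
        using real_vector.independent_mono[OF B(2) insert.prems] .
      ultimately show False using insert.hyps by (simp add: real_vector.independent_insert)
    qed
    moreover have "x \<notin> A \<union> C" using calculation span_superset[of "A \<union> C"] by blast
    ultimately show ?case using insert
      by (simp add: real_vector.independent_insertI)
  qed (use A in auto)
  have "span (A \<union> B) = V + W" using set_plus_span[of A B] A B by simp
  then have "dim (V + W) = card (A \<union> B)"
    using ind[of B] real_vector.dim_span_eq_card_independent[of "A \<union> B"] by simp
  also have "\<dots> = dim V + dim W" using ind[of B] A(1,4) B(1,4) card_Un_disjoint[of A B] by simp
  finally show ?thesis .
qed

lemma dim_linear_image_inj:
  assumes "linear g" "subspace V" "fin_dim V" "\<And>x. x \<in> V \<Longrightarrow> g x = 0 \<Longrightarrow> x = 0"
  shows "dim (g ` V) = dim V"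
proof -
  obtain A where A: "finite A" "independent A" "span A = V" "card A = dim V"
    using fin_dim_basis assms by blast
  have inj: "inj_on g V"
  proof (rule inj_onI)
    fix x y assume "x \<in> V" "y \<in> V" "g x = g y"
    then have "g (x - y) = 0" "x - y \<in> V"
      using assms(1,2) by (auto simp: linear_diff subspace_diff)
    then show "x = y" using assms(4) by fastforce
  qed
  have "independent (g ` A)"
    using linear_independent_injective_image[of g A] assms(1) A inj by blast
  moreover have "span (g ` A) = g ` V" using A linear_span_image[OF assms(1)] by metis
  moreover have "card (g ` A) = card A"
    using card_image[of g A] inj A(3) span_superset[of A] inj_on_subset by metis
  ultimately show ?thesis using real_vector.dim_span_eq_card_independent[of "g ` A"] A by simp
qed

lemma fin_dim_linear_image:
  assumes "linear g" "fin_dim V" shows "fin_dim (g ` V)"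
proof -
  obtain B where "finite B" "V \<subseteq> span B" using assms unfolding fin_dim_def by blast
  then have "finite (g ` B)" "g ` V \<subseteq> span (g ` B)"
    using linear_span_image[OF assms(1), of B] by auto
  then show ?thesis unfolding fin_dim_def by blast
qed

text \<open>
  Operators and projections here are only defined on a subspace. Extending them to linear maps
  of the whole type, by prescribing values on a basis, removes all domain conditions from
  algebraic computations with them.
\<close>

lemma linear_extension:
  fixes f :: "'a::real_vector \<Rightarrow> 'b::real_vector"
  assumes X: "subspace X"
    and add: "\<And>x y. x \<in> X \<Longrightarrow> y \<in> X \<Longrightarrow> f (x + y) = f x + f y"
    and scale: "\<And>c x. x \<in> X \<Longrightarrow> f (c *\<^sub>R x) = c *\<^sub>R f x"
  obtains g where "linear g" "\<forall>x\<in>X. g x = f x"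
proof -
  obtain B where B: "B \<subseteq> X" "independent B" "X \<subseteq> span B"
    using real_vector.maximal_independent_subset[of X] by blast
  obtain g where g: "linear g" "\<forall>x\<in>B. g x = f x"
    using linear_independent_extend[OF B(2), of f] by blast
  have f0: "f 0 = 0" using scale[of 0 0] subspace_0[OF X] by simp
  have sX: "span B = X" using span_subspace[OF B(1,3) X] .
  have "x \<in> X \<and> g x = f x" if "x \<in> span B" for x
    using that
  proof (induction rule: span_induct_alt)
    case base then show ?case using f0 g(1) subspace_0[OF X] by (simp add: linear_0)
  next
    case (step c x y)
    have x: "x \<in> X" using step(1) B by blast
    have "g (c *\<^sub>R x + y) = c *\<^sub>R f x + f y"
      using g step by (simp add: linear_add linear_scale)
    moreover have "f (c *\<^sub>R x + y) = c *\<^sub>R f x + f y"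
      using add[of "c *\<^sub>R x" y] scale[OF x, of c] x step X by (simp add: subspace_scale)
    ultimately show ?case using x step X by (simp add: subspace_scale subspace_add)
  qed
  then show ?thesis using that g(1) sX by blast
qed

lemma dim_kernel_functional:
  fixes f :: "'a::real_vector \<Rightarrow> real"
  assumes "subspace V" "fin_dim V" "linear f"
  shows "dim V \<le> dim {x\<in>V. f x = 0} + 1"
proof (cases "\<exists>x0\<in>V. f x0 \<noteq> 0")
  case True
  then obtain x0 where x0: "x0 \<in> V" "f x0 \<noteq> 0" by blast
  let ?K = "{x\<in>V. f x = 0}"
  have K: "subspace ?K" using assms
    by (auto simp: subspace_def linear_0 linear_add linear_scale)
  obtain A where A: "finite A" "independent A" "span A = ?K" "card A = dim ?K"
    using fin_dim_basis[OF K fin_dim_subset[OF assms(2)]] by blast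
  have "V \<subseteq> span (insert x0 A)"
  proof
    fix x assume x: "x \<in> V"
    have "x - (f x / f x0) *\<^sub>R x0 \<in> ?K"
      using x x0 assms by (auto simp: subspace_diff subspace_scale linear_diff linear_scale)
    then show "x \<in> span (insert x0 A)"
      unfolding span_breakdown_eq using A(3) by blast
  qed
  then have "dim V \<le> card (insert x0 A)" using A(1) real_vector.dim_le_card by blast
  then show ?thesis using A card_insert_le_m1[of "card A + 1" A x0] by (simp add: card_insert_if split: if_splits)
next
  case False
  then have "{x\<in>V. f x = 0} = V" by blast
  then show ?thesis by simp
qed

lemma dim_kernel_functionals:
  fixes f :: "'b \<Rightarrow> 'a::real_vector \<Rightarrow> real"
  assumes "subspace V" "fin_dim V" "finite B" "\<And>r. r \<in> B \<Longrightarrow> linear (f r)"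
  shows "dim V \<le> dim {x\<in>V. \<forall>r\<in>B. f r x = 0} + card B"
  using assms(3,4)
proof (induction B)
  case (insert r B)
  let ?K = "{x\<in>V. \<forall>r\<in>B. f r x = 0}"
  have "subspace ?K" using assms(1) insert.prems
    by (auto simp: subspace_def linear_0 linear_add linear_scale)
  then have "dim ?K \<le> dim {x\<in>?K. f r x = 0} + 1"
    using insert.prems fin_dim_subset[OF assms(2)] by (intro dim_kernel_functional) auto
  moreover have "{x\<in>?K. f r x = 0} = {x\<in>V. \<forall>r\<in>insert r B. f r x = 0}" by auto
  ultimately show ?case using insert by auto
qed simp

text \<open>
  The dimension count behind all comparisons of indices below: with fewer functionals than
  dimensions there is a nonzero vector on which all of them vanish.
\<close>

lemma common_zero_of_functionals:
  fixes f :: "'b \<Rightarrow> 'a::real_vector \<Rightarrow> real"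
  assumes "subspace V" "fin_dim V" "finite B" "\<And>r. r \<in> B \<Longrightarrow> linear (f r)" "card B < dim V"
  obtains x where "x \<in> V" "x \<noteq> 0" "\<forall>r\<in>B. f r x = 0"
proof -
  let ?K = "{x\<in>V. \<forall>r\<in>B. f r x = 0}"
  have "dim V \<le> dim ?K + card B"
    by (rule dim_kernel_functionals[OF assms(1-3)]) (rule assms(4))
  then have "dim ?K > 0" using assms(5) by linarith
  then have "\<not> ?K \<subseteq> {0}"
    using real_vector.dim_le_card[of ?K "{}"] by (auto simp: span_empty)
  then show ?thesis using that by blast
qed

lemma fin_dim_if_bounded:
  assumes "\<And>B. finite B \<Longrightarrow> independent B \<Longrightarrow> B \<subseteq> V \<Longrightarrow> card B \<le> k"
  shows "fin_dim V"
proof -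
  obtain B where B: "B \<subseteq> V" "independent B" "V \<subseteq> span B"
    using real_vector.maximal_independent_subset[of V] by blast
  have "finite B"
  proof (rule ccontr)
    assume "infinite B"
    then obtain C where "C \<subseteq> B" "finite C" "card C = Suc k"
      using infinite_arbitrarily_large by blast
    then show False using assms[of C] B real_vector.independent_mono by fastforce
  qed
  then show ?thesis unfolding fin_dim_def using B by blast
qed

section \<open>The negative index of a quadratic form\<close>

definition neg_def :: "('a::real_vector \<Rightarrow> real) \<Rightarrow> 'a set \<Rightarrow> bool" where
  "neg_def q V \<longleftrightarrow> subspace V \<and> fin_dim V \<and> (\<forall>x\<in>V. x \<noteq> 0 \<longrightarrow> q x < 0)"

text \<open>
  The supremum of the dimensions of the finite-dimensional negative definite subspaces; it is
  infinite precisely if these dimensions are unbounded. The domain \<open>X\<close> may be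
  infinite-dimensional.
\<close>

definition neg_index :: "('a::real_vector \<Rightarrow> real) \<Rightarrow> 'a set \<Rightarrow> enat" where
  "neg_index q X = (SUP V\<in>{V. neg_def q V \<and> V \<subseteq> X}. enat (dim V))"

lemma neg_defD:
  assumes "neg_def q V"
  shows "subspace V" "fin_dim V" "x \<in> V \<Longrightarrow> x \<noteq> 0 \<Longrightarrow> q x < 0"
  using assms by (simp_all add: neg_def_def)

lemma neg_index_upper: "neg_def q V \<Longrightarrow> V \<subseteq> X \<Longrightarrow> enat (dim V) \<le> neg_index q X"
  unfolding neg_index_def by (rule SUP_upper) simp

lemma neg_index_least:
  "(\<And>V. neg_def q V \<Longrightarrow> V \<subseteq> X \<Longrightarrow> enat (dim V) \<le> k) \<Longrightarrow> neg_index q X \<le> k"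
  unfolding neg_index_def by (rule SUP_least) simp

lemma neg_index_mono: "X \<subseteq> Y \<Longrightarrow> neg_index q X \<le> neg_index q Y"
  by (rule neg_index_least) (auto intro: neg_index_upper)

text \<open>
  A negative definite subspace can be transported along a linear relation that preserves the
  form: lift a basis, extend linearly, and observe that the lift is injective because it
  preserves negative values. Relations, instead of linear maps, allow transport against the
  direction of a map that is onto but not injective.
\<close>

lemma neg_index_le_of_relation:
  fixes \<rho> :: "('a::real_vector \<times> 'b::real_vector) set"
  assumes \<rho>: "subspace \<rho>"
    and total: "\<And>x. x \<in> X \<Longrightarrow> \<exists>y\<in>Y. (x, y) \<in> \<rho>"
    and q: "\<And>x y. x \<in> X \<Longrightarrow> (x, y) \<in> \<rho> \<Longrightarrow> q' y = q x"
    and Y: "subspace Y" and "q 0 = 0"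
  shows "neg_index q X \<le> neg_index q' Y"
proof (rule neg_index_least)
  fix V assume V: "neg_def q V" "V \<subseteq> X"
  obtain B where B: "finite B" "independent B" "span B = V" "card B = dim V"
    by (rule fin_dim_basis[OF neg_defD(1,2)[OF V(1)]])
  have "\<forall>x\<in>B. \<exists>y\<in>Y. (x, y) \<in> \<rho>" using total V B span_superset by blast
  then obtain f where f: "\<And>x. x \<in> B \<Longrightarrow> f x \<in> Y \<and> (x, f x) \<in> \<rho>" by metis
  obtain g where g: "linear g" "\<forall>x\<in>B. g x = f x"
    using linear_independent_extend[OF B(2), of f] by blast
  have gV: "g x \<in> Y \<and> (x, g x) \<in> \<rho>" if "x \<in> V" for x
    using that unfolding B(3)[symmetric]
  proof (induction rule: span_induct_alt)
    case base then show ?case using g \<rho> Y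
      by (metis linear_0 subspace_0 zero_prod_def)
  next
    case (step c x y)
    have "c *\<^sub>R (x, g x) + (y, g y) \<in> \<rho>"
      using \<rho> step f g by (intro subspace_add subspace_scale) auto
    moreover have "c *\<^sub>R g x + g y \<in> Y" 
      using Y step f g by (intro subspace_add subspace_scale) auto
    ultimately show ?case using g(1) by (simp add: linear_add linear_scale)
  qed
  have q': "q' (g x) = q x" if "x \<in> V" for x using q gV that V by blast
  have inj: "x = 0" if "x \<in> V" "g x = 0" for x
  proof (rule ccontr)
    assume "x \<noteq> 0"
    then have "q x < 0" using V that unfolding neg_def_def by blast
    moreover have "q' 0 = q 0" using q' that V(1) g(1) unfolding neg_def_def
      by (metis linear_0 subspace_0)
    ultimately show False using q'[OF that(1)] that \<open>q 0 = 0\<close> by simp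
  qed
  have "neg_def q' (g ` V)" unfolding neg_def_def
    using V g(1) q' linear_subspace_image fin_dim_linear_image linear_0[OF g(1)] 
    unfolding neg_def_def by fastforce
  moreover have "dim (g ` V) = dim V"
    using dim_linear_image_inj[OF g(1)] V inj unfolding neg_def_def by blast
  ultimately show "enat (dim V) \<le> neg_index q' Y"
    using neg_index_upper[of q' "g ` V" Y] gV by auto
qed

lemma bilinear_zero_on_span_right:
  fixes b :: "'a::real_vector \<Rightarrow> 'a \<Rightarrow> real"
  assumes "bilinear b" "v \<in> span B" "\<And>u. u \<in> B \<Longrightarrow> b x u = 0" shows "b x v = 0"
  using assms(2) by (induction rule: span_induct_alt)
    (auto simp: bilinear_rzero[OF assms(1)] bilinear_radd[OF assms(1)] bilinear_rmul[OF assms(1)] assms(3))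

locale symmetric_form =
  fixes X :: "'a::real_vector set" and b :: "'a \<Rightarrow> 'a \<Rightarrow> real"
  assumes subspace: "subspace X" and bilinear: "bilinear b"
    and sym: "\<And>x y. x \<in> X \<Longrightarrow> y \<in> X \<Longrightarrow> b x y = b y x"
begin

lemmas simps = bilinear_ladd[OF bilinear] bilinear_radd[OF bilinear] bilinear_lmul[OF bilinear]
  bilinear_rmul[OF bilinear] bilinear_lneg[OF bilinear] bilinear_rneg[OF bilinear]
  bilinear_lsub[OF bilinear] bilinear_rsub[OF bilinear] bilinear_lzero[OF bilinear]
  bilinear_rzero[OF bilinear]

lemma linear_left: "linear (\<lambda>x. b x y)"
  using bilinear unfolding bilinear_def by blast

lemma zero_on_span_right:
  assumes "v \<in> span B" "\<And>u. u \<in> B \<Longrightarrow> b x u = 0" shows "b x v = 0"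
  by (rule bilinear_zero_on_span_right[OF bilinear assms])

lemma restrict: "subspace Y \<Longrightarrow> Y \<subseteq> X \<Longrightarrow> symmetric_form Y b"
  using sym bilinear by unfold_locales auto

end

text \<open>
  Gram--Schmidt orthogonalisation works for definite forms of either sign; it is used for
  negative definite forms and for inner products.
\<close>

lemma form_projection:
  fixes b :: "'a::real_vector \<Rightarrow> 'a \<Rightarrow> real"
  assumes b: "bilinear b" and V: "subspace V" "fin_dim V"
    and definite: "\<And>x. x \<in> V \<Longrightarrow> b x x = 0 \<Longrightarrow> x = 0"
  obtains v where "v \<in> V" "\<And>u. u \<in> V \<Longrightarrow> b (x - v) u = 0"
proof -
  note simps = bilinear_ladd[OF b] bilinear_radd[OF b] bilinear_lmul[OF b]
    bilinear_rmul[OF b] bilinear_lsub[OF b] bilinear_rsub[OF b] bilinear_lzero[OF b]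
    bilinear_rzero[OF b]
  obtain B where B: "finite B" "span B = V" using fin_dim_basis[OF V] by metis
  have *: "\<forall>x. \<exists>v\<in>span C. \<forall>u\<in>span C. b (x - v) u = 0" if "C \<subseteq> B" for C
    using finite_subset[OF that B(1)] that
  proof (induction C)
    case empty then show ?case by (auto simp: simps)
  next
    case (insert w C)
    then have "\<forall>x. \<exists>v. v \<in> span C \<and> (\<forall>u\<in>span C. b (x - v) u = 0)" by blast
    then obtain P where P: "\<And>x. P x \<in> span C" "\<And>x u. u \<in> span C \<Longrightarrow> b (x - P x) u = 0"
      by metis
    \<comment> \<open>Gram--Schmidt: \<open>w'\<close> is the new basis vector made orthogonal to the span of the previous ones.\<close>
    define w' where "w' = w - P w"
    have w'V: "w' \<in> span (insert w C)"
    proof -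
      have "P w \<in> span (insert w C)" using P(1)[of w] span_mono[of C "insert w C"] by blast
      then show ?thesis unfolding w'_def by (simp add: span_diff span_base)
    qed
    show ?case
    proof
      fix x
      define c where "c = b (x - P x) w' / b w' w'"
      define v where "v = P x + c *\<^sub>R w'"
      have w'0: "b w' w' = 0 \<Longrightarrow> w' = 0"
        using definite w'V insert.prems B(2) span_mono[of "insert w C" B] by blast
      have v: "v \<in> span (insert w C)" unfolding v_def
        using P(1) span_mono[of C "insert w C"] w'V by (intro span_add span_scale) auto
      have 1: "b (x - v) u = 0" if "u \<in> span C" for u
      proof -
        have "x - v = (x - P x) - c *\<^sub>R w'" by (simp add: v_def)
        then have "b (x - v) u = b (x - P x) u - c * b (w - P w) u"
          unfolding w'_def by (metis bilinear_lsub[OF b] bilinear_lmul[OF b] real_scaleR_def)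
        then show ?thesis using P(2)[OF that] by simp
      qed
      have 2: "b (x - v) w' = 0"
      proof (cases "b w' w' = 0")
        case True then show ?thesis using w'0 by (simp add: simps)
      next
        case False
        have "x - v = (x - P x) - c *\<^sub>R w'" by (simp add: v_def)
        then have "b (x - v) w' = b (x - P x) w' - c * b w' w'"
          by (metis bilinear_lsub[OF b] bilinear_lmul[OF b] real_scaleR_def)
        then show ?thesis using False by (simp add: c_def)
      qed
      have "b (x - v) u = 0" if "u \<in> span (insert w C)" for u
        using b that
      proof (rule bilinear_zero_on_span_right)
        fix y assume y: "y \<in> insert w C"
        have "b (x - v) w = b (x - v) w' + b (x - v) (P w)" by (simp add: w'_def simps)
        then have "b (x - v) w = 0" using 1[OF P(1)] 2 by simp
        then show "b (x - v) y = 0" using y 1[OF span_base] by blast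
      qed
      then show "\<exists>v\<in>span (insert w C). \<forall>u\<in>span (insert w C). b (x - v) u = 0"
        using v by blast
    qed
  qed
  show ?thesis using *[OF order_refl] that unfolding B(2) by blast
qed

context symmetric_form
begin

abbreviation q where "q x \<equiv> b x x"

text \<open>
  If the dimensions are bounded, take one of maximal dimension: a vector orthogonal to it on
  which the form is negative could be added to it.
\<close>

lemma neg_def_maximal_extension:
  assumes fin: "neg_index q X \<noteq> \<infinity>" and V0: "neg_def q V0" "V0 \<subseteq> X"
  obtains V where "neg_def q V" "V0 \<subseteq> V" "V \<subseteq> X"
    "\<forall>x\<in>X. (\<forall>v\<in>V. b x v = 0) \<longrightarrow> q x \<ge> 0"
proof -
  obtain k where k: "neg_index q X = enat k" using fin by auto
  define P where "P V \<longleftrightarrow> neg_def q V \<and> V0 \<subseteq> V \<and> V \<subseteq> X" for V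
  have "\<forall>V. P V \<longrightarrow> dim V < Suc k"
    using neg_index_upper[of q _ X] k unfolding P_def by (metis enat_ord_simps(1) less_Suc_eq_le)
  then obtain V where V: "P V" "\<And>V'. P V' \<Longrightarrow> dim V' \<le> dim V"
    using ex_has_greatest_nat[of P V0 dim "Suc k"] V0 P_def by blast
  have "q x \<ge> 0" if x: "x \<in> X" "\<And>v. v \<in> V \<Longrightarrow> b x v = 0" for x
  proof (rule ccontr)
    assume neg: "\<not> q x \<ge> 0"
    have x0: "x \<noteq> 0" using neg by (auto simp: simps)
    have int: "V \<inter> span {x} = {0}"
    proof -
      have "y = 0" if y: "y \<in> V" "y = k *\<^sub>R x" for y k
      proof -
        have "k * q x = 0" using x(2)[OF y(1)] y(2) by (simp add: simps)
        then show ?thesis using neg y by auto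
      qed
      then show ?thesis using V(1) unfolding P_def neg_def_def span_singleton
        by (auto simp: subspace_0)
    qed
    have "q y < 0" if y: "y \<in> V + span {x}" "y \<noteq> 0" for y
    proof -
      obtain v k where vk: "v \<in> V" "y = v + k *\<^sub>R x" using y(1)
        by (auto simp: set_plus_def span_singleton)
      have bx: "b x v = 0" "b v x = 0"
        using x vk(1) sym[of v x] V(1) unfolding P_def by auto
      have eq: "q y = q v + k\<^sup>2 * q x" unfolding vk(2)
        by (simp add: simps bx power2_eq_square)
      show ?thesis
      proof (cases "v = 0")
        case True
        then have "k \<noteq> 0" using vk y(2) by auto
        then show ?thesis using eq True neg by (simp add: simps mult_pos_neg)
      next
        case False
        then have "q v < 0" using V(1) vk(1) unfolding P_def unfolding neg_def_def by blast
        moreover have "k\<^sup>2 * q x \<le> 0" using neg by (simp add: mult_nonneg_nonpos)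
        ultimately show ?thesis using eq by simp
      qed
    qed
    then have nd: "\<forall>y\<in>V + span {x}. y \<noteq> 0 \<longrightarrow> q y < 0" by blast
    have sf: "subspace (V + span {x})" "fin_dim (V + span {x})"
      using V(1) unfolding P_def neg_def_def
      by (auto simp: subspace_set_plus fin_dim_plus fin_dim_span)
    have "V \<subseteq> V + span {x}"
      using set_zero_plus2[of "span {x}" V] by (simp add: add.commute span_zero)
    moreover have "V + span {x} \<subseteq> X"
      using V(1) x(1) subspace unfolding P_def
      by (auto simp: set_plus_def span_singleton subset_iff intro!: subspace_add subspace_scale)
    ultimately have "P (V + span {x})"
      using V(1) nd sf order_trans[of V0 V] unfolding P_def neg_def_def by simp
    moreover have "dim (V + span {x}) = dim V + dim (span {x})"
      using V(1) int by (intro dim_direct_sum) (simp_all add: P_def neg_def_def fin_dim_span)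
    moreover have "dim (span {x}) = 1"
      using x0 real_vector.dim_span_eq_card_independent[of "{x}"] by simp
    ultimately show False using V(2)[of "V + span {x}"] by linarith
  qed
  then have "\<forall>x\<in>X. (\<forall>v\<in>V. b x v = 0) \<longrightarrow> q x \<ge> 0" by blast
  moreover have "neg_def q V" "V0 \<subseteq> V" "V \<subseteq> X" using V(1) unfolding P_def by blast+
  ultimately show ?thesis using that by blast
qed

text \<open>
  The converse of the maximality argument: a negative definite subspace of larger dimension
  would contain a nonzero vector orthogonal to \<open>V\<close>.
\<close>

lemma neg_index_eq_dim:
  assumes V: "neg_def q V" "V \<subseteq> X"
    and pos: "\<forall>x\<in>X. (\<forall>v\<in>V. b x v = 0) \<longrightarrow> q x \<ge> 0"
  shows "neg_index q X = enat (dim V)"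
proof (rule antisym)
  show "neg_index q X \<le> enat (dim V)"
  proof (rule neg_index_least)
    fix U assume U: "neg_def q U" "U \<subseteq> X"
    obtain B where B: "finite B" "independent B" "span B = V" "card B = dim V"
      by (rule fin_dim_basis[OF neg_defD(1,2)[OF V(1)]])
    show "enat (dim U) \<le> enat (dim V)"
    proof (rule ccontr)
      assume "\<not> ?thesis"
      then have less: "card B < dim U" using B(4) by simp
      obtain x where x: "x \<in> U" "x \<noteq> 0" "\<forall>r\<in>B. b x r = 0"
        by (rule common_zero_of_functionals[where f="\<lambda>r x. b x r", OF neg_defD(1,2)[OF U(1)] B(1) linear_left less])
      have "b x v = 0" if "v \<in> V" for v
        using zero_on_span_right[of v B x] that x(3) B(3) by blast
      then have "q x \<ge> 0" using pos U(2) x(1) by blast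
      then show False using neg_defD(3)[OF U(1) x(1,2)] by simp
    qed
  qed
  show "enat (dim V) \<le> neg_index q X" by (rule neg_index_upper[OF V])
qed

lemma neg_index_sum_orthogonal:
  assumes Z: "subspace Z" "Z \<subseteq> X" and Z': "subspace Z'" "Z' \<subseteq> X"
    and orth: "\<And>z z'. z \<in> Z \<Longrightarrow> z' \<in> Z' \<Longrightarrow> b z z' = 0"
    and V: "neg_def q V" "V \<subseteq> Z" "\<forall>x\<in>Z. (\<forall>v\<in>V. b x v = 0) \<longrightarrow> q x \<ge> 0"
    and V': "neg_def q V'" "V' \<subseteq> Z'" "\<forall>x\<in>Z'. (\<forall>v\<in>V'. b x v = 0) \<longrightarrow> q x \<ge> 0"
  shows "neg_def q (V + V')" "dim (V + V') = dim V + dim V'"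
    "neg_index q (Z + Z') = enat (dim V + dim V')"
proof -
  have orth': "b z' z = 0" if "z \<in> Z" "z' \<in> Z'" for z z'
    using orth[OF that] sym that Z Z' by (metis subset_iff)
  note VV = V(1)[unfolded neg_def_def] V'(1)[unfolded neg_def_def]
  have int: "V \<inter> V' = {0}"
  proof -
    have "x = 0" if "x \<in> V" "x \<in> V'" for x
      using orth[of x x] that V V' VV by (metis order.strict_iff_not order_refl subset_iff)
    moreover have "0 \<in> V" "0 \<in> V'" using VV by (simp_all add: subspace_0)
    ultimately show ?thesis by blast
  qed
  show dim: "dim (V + V') = dim V + dim V'"
    using VV int by (intro dim_direct_sum) simp_all
  have sumq: "q (z + z') = q z + q z'" if "z \<in> Z" "z' \<in> Z'" for z z'
    using orth orth' that by (simp add: simps)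
  have "q x < 0" if x: "x \<in> V + V'" "x \<noteq> 0" for x
  proof -
    obtain v v' where vv: "v \<in> V" "v' \<in> V'" "x = v + v'" using x(1) by (auto simp: set_plus_def)
    have "v \<noteq> 0 \<Longrightarrow> q v < 0" "v' \<noteq> 0 \<Longrightarrow> q v' < 0" using vv VV by simp_all
    moreover have "q x = q v + q v'" using sumq[of v v'] vv V(2) V'(2) by blast
    moreover have "v \<noteq> 0 \<or> v' \<noteq> 0" using vv x(2) by auto
    moreover have "q 0 = 0" by (simp add: simps)
    ultimately show ?thesis by (cases "v = 0"; cases "v' = 0") simp_all
  qed
  then show nd: "neg_def q (V + V')" unfolding neg_def_def
    using VV by (simp add: subspace_set_plus fin_dim_plus)
  have ZZ: "Z + Z' \<subseteq> X" using Z Z' subspace by (auto simp: set_plus_def subset_iff subspace_add)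
  interpret S: symmetric_form "Z + Z'" b
    by (rule restrict[OF subspace_set_plus[OF Z(1) Z'(1)] ZZ])
  have "neg_index q (Z + Z') = enat (dim (V + V'))"
  proof (rule S.neg_index_eq_dim[OF nd])
    show "V + V' \<subseteq> Z + Z'" by (rule set_plus_mono2[OF V(2) V'(2)])
    show "\<forall>x\<in>Z + Z'. (\<forall>v\<in>V + V'. b x v = 0) \<longrightarrow> q x \<ge> 0"
    proof (intro ballI impI)
    fix x assume x: "x \<in> Z + Z'" "\<forall>v\<in>V + V'. b x v = 0"
    then obtain z z' where zz: "z \<in> Z" "z' \<in> Z'" "x = z + z'" by (auto simp: set_plus_def)
    have "b z v = 0" if "v \<in> V" for v
    proof -
      have "v + 0 \<in> V + V'" using that VV by (intro set_plus_intro) (simp_all add: subspace_0)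
      then have "b x v = 0" using x(2) by force
      moreover have "b z' v = 0" using orth'[of v z'] that V(2) zz(2) by blast
      ultimately show ?thesis unfolding zz(3) by (simp add: simps)
    qed
    moreover have "b z' v = 0" if "v \<in> V'" for v
    proof -
      have "0 + v \<in> V + V'" using that VV by (intro set_plus_intro) (simp_all add: subspace_0)
      then have "b x v = 0" using x(2) by force
      moreover have "b z v = 0" using orth[of z v] that V'(2) zz(1) by blast
      ultimately show ?thesis unfolding zz(3) by (simp add: simps)
    qed
    ultimately have "q z \<ge> 0" "q z' \<ge> 0" using V(3) V'(3) zz(1,2) by blast+
    then show "q x \<ge> 0" using sumq[OF zz(1,2)] zz(3) by simp
    qed
  qed
  then show "neg_index q (Z + Z') = enat (dim V + dim V')" using dim by simp
qed

text \<open>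
  A hyperbolic plane contributes one negative dimension, and \<open>R\<close> counts the hyperbolic planes
  that are not visible in \<open>Z + Z'\<close>. Upper bound: \<open>dim R\<close> functionals cut a negative definite
  subspace down to one in \<open>Z + Z'\<close>, where the indices of the orthogonal summands add up. Lower
  bound: extend maximal negative definite subspaces of \<open>Z\<close> and \<open>Z'\<close> to a maximal one, \<open>M\<close>, in
  \<open>X\<close>. An element of \<open>R\<close> orthogonal to \<open>M\<close> is isotropic in the nonnegative complement of \<open>M\<close>,
  hence orthogonal to everything, hence \<open>0\<close>. So \<open>R\<close> acts faithfully by functionals on \<open>M\<close>, and
  these vanish on the part coming from \<open>Z\<close> and \<open>Z'\<close>; therefore \<open>M\<close> has at least \<open>dim R\<close> further
  dimensions.
\<close>

theorem neg_index_formula: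
  assumes Z: "subspace Z" "Z \<subseteq> X"
  defines "Z' \<equiv> {x\<in>X. \<forall>z\<in>Z. b x z = 0}"
  assumes R: "subspace R" "fin_dim R" "R \<subseteq> Z \<inter> Z'"
    and nondeg: "\<And>r. r \<in> R \<Longrightarrow> (\<And>x. x \<in> X \<Longrightarrow> b r x = 0) \<Longrightarrow> r = 0"
    and perp: "\<And>x. x \<in> X \<Longrightarrow> (\<And>r. r \<in> R \<Longrightarrow> b x r = 0) \<Longrightarrow> x \<in> Z + Z'"
  shows "neg_index q X = neg_index q Z + neg_index q Z' + enat (dim R)"
proof -
  have Z'X: "Z' \<subseteq> X" by (auto simp: Z'_def)
  have sZ': "subspace Z'" unfolding Z'_def using subspace
    by (auto simp: subspace_def simps)
  show ?thesis
  proof (cases "neg_index q Z = \<infinity> \<or> neg_index q Z' = \<infinity>")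
    case True
    then show ?thesis using neg_index_mono[OF Z(2), of q] neg_index_mono[OF Z'X, of q] by auto
  next
    case False
    interpret Z: symmetric_form Z b by (rule restrict[OF Z])
    interpret Z': symmetric_form Z' b by (rule restrict[OF sZ' Z'X])
    have nd0: "neg_def q {0}" by (auto simp: neg_def_def fin_dim_def intro: exI[of _ "{}"])
    have finZ: "neg_index q Z \<noteq> \<infinity>" and zeroZ: "{0} \<subseteq> Z"
      using False subspace_0[OF Z(1)] by simp_all
    obtain V where "neg_def q V" "{0} \<subseteq> V" "V \<subseteq> Z"
      "\<forall>x\<in>Z. (\<forall>v\<in>V. b x v = 0) \<longrightarrow> q x \<ge> 0"
      by (rule Z.neg_def_maximal_extension[OF finZ nd0 zeroZ])
    note V = this(1,3,4)
    have finZ': "neg_index q Z' \<noteq> \<infinity>" and zeroZ': "{0} \<subseteq> Z'"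
      using False subspace_0[OF sZ'] by simp_all
    obtain V' where "neg_def q V'" "{0} \<subseteq> V'" "V' \<subseteq> Z'"
      "\<forall>x\<in>Z'. (\<forall>v\<in>V'. b x v = 0) \<longrightarrow> q x \<ge> 0"
      by (rule Z'.neg_def_maximal_extension[OF finZ' nd0 zeroZ'])
    note V' = this(1,3,4)
    have orth: "b z z' = 0" if "z \<in> Z" "z' \<in> Z'" for z z'
      using that sym[of z z'] Z unfolding Z'_def by auto
    note sum = neg_index_sum_orthogonal[OF Z sZ' Z'X orth V V']
    have Zn: "neg_index q Z = enat (dim V)" by (rule Z.neg_index_eq_dim[OF V])
    have Z'n: "neg_index q Z' = enat (dim V')" by (rule Z'.neg_index_eq_dim[OF V'])
    obtain B where B: "finite B" "independent B" "span B = R" "card B = dim R"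
      by (rule fin_dim_basis[OF R(1,2)])
    have BR: "b x r = 0" if "r \<in> R" "\<And>r. r \<in> B \<Longrightarrow> b x r = 0" for x r
      using zero_on_span_right[of r B x] that B(3) by blast
    have up: "dim U \<le> dim V + dim V' + dim R" if U: "neg_def q U" "U \<subseteq> X" for U
    proof -
      let ?K = "{x\<in>U. \<forall>r\<in>B. b x r = 0}"
      have "dim U \<le> dim ?K + card B"
        by (rule dim_kernel_functionals[where f="\<lambda>r x. b x r", OF neg_defD(1,2)[OF U(1)] B(1) linear_left])
      moreover have "?K \<subseteq> Z + Z'"
      proof
        fix x assume x: "x \<in> ?K"
        show "x \<in> Z + Z'"
        proof (rule perp)
          show "x \<in> X" using x U(2) by blast
          show "b x r = 0" if "r \<in> R" for r using BR[OF that] x by blast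
        qed
      qed
      moreover have "neg_def q ?K"
      proof -
        have "subspace ?K" using neg_defD(1)[OF U(1)] by (simp add: subspace_def simps)
        moreover have "fin_dim ?K" by (rule fin_dim_subset[OF neg_defD(2)[OF U(1)]]) simp
        ultimately show ?thesis using neg_defD(3)[OF U(1)] by (simp add: neg_def_def)
      qed
      ultimately show ?thesis using neg_index_upper[of q ?K "Z + Z'"] sum(3) B(4) by simp
    qed
    have le: "neg_index q X \<le> enat (dim V + dim V' + dim R)"
      using up by (intro neg_index_least) simp
    then have fin: "neg_index q X \<noteq> \<infinity>" by (cases "neg_index q X") simp_all
    have VX: "V \<subseteq> X" "V' \<subseteq> X" using V(2) V'(2) Z(2) Z'X by blast+
    have VVX: "V + V' \<subseteq> X"
      using VX subspace by (auto simp: set_plus_def subset_iff subspace_add)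
    obtain M where M: "neg_def q M" "V + V' \<subseteq> M" "M \<subseteq> X"
      "\<forall>x\<in>X. (\<forall>v\<in>M. b x v = 0) \<longrightarrow> q x \<ge> 0"
      by (rule neg_def_maximal_extension[OF fin sum(1) VVX])
    have RX: "R \<subseteq> X" using R(3) Z'X by blast
    have Rq: "q r = 0" if "r \<in> R" for r using that R(3) unfolding Z'_def by blast
    have RM: "r = 0" if r: "r \<in> R" "\<And>v. v \<in> M \<Longrightarrow> b r v = 0" for r
    proof (rule nondeg[OF r(1)])
      fix x assume x: "x \<in> X"
      have Mdef: "v = 0" if "v \<in> M" "q v = 0" for v
        using neg_defD(3)[OF M(1) that(1)] that(2) by (cases "v = 0") simp_all
      obtain v where v: "v \<in> M" "\<And>u. u \<in> M \<Longrightarrow> b (x - v) u = 0"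
        using form_projection[OF bilinear neg_defD(1,2)[OF M(1)] Mdef] by metis
      define y where "y = x - v"
      have yX: "y \<in> X" using x v(1) M(3) subspace unfolding y_def by (simp add: subspace_diff subset_iff)
      have rX: "r \<in> X" using RX r(1) by blast
      have bry: "b r x = b r y" using r(2)[OF v(1)] by (simp add: y_def simps)
      have "q (y + c *\<^sub>R r) \<ge> 0" for c
      proof -
        have "y + c *\<^sub>R r \<in> X" using yX rX subspace by (simp add: subspace_add subspace_scale)
        moreover have "\<forall>u\<in>M. b (y + c *\<^sub>R r) u = 0"
          using v(2) r(2) by (simp add: simps y_def)
        ultimately show ?thesis using M(4) by blast
      qed
      moreover have "q (y + c *\<^sub>R r) = q y + 2 * c * b r y" for c
        using sym[OF yX rX] Rq[OF r(1)] by (simp add: simps)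
      ultimately have *: "q y + 2 * c * b r y \<ge> 0" for c by metis
      show "b r x = 0"
      proof (rule ccontr)
        assume "b r x \<noteq> 0"
        then have "b r y \<noteq> 0" using bry by simp
        then have "2 * ((- q y - 1) / (2 * b r y)) * b r y = - q y - 1" by (simp add: field_simps)
        then show False using *[of "(- q y - 1) / (2 * b r y)"] by linarith
      qed
    qed
    \<comment> \<open>A basis \<open>C0\<close> of \<open>?M0\<close> extends to a basis \<open>C\<close> of \<open>M\<close>; if \<open>C - C0\<close> had fewer than \<open>dim R\<close>
      elements, some nonzero \<open>r\<close> would be orthogonal to \<open>M\<close>.\<close>
    let ?M0 = "{v\<in>M. \<forall>r\<in>B. b v r = 0}"
    have M0: "subspace ?M0" "fin_dim ?M0"
      using neg_defD(1)[OF M(1)] fin_dim_subset[OF neg_defD(2)[OF M(1)], of ?M0]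
      by (simp_all add: subspace_def simps)
    obtain C0 where C0: "finite C0" "independent C0" "span C0 = ?M0" "card C0 = dim ?M0"
      by (rule fin_dim_basis[OF M0])
    have "C0 \<subseteq> M" using C0(3) span_superset[of C0] by blast
    then obtain C where C: "C0 \<subseteq> C" "C \<subseteq> M" "independent C" "M \<subseteq> span C"
      using real_vector.maximal_independent_subset_extend[OF _ C0(2)] by metis
    have Cfin: "finite C" "card C \<le> dim M"
      using independent_card_le_dim_fin[OF neg_defD(2,1)[OF M(1)] C(3,2)] by simp_all
    have "dim R \<le> card (C - C0)"
    proof (rule ccontr)
      assume "\<not> ?thesis"
      then have less: "card (C - C0) < dim R" by simp
      obtain r where r: "r \<in> R" "r \<noteq> 0" "\<forall>v\<in>C - C0. b r v = 0"
        by (rule common_zero_of_functionals[where f="\<lambda>r x. b x r", OF R(1,2) finite_Diff[OF Cfin(1)] linear_left less])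
      have "b r v = 0" if v: "v \<in> C" for v
      proof (cases "v \<in> C0")
        case True
        then have v0: "v \<in> ?M0" using C0(3) span_superset[of C0] by blast
        then have "b v r = 0" using BR[OF r(1), of v] by blast
        then show ?thesis using sym[of r v] v0 M(3) RX r(1) by (simp add: subset_iff)
      qed (use v r(3) in blast)
      then have "b r v = 0" if "v \<in> M" for v
        using zero_on_span_right[of v C r] C(4) that by blast
      then show False using RM[OF r(1)] r(2) by blast
    qed
    also have "card (C - C0) \<le> dim M - dim ?M0"
      using Cfin C0(4) card_Diff_subset[OF C0(1) C(1)] by simp
    finally have "dim R \<le> dim M - dim ?M0" .
    moreover have "dim ?M0 \<le> dim M" using Cfin C0(4) card_mono[OF Cfin(1) C(1)] by simp
    moreover have "dim (V + V') \<le> dim ?M0"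
    proof (rule dim_mono_fin[OF M0(2,1)])
      show "subspace (V + V')" using sum(1) unfolding neg_def_def by blast
      have "b v r = 0" if v: "v \<in> V + V'" and r: "r \<in> B" for v r
      proof -
        have rR: "r \<in> R" using r B(3) span_base[of r B] by blast
        obtain u u' where "u \<in> V" "u' \<in> V'" "v = u + u'" using v by (auto simp: set_plus_def)
        moreover have "b u r = 0" if "u \<in> V" for u using orth[of u r] that V(2) rR R(3) by auto
        moreover have "b u' r = 0" if "u' \<in> V'" for u'
          using that V'(2) rR R(3) unfolding Z'_def by auto
        ultimately show ?thesis by (simp add: simps)
      qed
      then show "V + V' \<subseteq> ?M0" using M(2) by blast
    qed
    ultimately have "dim V + dim V' + dim R \<le> dim M" using sum(2) by linarith
    then have "enat (dim V + dim V' + dim R) \<le> neg_index q X"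
      using neg_index_upper[OF M(1,3)] by (meson enat_ord_simps(1) order_trans)
    then show ?thesis using le Zn Z'n by simp
  qed
qed

end

section \<open>Complete subspaces of inner product spaces\<close>

lemma norm_midpoint_identity:
  fixes x y z :: "'a::real_inner"
  shows "(norm (y - z))\<^sup>2 = 2 * (norm (y - x))\<^sup>2 + 2 * (norm (z - x))\<^sup>2
           - 4 * (norm ((1/2) *\<^sub>R (y + z) - x))\<^sup>2"
proof -
  define u v where "u = y - x" and "v = z - x"
  have 1: "y - z = u - v" by (simp add: u_def v_def)
  have "(1/2) *\<^sub>R x + (1/2) *\<^sub>R x = x" by (simp flip: scaleR_add_left)
  then have 2: "(1/2) *\<^sub>R (y + z) - x = (1/2) *\<^sub>R (u + v)"
    unfolding u_def v_def by (simp add: algebra_simps)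
  have 3: "inner v u = inner u v" by (rule inner_commute)
  show ?thesis unfolding 1 2 u_def[symmetric] v_def[symmetric] power2_norm_eq_inner
    by (simp add: inner_add_left inner_add_right inner_diff_left inner_diff_right 3 field_simps)
qed

text \<open>
  The distances from \<open>x\<close> to the decreasing sets increase to a limit. Points that almost realise
  them form a Cauchy sequence, by the midpoint identity and convexity, and its limit lies in all
  of the sets. This takes the place of weak compactness in the sequel.
\<close>

lemma nested_convex_sets:
  fixes C :: "nat \<Rightarrow> 'a::real_inner set"
  assumes H: "complete H" "C 0 \<subseteq> H" and dec: "\<And>n. C (Suc n) \<subseteq> C n"
    and C: "\<And>n. convex (C n)" "\<And>n. closed (C n)" "\<And>n. C n \<noteq> {}"
    and bdd: "\<And>n. \<exists>y\<in>C n. norm (y - x) \<le> M"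
  obtains y where "y \<in> (\<Inter>n. C n)" "\<forall>z\<in>(\<Inter>n. C n). norm (y - x) \<le> norm (z - x)"
proof -
  define d where "d n = (INF y\<in>C n. (norm (y - x))\<^sup>2)" for n
  have anti: "C n \<subseteq> C m" if "m \<le> n" for m n
    using that by (induction rule: dec_induct) (use dec in auto)
  have below: "bdd_below ((\<lambda>y. (norm (y - x))\<^sup>2) ` C n)" for n
    by (rule bdd_belowI[of _ 0]) auto
  have dle: "d n \<le> (norm (y - x))\<^sup>2" if "y \<in> C n" for n y
    unfolding d_def by (rule cINF_lower[OF below that])
  have dmono: "d m \<le> d n" if "m \<le> n" for m n
    unfolding d_def by (rule cINF_superset_mono) (use C anti[OF that] below in auto)
  have dM: "d n \<le> M\<^sup>2" for n
  proof -
    obtain y where y: "y \<in> C n" "norm (y - x) \<le> M" using bdd by blast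
    then show ?thesis using dle[OF y(1)] power_mono[OF y(2), of 2] by simp
  qed
  have "\<forall>n. \<exists>y. y \<in> C n \<and> (norm (y - x))\<^sup>2 < d n + 1 / real (Suc n)"
  proof
    fix n
    have "d n < d n + 1 / real (Suc n)" by simp
    then show "\<exists>y. y \<in> C n \<and> (norm (y - x))\<^sup>2 < d n + 1 / real (Suc n)"
      unfolding d_def using cINF_less_iff[OF C(3) below] by blast
  qed
  then obtain Y where Y: "\<And>n. Y n \<in> C n" "\<And>n. (norm (Y n - x))\<^sup>2 < d n + 1 / real (Suc n)"
    by metis
  have "incseq d" using dmono by (simp add: incseq_def)
  then obtain D where D: "d \<longlonglongrightarrow> D" "\<And>n. d n \<le> D"
    using incseq_convergent[of d "M\<^sup>2"] dM by blast
  have close: "(norm (Y m - Y n))\<^sup>2 \<le> 4 * (D - d k) + 4 / real (Suc k)" if "k \<le> m" "k \<le> n" for k m n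
  proof -
    have "Y m \<in> C k" "Y n \<in> C k" using Y(1) anti that by blast+
    then have "(1/2) *\<^sub>R Y m + (1/2) *\<^sub>R Y n \<in> C k"
      using C(1)[of k] by (intro convexD) auto
    then have "d k \<le> (norm ((1/2) *\<^sub>R (Y m + Y n) - x))\<^sup>2"
      using dle by (simp add: scaleR_add_right)
    moreover have "(norm (Y j - x))\<^sup>2 \<le> D + 1 / real (Suc k)" if "k \<le> j" for j
    proof -
      have "1 / real (Suc j) \<le> 1 / real (Suc k)" using that by (intro divide_left_mono) auto
      then show ?thesis using Y(2)[of j] D(2)[of j] by linarith
    qed
    ultimately show ?thesis using norm_midpoint_identity[of "Y m" "Y n" x] that
      by (smt (verit, best) add_divide_distrib)
  qed
  have "(\<lambda>k. 4 * (D - d k) + 4 * inverse (real (Suc k))) \<longlonglongrightarrow> 4 * (D - D) + 4 * 0"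
    by (intro tendsto_intros D(1) LIMSEQ_inverse_real_of_nat)
  then have lim0: "(\<lambda>k. 4 * (D - d k) + 4 / real (Suc k)) \<longlonglongrightarrow> 0"
    by (simp add: divide_inverse)
  have "Cauchy Y"
  proof (rule metric_CauchyI)
    fix e :: real assume e: "e > 0"
    then have "\<forall>\<^sub>F k in sequentially. 4 * (D - d k) + 4 / real (Suc k) < e\<^sup>2"
      using order_tendstoD(2)[OF lim0] by simp
    then obtain k where k: "4 * (D - d k) + 4 / real (Suc k) < e\<^sup>2"
      using eventually_happens'[OF sequentially_bot] by blast
    have "dist (Y m) (Y n) < e" if "k \<le> m" "k \<le> n" for m n
      using close[OF that] k e unfolding dist_norm
      by (meson le_less_trans less_imp_le power2_less_imp_less)
    then show "\<exists>k. \<forall>m\<ge>k. \<forall>n\<ge>k. dist (Y m) (Y n) < e" by blast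
  qed
  moreover have "Y n \<in> H" for n using Y(1)[of n] anti[of 0 n] H(2) by blast
  ultimately obtain y where y: "Y \<longlonglongrightarrow> y"
    using H(1) unfolding complete_def by blast
  have yC: "y \<in> C n" for n
  proof (rule Lim_in_closed_set[OF C(2)])
    show "\<forall>\<^sub>F k in sequentially. Y k \<in> C n"
      using Y(1) anti eventually_ge_at_top[of n] by (rule_tac eventually_mono) blast+
  qed (use y in auto)
  moreover have "norm (y - x) \<le> norm (z - x)" if z: "z \<in> (\<Inter>n. C n)" for z
  proof -
    have "(\<lambda>n. (norm (Y n - x))\<^sup>2) \<longlonglongrightarrow> (norm (y - x))\<^sup>2" by (intro tendsto_intros y)
    moreover have "(\<lambda>n. d n + 1 / real (Suc n)) \<longlonglongrightarrow> D + 0"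
      using LIMSEQ_inverse_real_of_nat by (intro tendsto_add D(1)) (simp add: inverse_eq_divide)
    ultimately have "(norm (y - x))\<^sup>2 \<le> D + 0"
      by (rule LIMSEQ_le) (use Y(2) less_imp_le in blast)
    also have "D + 0 \<le> (norm (z - x))\<^sup>2"
      using LIMSEQ_le_const2[OF D(1), of "(norm (z - x))\<^sup>2"] dle z by auto
    finally show ?thesis using power2_le_imp_le by fastforce
  qed
  ultimately show ?thesis using that[of y] by blast
qed

lemma orthogonal_projection_exists:
  fixes S :: "'a::real_inner set"
  assumes S: "complete S" "subspace S"
  obtains p where "p \<in> S" "\<forall>y\<in>S. inner (x - p) y = 0"
proof -
  have ne: "S \<noteq> {}" using subspace_0[OF S(2)] by blast
  have "\<exists>y\<in>S. norm (y - x) \<le> norm x" using subspace_0[OF S(2)] by (rule_tac bexI[of _ 0]) simp_all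
  note ex = this
  have conv: "convex S" and clos: "closed S"
    using S by (simp_all add: subspace_imp_convex complete_imp_closed)
  obtain p where "p \<in> (\<Inter>n::nat. S)" "\<forall>z\<in>(\<Inter>n::nat. S). norm (p - x) \<le> norm (z - x)"
    by (rule nested_convex_sets[where C = "\<lambda>_. S", OF S(1) order_refl order_refl conv clos ne ex])
  then have p: "p \<in> S" "\<forall>z\<in>S. norm (p - x) \<le> norm (z - x)" by simp_all
  have "inner (x - p) y = 0" if y: "y \<in> S" for y
  proof (rule ccontr)
    assume n: "inner (x - p) y \<noteq> 0"
    then have y0: "inner y y > 0" by auto
    define c where "c = inner (x - p) y / inner y y"
    have "norm (p - x) \<le> norm ((p + c *\<^sub>R y) - x)"
      using p y S(2) by (simp add: subspace_add subspace_scale)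
    then have "(norm (p - x))\<^sup>2 \<le> (norm ((p + c *\<^sub>R y) - x))\<^sup>2" by (simp add: power_mono)
    also have "\<dots> = (norm (p - x))\<^sup>2 - 2 * c * inner (x - p) y + c * c * inner y y"
    proof -
      have "(p + c *\<^sub>R y) - x = c *\<^sub>R y - (x - p)" by simp
      moreover have "norm (p - x) = norm (x - p)" by (rule norm_minus_commute)
      ultimately show ?thesis
        by (simp add: power2_norm_eq_inner inner_diff_left inner_diff_right inner_commute algebra_simps)
    qed
    also have "c * c * inner y y = c * inner (x - p) y" using y0 by (simp add: c_def)
    finally have "c * inner (x - p) y \<le> 0" by simp
    moreover have "c * inner (x - p) y = (inner (x - p) y)\<^sup>2 / inner y y"
      by (simp add: c_def power2_eq_square)
    ultimately show False using n y0 by (simp add: divide_le_0_iff zero_less_power2 order.strict_iff_not)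
  qed
  then show ?thesis using that p(1) by blast
qed

text \<open>
  A substitute for weak sequential compactness: the closed convex hulls of the tails of a
  bounded sequence are a decreasing sequence of bounded closed convex sets.
\<close>

lemma weak_cluster_point:
  fixes w :: "nat \<Rightarrow> 'a::real_inner"
  assumes H: "complete H" "subspace H" and w: "\<And>n. w n \<in> H" "\<And>n. norm (w n) \<le> M"
  obtains v where "v \<in> H" "\<forall>n. v \<in> closure (convex hull (w ` {n..}))"
proof -
  let ?C = "\<lambda>n. closure (convex hull (w ` {n..}))"
  have sub: "?C n \<subseteq> H" for n
  proof -
    have "convex hull (w ` {n..}) \<subseteq> H"
      using w subspace_imp_convex[OF H(2)] by (intro hull_minimal) auto
    then show ?thesis using complete_imp_closed[OF H(1)] by (simp add: closure_minimal)
  qed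
  have dec: "?C (Suc n) \<subseteq> ?C n" for n by (intro closure_mono hull_mono image_mono) auto
  have ne: "w n \<in> ?C n" for n by (intro closure_subset[THEN subsetD] hull_inc) auto
  have "\<exists>y\<in>?C n. norm (y - 0) \<le> M" for n using ne[of n] w(2)[of n] by auto
  moreover have "convex (?C n)" "closed (?C n)" "?C n \<noteq> {}" for n
    using ne by (auto intro: convex_closure)
  ultimately obtain v where "v \<in> (\<Inter>n. ?C n)"
    using nested_convex_sets[of H ?C 0 M, OF H(1) sub dec] by metis
  then show ?thesis using that[of v] sub by blast
qed

definition proj :: "'a::real_inner set \<Rightarrow> 'a \<Rightarrow> 'a" where
  "proj S x = (SOME p. p \<in> S \<and> (\<forall>y\<in>S. inner (x - p) y = 0))"

text \<open>
  The type of the ambient space is not assumed to be complete; completeness is a property of the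
  subspace.
\<close>

locale complete_subspace =
  fixes S :: "'a::real_inner set"
  assumes complete: "complete S" and subspace: "subspace S"
begin

lemma proj: "proj S x \<in> S" "y \<in> S \<Longrightarrow> inner (x - proj S x) y = 0"
proof -
  have "\<exists>p. p \<in> S \<and> (\<forall>y\<in>S. inner (x - p) y = 0)"
    using orthogonal_projection_exists[OF complete subspace, of x] by metis
  then have "proj S x \<in> S \<and> (\<forall>y\<in>S. inner (x - proj S x) y = 0)"
    unfolding proj_def by (rule someI_ex)
  then show "proj S x \<in> S" "y \<in> S \<Longrightarrow> inner (x - proj S x) y = 0" by blast+
qed

lemma proj_eqI:
  assumes "p \<in> S" "\<And>y. y \<in> S \<Longrightarrow> inner (x - p) y = 0" shows "proj S x = p"
proof -
  have m: "proj S x - p \<in> S" using proj(1) assms(1) subspace by (simp add: subspace_diff)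
  have "inner (proj S x - p) (proj S x - p) = inner (x - p) (proj S x - p) - inner (x - proj S x) (proj S x - p)"
    by (simp add: inner_diff_left)
  then have "inner (proj S x - p) (proj S x - p) = 0" using proj(2)[OF m] assms(2)[OF m] by simp
  then show ?thesis by simp
qed

lemma proj_id: "x \<in> S \<Longrightarrow> proj S x = x" by (rule proj_eqI) simp_all

lemma proj_eq_0: "(\<And>y. y \<in> S \<Longrightarrow> inner x y = 0) \<Longrightarrow> proj S x = 0"
  using proj_eqI[OF subspace_0[OF subspace], of x] by simp

lemma proj_add: "proj S (x + y) = proj S x + proj S y"
proof (rule proj_eqI)
  show "proj S x + proj S y \<in> S" using proj(1) subspace by (simp add: subspace_add)
  fix z assume "z \<in> S"
  then show "inner (x + y - (proj S x + proj S y)) z = 0"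
    using proj(2)[of z x] proj(2)[of z y] by (simp add: inner_diff_left inner_add_left)
qed

lemma proj_scale: "proj S (c *\<^sub>R x) = c *\<^sub>R proj S x"
proof (rule proj_eqI)
  show "c *\<^sub>R proj S x \<in> S" using proj(1) subspace by (simp add: subspace_scale)
  fix z assume "z \<in> S"
  then show "inner (c *\<^sub>R x - c *\<^sub>R proj S x) z = 0"
    using proj(2)[of z x] by (simp add: inner_diff_left)
qed

lemma proj_inner: "inner (proj S x) x = (norm (proj S x))\<^sup>2"
  using proj(2)[OF proj(1), of x x]
  by (simp add: inner_diff_left power2_norm_eq_inner inner_commute[of "proj S x" x])

lemma proj_inner': "y \<in> S \<Longrightarrow> inner (proj S x) y = inner x y"
  using proj(2)[of y x] by (simp add: inner_diff_left)

lemma pythagoras: "(norm x)\<^sup>2 = (norm (proj S x))\<^sup>2 + (norm (x - proj S x))\<^sup>2"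
proof -
  have "inner (x - proj S x) (proj S x) = 0" by (rule proj(2)[OF proj(1)])
  then show ?thesis
    by (simp add: power2_norm_eq_inner inner_diff_left inner_diff_right inner_commute)
qed

lemma norm_proj_le: "norm (proj S x) \<le> norm x"
proof (rule power2_le_imp_le)
  show "(norm (proj S x))\<^sup>2 \<le> (norm x)\<^sup>2" unfolding pythagoras[of x] by simp
qed simp

end

lemma complete_subspace_closed:
  assumes "complete_subspace H" "closed S" "subspace S" "S \<subseteq> H"
  shows "complete_subspace S"
  using complete_closed_subset[OF assms(2,4)] assms(1,3) by (simp add: complete_subspace_def)

lemma complete_subspace_perp:
  assumes "complete_subspace H"
  shows "complete_subspace {x\<in>H. \<forall>y\<in>S. inner x y = 0}"
proof (rule complete_subspace_closed[OF assms])
  have H: "subspace H" "closed H"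
    using assms by (simp_all add: complete_subspace_def complete_imp_closed)
  have "{x\<in>H. \<forall>y\<in>S. inner x y = 0} = H \<inter> (\<Inter>y\<in>S. {x. inner x y = 0})" by auto
  moreover have "closed {x. inner x y = 0}" for y :: 'a
    by (intro closed_Collect_eq continuous_intros)
  ultimately show "closed {x\<in>H. \<forall>y\<in>S. inner x y = 0}"
    using H(2) by (simp add: closed_Int closed_INT)
  show "subspace {x\<in>H. \<forall>y\<in>S. inner x y = 0}"
    using H(1) by (auto simp: subspace_def inner_add_left)
qed simp

text \<open>
  Closedness follows from the existence of the projection \<open>p\<close> of a point \<open>x\<close> of the closure:
  \<open>x - p\<close> is orthogonal to \<open>V\<close> and hence to its limits, in particular to \<open>x - p\<close>.
\<close>

lemma complete_subspace_fin_dim: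
  fixes V :: "'a::real_inner set"
  assumes V: "subspace V" "fin_dim V" and H: "complete_subspace H" "V \<subseteq> H"
  shows "complete_subspace V"
proof (rule complete_subspace_closed[OF H(1) _ V(1) H(2)])
  have "x \<in> V" if x: "x \<in> closure V" for x
  proof -
    obtain p where p: "p \<in> V" "\<And>u. u \<in> V \<Longrightarrow> inner (x - p) u = 0"
      using form_projection[OF _ V, of inner x] by (auto simp: bilinear_conv_bounded_bilinear bounded_bilinear_inner bilinear_def inner_add_left inner_add_right linear_iff)
    obtain u where u: "\<And>n. u n \<in> V" "u \<longlonglongrightarrow> x" using x closure_sequential by blast
    have "(\<lambda>n. inner (x - p) (x - u n)) \<longlonglongrightarrow> inner (x - p) (x - x)"
      by (intro tendsto_intros u)
    moreover have "inner (x - p) (x - u n) = inner (x - p) (x - p)" for n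
      using p(2)[OF u(1)[of n]] p(2)[OF p(1)] by (simp add: inner_diff_right)
    ultimately have "inner (x - p) (x - p) = 0" by (simp add: LIMSEQ_const_iff)
    then show ?thesis using p(1) by simp
  qed
  then show "closed V" using closure_subset_eq[of V] by blast
qed

section \<open>Log-convex sequences\<close>

lemma log_convex_increasing:
  fixes a :: "nat \<Rightarrow> real"
  assumes a: "\<And>n. 0 \<le> a n" "\<And>n. (a (Suc n))\<^sup>2 \<le> a n * a (Suc (Suc n))"
    and l: "a l < a (Suc l)" "l \<le> k"
  shows "a k < a (Suc k)"
  using l(2)
proof (induction rule: dec_induct)
  case (step n)
  show ?case
  proof (rule ccontr)
    assume "\<not> ?thesis"
    then have "a n * a (Suc (Suc n)) \<le> a n * a (Suc n)"
      using a(1) by (simp add: mult_left_mono)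
    also have "\<dots> < a (Suc n) * a (Suc n)"
      using step.IH a(1)[of n] by (simp add: mult_strict_right_mono)
    finally show False using a(2)[of n] by (simp add: power2_eq_square)
  qed
qed (rule l(1))

text \<open>
  A ratio of consecutive terms that exceeds \<open>s\<close> persists by log-convexity and makes the sequence
  grow faster than \<open>C s\<^sup>n\<close>. So the constant in a geometric bound can be replaced by the initial
  value.
\<close>

lemma log_convex_bound:
  fixes a :: "nat \<Rightarrow> real"
  assumes a: "\<And>n. 0 \<le> a n" "\<And>n. (a (Suc n))\<^sup>2 \<le> a n * a (Suc (Suc n))"
    and s: "0 < s" and bound: "\<And>n. a n \<le> C * s ^ n"
  shows "a n \<le> s ^ n * a 0"
proof -
  have step: "a (Suc m) \<le> s * a m" for m
  proof (rule ccontr)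
    assume n: "\<not> ?thesis"
    define b where "b k = a (m + k)" for k
    have b: "0 \<le> b k" "(b (Suc k))\<^sup>2 \<le> b k * b (Suc (Suc k))" for k
      using a by (simp_all add: b_def)
    have b1: "b 1 > s * b 0" using n by (simp add: b_def)
    have b0: "b 0 > 0"
    proof (rule ccontr)
      assume "\<not> ?thesis"
      then have z: "b 0 = 0" using b(1)[of 0] by simp
      then have "(b 1)\<^sup>2 \<le> 0" using b(2)[of 0] by simp
      then show False using b1 z by simp
    qed
    define r where "r = b 1 / b 0"
    have r: "r > s" using b0 b1 by (simp add: r_def field_simps)
    have ratio: "r * b k \<le> b (Suc k) \<and> 0 < b k" for k
    proof (induction k)
      case (Suc k)
      have p: "0 < b (Suc k)" using Suc r s by (smt (verit) mult_pos_pos)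
      have "r * b k * b (Suc k) \<le> b (Suc k) * b (Suc k)"
        using Suc p by (intro mult_right_mono) simp_all
      also have "\<dots> \<le> b k * b (Suc (Suc k))" using b(2)[of k] by (simp add: power2_eq_square)
      finally have "b k * (r * b (Suc k)) \<le> b k * b (Suc (Suc k))" by (simp add: ac_simps)
      then show ?case using Suc p by simp
    qed (use b0 in \<open>simp_all add: r_def\<close>)
    have low: "r ^ k * b 0 \<le> b k" for k
    proof (induction k)
      case (Suc k)
      have "r ^ Suc k * b 0 = r * (r ^ k * b 0)" by simp
      also have "\<dots> \<le> r * b k" using Suc r s by (intro mult_left_mono) simp_all
      also have "\<dots> \<le> b (Suc k)" using ratio by simp
      finally show ?case .
    qed simp
    have "(r / s) ^ k \<le> C * s ^ m / b 0" for k
    proof -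
      have "r ^ k * b 0 \<le> C * s ^ (m + k)" using low[of k] bound[of "m + k"] by (simp add: b_def)
      then show ?thesis using s b0 by (simp add: field_simps power_add power_divide)
    qed
    moreover have "\<exists>k. C * s ^ m / b 0 < (r / s) ^ k"
      using r s by (intro real_arch_pow) simp
    ultimately show False by (meson not_le)
  qed
  show ?thesis
  proof (induction n)
    case (Suc n)
    have "a (Suc n) \<le> s * a n" by (rule step)
    also have "\<dots> \<le> s * (s ^ n * a 0)" using Suc s by (intro mult_left_mono) simp_all
    finally show ?case by (simp add: mult.assoc)
  qed simp
qed

text \<open>
  Once such a sequence increases it goes on increasing, so its maximum on an interval is at an
  end point.
\<close>

lemma log_convex_le_endpoints:
  fixes a :: "nat \<Rightarrow> real"
  assumes a: "\<And>n. 0 \<le> a n" "\<And>n. (a (Suc n))\<^sup>2 \<le> a n * a (Suc (Suc n))"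
    and ends: "a 0 \<le> M" "a n \<le> M" and i: "i \<le> n"
  shows "a i \<le> M"
proof (rule ccontr)
  assume n: "\<not> ?thesis"
  have "\<exists>l<i. a l < a (Suc l)"
  proof (rule ccontr)
    assume c: "\<not> ?thesis"
    have "a k \<le> a 0" if "k \<le> i" for k
      using that
    proof (induction k)
      case (Suc k)
      have "k < i" using Suc.prems by simp
      then have "a (Suc k) \<le> a k" using c by (meson not_less)
      then show ?case using Suc by simp
    qed simp
    then show False using n ends(1) by force
  qed
  then obtain l where l: "l < i" "a l < a (Suc l)" by blast
  have "a i \<le> a k" if "i \<le> k" for k
    using that
  proof (induction rule: dec_induct)
    case (step k)
    then show ?case using log_convex_increasing[OF a l(2), of k] l(1) by simp
  qed simp
  then show False using n ends(2) i by force
qed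

section \<open>Solving equations with coercive symmetric operators\<close>

lemma op_adjoint_subspace:
  assumes "subspace H" shows "subspace (op_adjoint H A)"
  using assms unfolding op_adjoint_def subspace_def
  by (auto simp: inner_add_right zero_prod_def split: prod.splits)

lemma op_adjoint_closed:
  assumes "closed H" shows "closed (op_adjoint H A)"
proof -
  have "op_adjoint H A = H \<times> H \<inter> (\<Inter>p\<in>A. {q. inner (snd p) (fst q) = inner (fst p) (snd q)})"
    unfolding op_adjoint_def by fastforce
  moreover have "closed {q. inner (snd p) (fst q) = inner (fst p) (snd q)}" for p :: "'a \<times> 'a"
    by (intro closed_Collect_eq continuous_intros)
  ultimately show ?thesis using assms by (simp add: closed_Int closed_INT closed_Times)
qed

lemma subspace_Range: "subspace A \<Longrightarrow> subspace (Range A)"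
  using linear_subspace_image[OF linear_snd, of A] by (simp add: Range_snd)

lemma subspace_Domain: "subspace A \<Longrightarrow> subspace (Domain A)"
  using linear_subspace_image[OF linear_fst, of A] by (simp add: Domain_fst)

text \<open>
  Coercivity makes the range complete, and self-adjointness puts everything orthogonal to the
  range into the kernel, which is trivial.
\<close>

lemma coercive_selfadjoint_surjective:
  assumes K: "complete_subspace K" and A: "selfadjoint_operator K A"
    and coercive: "\<And>x z. (x, z) \<in> A \<Longrightarrow> (norm x)\<^sup>2 \<le> inner z x" and h: "h \<in> K"
  shows "\<exists>x. (x, h) \<in> A"
proof -
  interpret K: complete_subspace K by (rule K)
  have sub: "subspace A" "A \<subseteq> K \<times> K" and adj: "op_adjoint K A = A"
    using A by (simp_all add: selfadjoint_operator_def linear_operator_def)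
  have clos: "closed A" using op_adjoint_closed[of K A] complete_imp_closed[OF K.complete] adj by simp
  have low: "norm x \<le> norm z" if "(x, z) \<in> A" for x z
  proof (cases "x = 0")
    case False
    have "norm x * norm x \<le> norm z * norm x"
      using coercive[OF that] norm_cauchy_schwarz[of z x] by (simp add: power2_eq_square)
    then show ?thesis using False by simp
  qed simp
  have "complete (Range A)" unfolding complete_def
  proof (intro allI impI)
    fix f assume f: "(\<forall>n. f n \<in> Range A) \<and> Cauchy f"
    then have "\<forall>n. \<exists>x. (x, f n) \<in> A" by blast
    then obtain g where g: "\<And>n. (g n, f n) \<in> A" by metis
    have diff: "norm (g m - g n) \<le> norm (f m - f n)" for m n
    proof -
      have "(g m - g n, f m - f n) \<in> A" using subspace_diff[OF sub(1) g g] by simp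
      then show ?thesis by (rule low)
    qed
    have "Cauchy g"
    proof (rule metric_CauchyI)
      fix e :: real assume "e > 0"
      then obtain M where "\<forall>m\<ge>M. \<forall>n\<ge>M. dist (f m) (f n) < e" using f metric_CauchyD by blast
      then show "\<exists>M. \<forall>m\<ge>M. \<forall>n\<ge>M. dist (g m) (g n) < e"
        unfolding dist_norm using diff le_less_trans by blast
    qed
    moreover have "g n \<in> K" "f n \<in> K" for n using g[of n] sub(2) by blast+
    ultimately obtain x z where "g \<longlonglongrightarrow> x" "f \<longlonglongrightarrow> z"
      using K.complete f unfolding complete_def by metis
    then have "(\<lambda>n. (g n, f n)) \<longlonglongrightarrow> (x, z)" by (intro tendsto_Pair)
    then have "(x, z) \<in> A" by (rule closed_sequentially[OF clos g])
    then show "\<exists>l\<in>Range A. f \<longlonglongrightarrow> l" using \<open>f \<longlonglongrightarrow> z\<close> by blast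
  qed
  then interpret R: complete_subspace "Range A"
    using subspace_Range[OF sub(1)] by unfold_locales
  define r where "r = h - proj (Range A) h"
  have "proj (Range A) h \<in> K" using R.proj(1)[of h] sub(2) by blast
  then have rK: "r \<in> K" using h K.subspace unfolding r_def by (simp add: subspace_diff)
  have "inner z r = 0" if "(x, z) \<in> A" for x z
    using R.proj(2)[of z h] that unfolding r_def by (metis RangeI inner_commute)
  then have "(r, 0) \<in> op_adjoint K A"
    using rK K.subspace by (auto simp: op_adjoint_def subspace_0)
  then have "(norm r)\<^sup>2 \<le> inner 0 r" using coercive adj by metis
  then have "h = proj (Range A) h" by (simp add: r_def)
  then show ?thesis using R.proj(1)[of h] by (metis RangeE)
qed

text \<open>
  The operator \<open>1 + B\<close> is self-adjoint on \<open>K\<close> and coercive.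
\<close>

lemma identity_plus_positive_surjective:
  assumes K: "complete_subspace K" and B: "linear B" "\<And>x. x \<in> K \<Longrightarrow> B x \<in> K"
    and sym: "\<And>x y. x \<in> K \<Longrightarrow> y \<in> K \<Longrightarrow> inner (B x) y = inner x (B y)"
    and pos: "\<And>x. x \<in> K \<Longrightarrow> 0 \<le> inner (B x) x" and h: "h \<in> K"
  obtains z where "z \<in> K" "z + B z = h"
proof -
  interpret K: complete_subspace K by (rule K)
  define A where "A = (\<lambda>z. (z, z + B z)) ` K"
  have lin: "linear (\<lambda>z. (z, z + B z))"
    using B(1) by (auto simp: linear_iff algebra_simps)
  have AI: "(z, z + B z) \<in> A" if "z \<in> K" for z using that by (simp add: A_def)
  have AD: "x \<in> K" "z = x + B x" if "(x, z) \<in> A" for x z using that by (auto simp: A_def)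
  have lo: "linear_operator K A" unfolding linear_operator_def
  proof (intro conjI)
    show "A \<subseteq> K \<times> K" using B(2) K.subspace by (auto simp: A_def subspace_add)
    show "subspace A" unfolding A_def by (rule linear_subspace_image[OF lin K.subspace])
    show "single_valued A" by (auto simp: A_def single_valued_def)
  qed
  moreover have "Domain A = K" by (auto simp: A_def)
  moreover have "op_adjoint K A = A"
  proof (intro set_eqI iffI; clarify)
    fix y w assume "(y, w) \<in> op_adjoint K A"
    then have yw: "y \<in> K" "w \<in> K" "\<And>x. x \<in> K \<Longrightarrow> inner (x + B x) y = inner x w"
      using AI unfolding op_adjoint_def by auto
    define d where "d = y + B y - w"
    have d: "d \<in> K" using yw B(2) K.subspace by (simp add: d_def subspace_add subspace_diff)
    have "inner d d = inner (d + B d) y - inner d w"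
      using sym[OF d yw(1)] by (simp add: d_def inner_add_right inner_diff_right inner_add_left)
    then have "inner d d = 0" using yw(3)[OF d] by simp
    then have "w = y + B y" by (simp add: d_def)
    then show "(y, w) \<in> A" using AI yw by simp
  next
    fix y w assume "(y, w) \<in> A"
    then have yw: "y \<in> K" "w = y + B y" using AD by blast+
    have "inner (x + B x) y = inner x w" if "x \<in> K" for x
      using sym[OF that yw(1)] yw(2) by (simp add: inner_add_left inner_add_right)
    then show "(y, w) \<in> op_adjoint K A"
      using yw B(2) K.subspace unfolding op_adjoint_def by (auto simp: A_def subspace_add)
  qed
  ultimately have "selfadjoint_operator K A"
    unfolding selfadjoint_operator_def using closure_subset by blast
  moreover have "(norm x)\<^sup>2 \<le> inner z x" if "(x, z) \<in> A" for x z
    using AD[OF that] pos[of x] by (simp add: inner_add_left power2_norm_eq_inner)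
  ultimately obtain x where "(x, h) \<in> A"
    using coercive_selfadjoint_surjective[OF K _ _ h] by blast
  then show ?thesis using that AD by blast
qed

section \<open>Spectral subspaces of a positive injective contraction\<close>

text \<open>
  The operator \<open>T\<close> stands for the inverse of a self-adjoint operator \<open>B \<ge> 1\<close>; the bound
  \<open>\<parallel>Tx\<parallel>\<^sup>2 \<le> \<langle>Tx, x\<rangle>\<close> is \<open>\<parallel>y\<parallel>\<^sup>2 \<le> \<langle>By, y\<rangle>\<close> for \<open>y = Tx\<close>.
\<close>

locale positive_injective_contraction = H: complete_subspace H for H :: "'a::real_inner set" +
  fixes T :: "'a \<Rightarrow> 'a"
  assumes linear: "linear T"
    and mem: "x \<in> H \<Longrightarrow> T x \<in> H"
    and sym: "x \<in> H \<Longrightarrow> y \<in> H \<Longrightarrow> inner (T x) y = inner x (T y)"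
    and positive: "x \<in> H \<Longrightarrow> (norm (T x))\<^sup>2 \<le> inner (T x) x"
    and inj: "x \<in> H \<Longrightarrow> T x = 0 \<Longrightarrow> x = 0"
begin

lemmas add = linear_add[OF linear] and scale = linear_scale[OF linear]
  and diff = linear_diff[OF linear] and zero = linear_0[OF linear]

lemma norm_le: assumes "x \<in> H" shows "norm (T x) \<le> norm x"
proof (cases "T x = 0")
  case False
  have "norm (T x) * norm (T x) \<le> norm (T x) * norm x"
    using positive[OF assms] norm_cauchy_schwarz[of "T x" x] by (simp add: power2_eq_square)
  then show ?thesis using False by simp
qed simp

lemma pow_linear: "linear (T ^^ n)"
proof (induction n)
  case (Suc n)
  show ?case using linear_compose[OF Suc linear] by (simp add: o_def)
qed (simp add: linear_id[unfolded id_def])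

lemma pow_mem: "x \<in> H \<Longrightarrow> (T ^^ n) x \<in> H"
  by (induction n) (simp_all add: mem)

lemma pow_Suc: "(T ^^ Suc n) x = (T ^^ n) (T x)"
  by (simp add: funpow_swap1)

lemma pow_sym:
  assumes "x \<in> H" "y \<in> H" shows "inner ((T ^^ n) x) y = inner x ((T ^^ n) y)"
  using assms(2)
proof (induction n arbitrary: y)
  case (Suc n)
  have "inner ((T ^^ Suc n) x) y = inner ((T ^^ n) x) (T y)"
    using sym[OF pow_mem[OF assms(1)] Suc.prems] by simp
  also have "\<dots> = inner x ((T ^^ n) (T y))" using Suc mem by simp
  finally show ?case by (simp add: pow_Suc del: funpow.simps)
qed simp

lemma pow_norm_le: "x \<in> H \<Longrightarrow> norm ((T ^^ n) x) \<le> norm x"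
proof (induction n)
  case (Suc n)
  then show ?case using norm_le[OF pow_mem[OF Suc.prems], of n] by simp
qed simp

lemma inj_eq: assumes "x \<in> H" "y \<in> H" "T x = T y" shows "x = y"
  using inj[of "x - y"] assms H.subspace by (simp add: diff subspace_diff)

lemma pow_inj: "x \<in> H \<Longrightarrow> y \<in> H \<Longrightarrow> (T ^^ n) x = (T ^^ n) y \<Longrightarrow> x = y"
proof (induction n)
  case (Suc n)
  then show ?case using inj_eq[OF pow_mem pow_mem, of x y n n] by simp
qed simp

lemma pow_log_convex:
  assumes "x \<in> H"
  shows "(norm ((T ^^ Suc n) x))\<^sup>2 \<le> norm ((T ^^ n) x) * norm ((T ^^ Suc (Suc n)) x)"
proof -
  have "(norm ((T ^^ Suc n) x))\<^sup>2 = inner (T ((T ^^ n) x)) (T ((T ^^ n) x))"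
    by (simp add: power2_norm_eq_inner)
  also have "\<dots> = inner ((T ^^ n) x) ((T ^^ Suc (Suc n)) x)"
    using sym[OF pow_mem[OF assms] mem[OF pow_mem[OF assms]]] by simp
  finally show ?thesis using norm_cauchy_schwarz by metis
qed

text \<open>
  The spectral subspace of \<open>T\<^sup>-\<^sup>1\<close> for \<open>[0, s]\<close>, characterised by the growth of the iterates
  \<open>T\<^sup>-\<^sup>n x\<close>. This description involves no functional calculus.
\<close>

definition G :: "real \<Rightarrow> 'a set" where
  "G s = {x\<in>H. \<forall>n. \<exists>w\<in>H. (T ^^ n) w = x \<and> norm w \<le> s ^ n * norm x}"

lemma G_preimages:
  assumes x: "x \<in> H" and w: "\<And>n. w n \<in> H" "\<And>n. (T ^^ n) (w n) = x"
  shows "w 0 = x" "T (w (Suc n)) = w n" "(T ^^ m) (w (n + m)) = w n"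
    "(norm (w (Suc n)))\<^sup>2 \<le> norm (w n) * norm (w (Suc (Suc n)))"
proof -
  show "w 0 = x" using w(2)[of 0] by simp
  have m: "(T ^^ m) (w (n + m)) = w n" for n m
  proof (rule pow_inj)
    show "(T ^^ n) ((T ^^ m) (w (n + m))) = (T ^^ n) (w n)"
      using w(2)[of "n + m"] w(2)[of n] by (simp add: funpow_add)
  qed (use w in \<open>simp_all add: pow_mem\<close>)
  then show "(T ^^ m) (w (n + m)) = w n" .
  have T1: "T (w (Suc n)) = w n" for n using m[of 1 n] by simp
  then show "T (w (Suc n)) = w n" .
  have "(norm (w (Suc n)))\<^sup>2 = inner (T (w (Suc (Suc n)))) (w (Suc n))"
    by (simp add: T1 power2_norm_eq_inner)
  also have "\<dots> = inner (w (Suc (Suc n))) (w n)" using sym[OF w(1) w(1), of "Suc (Suc n)" "Suc n"] T1 by simp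
  also have "\<dots> \<le> norm (w n) * norm (w (Suc (Suc n)))"
    using norm_cauchy_schwarz[of "w n" "w (Suc (Suc n))"] by (simp add: inner_commute)
  finally show "(norm (w (Suc n)))\<^sup>2 \<le> norm (w n) * norm (w (Suc (Suc n)))" .
qed

text \<open>
  The norms of the iterates \<open>T\<^sup>-\<^sup>n x\<close> are log-convex, so a growth bound with any constant improves
  to the one in the definition. Sums satisfy only the former, which is how \<open>G s\<close> turns out to be
  linear.
\<close>

lemma G_I:
  assumes x: "x \<in> H" and s: "0 < s" and w: "\<And>n. w n \<in> H" "\<And>n. (T ^^ n) (w n) = x"
    and bound: "\<And>n. norm (w n) \<le> C * s ^ n"
  shows "x \<in> G s"
proof -
  have "norm (w n) \<le> s ^ n * norm (w 0)" for n
    using log_convex_bound[of "\<lambda>n. norm (w n)" s C n] G_preimages(4)[OF x w] s bound by simp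
  then show ?thesis using x w G_preimages(1)[OF x w] unfolding G_def by auto
qed

lemma G_D:
  assumes "x \<in> G s"
  obtains w where "\<forall>n. w n \<in> H" "\<forall>n. (T ^^ n) (w n) = x" "\<forall>n. norm (w n) \<le> s ^ n * norm x"
proof -
  have "\<forall>n. \<exists>w. w \<in> H \<and> (T ^^ n) w = x \<and> norm w \<le> s ^ n * norm x"
    using assms unfolding G_def by blast
  then obtain w where "\<forall>n. w n \<in> H \<and> (T ^^ n) (w n) = x \<and> norm (w n) \<le> s ^ n * norm x"
    by metis
  then show ?thesis using that[of w] by blast
qed

lemma G_subset: "G s \<subseteq> H" by (auto simp: G_def)

lemma G_trivial: assumes "s < 1" shows "G s = {0}"
proof -
  have "x = 0" if x: "x \<in> G s" for x
  proof (rule ccontr)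
    assume x0: "x \<noteq> 0"
    obtain w where w: "\<forall>n. w n \<in> H" "\<forall>n. (T ^^ n) (w n) = x" "\<forall>n. norm (w n) \<le> s ^ n * norm x"
      by (rule G_D[OF x])
    have "T (w 1) = x" using w(2)[rule_format, of 1] by simp
    then have "norm x \<le> norm (w 1)" using norm_le w(1) by metis
    also have "\<dots> \<le> s * norm x" using w(3)[rule_format, of 1] by simp
    finally show False using assms x0 by simp
  qed
  moreover have "0 \<in> G s"
    using subspace_0[OF H.subspace] linear_0[OF pow_linear] by (auto simp: G_def intro!: bexI[of _ 0])
  ultimately show ?thesis by blast
qed

lemma G_mono: assumes "s \<le> t" shows "G s \<subseteq> G t"
proof (cases "s < 1")
  case True
  then show ?thesis using G_trivial[OF True] G_trivial[of t]
    linear_0[OF pow_linear] subspace_0[OF H.subspace] by (auto simp: G_def intro!: bexI[of _ 0])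
next
  case False
  then have "s ^ n * norm x \<le> t ^ n * norm x" for n and x :: 'a
    using assms by (intro mult_right_mono power_mono) simp_all
  then show ?thesis unfolding G_def by (blast intro: order_trans)
qed

lemma G_subspace: "subspace (G s)"
proof (cases "s < 1")
  case False
  then have s: "0 < s" by simp
  show ?thesis
  proof (rule subspaceI)
    show "0 \<in> G s" using subspace_0[OF H.subspace] linear_0[OF pow_linear]
      by (auto simp: G_def intro!: bexI[of _ 0])
  next
    fix x y assume xy: "x \<in> G s" "y \<in> G s"
    obtain w where w: "\<forall>n. w n \<in> H" "\<forall>n. (T ^^ n) (w n) = x" "\<forall>n. norm (w n) \<le> s ^ n * norm x"
      by (rule G_D[OF xy(1)])
    obtain v where v: "\<forall>n. v n \<in> H" "\<forall>n. (T ^^ n) (v n) = y" "\<forall>n. norm (v n) \<le> s ^ n * norm y"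
      by (rule G_D[OF xy(2)])
    have "norm (w n + v n) \<le> (norm x + norm y) * s ^ n" for n
      using norm_triangle_ineq[of "w n" "v n"] w(3)[rule_format, of n] v(3)[rule_format, of n]
      by (simp add: algebra_simps)
    moreover have "x \<in> H" "y \<in> H" using xy G_subset by blast+
    ultimately show "x + y \<in> G s"
      using w v H.subspace
      by (intro G_I[where w = "\<lambda>n. w n + v n"])
        (auto simp: s subspace_add linear_add[OF pow_linear])
  next
    fix c x assume x: "x \<in> G s"
    obtain w where w: "\<forall>n. w n \<in> H" "\<forall>n. (T ^^ n) (w n) = x" "\<forall>n. norm (w n) \<le> s ^ n * norm x"
      by (rule G_D[OF x])
    have "norm (c *\<^sub>R w n) \<le> (\<bar>c\<bar> * norm x) * s ^ n" for n
      using mult_left_mono[OF w(3)[rule_format, of n], of "\<bar>c\<bar>"] by (simp add: ac_simps)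
    moreover have "x \<in> H" using x G_subset by blast
    ultimately show "c *\<^sub>R x \<in> G s"
      using w H.subspace
      by (intro G_I[where w = "\<lambda>n. c *\<^sub>R w n"])
        (auto simp: s subspace_scale linear_scale[OF pow_linear])
  qed
qed (simp add: G_trivial)

lemma G_inverse:
  assumes "x \<in> G s"
  obtains w where "w \<in> G s" "T w = x" "norm w \<le> s * norm x"
proof (cases "s < 1")
  case True
  then have "x = 0" using assms G_trivial by blast
  then show ?thesis using that[of 0] subspace_0[OF G_subspace] zero by simp
next
  case False
  obtain w where w: "\<forall>n. w n \<in> H" "\<forall>n. (T ^^ n) (w n) = x" "\<forall>n. norm (w n) \<le> s ^ n * norm x"
    by (rule G_D[OF assms])
  have x: "x \<in> H" using assms G_subset by blast
  note pre = G_preimages[OF x w(1)[rule_format] w(2)[rule_format]]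
  have "w 1 \<in> G s"
  proof (rule G_I)
    show "(T ^^ n) (w (1 + n)) = w 1" for n by (rule pre(3))
    show "norm (w (1 + n)) \<le> (s * norm x) * s ^ n" for n
      using w(3)[rule_format, of "1 + n"] by (simp add: ac_simps)
  qed (use w(1) False in simp_all)
  moreover have "T (w 1) = x" using pre(1) pre(2)[of 0] by simp
  moreover have "norm (w 1) \<le> s * norm x" using w(3)[rule_format, of 1] by simp
  ultimately show ?thesis using that by blast
qed

lemma G_invariant: assumes x: "x \<in> G s" shows "T x \<in> G s"
proof (cases "s < 1")
  case True
  then show ?thesis using x G_trivial zero by auto
next
  case False
  obtain w where w: "\<forall>n. w n \<in> H" "\<forall>n. (T ^^ n) (w n) = x" "\<forall>n. norm (w n) \<le> s ^ n * norm x"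
    by (rule G_D[OF x])
  show ?thesis
  proof (rule G_I)
    show "(T ^^ n) (T (w n)) = T x" for n using w(2) by (simp flip: funpow_swap1)
    show "norm (T (w n)) \<le> norm x * s ^ n" for n
      using norm_le[of "w n"] w(1,3) by (metis mult.commute order_trans)
  qed (use w(1) mem x G_subset False in auto)
qed

lemma pow_tendsto:
  assumes "\<And>n. x n \<in> H" "y \<in> H" "x \<longlonglongrightarrow> y" shows "(\<lambda>k. (T ^^ n) (x k)) \<longlonglongrightarrow> (T ^^ n) y"
proof -
  have "(\<lambda>k. norm ((T ^^ n) (x k) - (T ^^ n) y)) \<longlonglongrightarrow> 0"
  proof (rule tendsto_sandwich[OF _ _ tendsto_const])
    show "(\<lambda>k. norm (x k - y)) \<longlonglongrightarrow> 0" using assms(3) by (simp add: LIM_zero_iff tendsto_norm_zero_iff)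
    show "\<forall>\<^sub>F k in sequentially. norm ((T ^^ n) (x k) - (T ^^ n) y) \<le> norm (x k - y)"
      using pow_norm_le[of "x _ - y" n] assms H.subspace
      by (simp add: linear_diff[OF pow_linear] subspace_diff)
  qed simp
  then show ?thesis by (simp add: LIM_zero_iff tendsto_norm_zero_iff)
qed

text \<open>
  On \<open>G s\<close> the inverse of \<open>T\<^sup>n\<close> is Lipschitz with constant \<open>s\<^sup>n\<close>, so preimages of a convergent
  sequence converge.
\<close>

lemma G_closed: "closed (G s)"
proof (cases "s < 1")
  case False
  show ?thesis unfolding closed_sequential_limits
  proof (intro allI impI)
    fix x l assume x: "(\<forall>k. x k \<in> G s) \<and> x \<longlonglongrightarrow> l"
    then have xH: "x k \<in> H" for k using G_subset by blast
    have l: "l \<in> H" using x xH complete_imp_closed[OF H.complete] closed_sequentially by blast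
    have "\<exists>w\<in>H. (T ^^ n) w = l \<and> norm w \<le> s ^ n * norm l" for n
    proof -
      have "\<forall>k. \<exists>w. w \<in> H \<and> (T ^^ n) w = x k \<and> norm w \<le> s ^ n * norm (x k)"
        using x unfolding G_def by blast
      then obtain w where w: "\<And>k. w k \<in> H" "\<And>k. (T ^^ n) (w k) = x k"
        "\<And>k. norm (w k) \<le> s ^ n * norm (x k)" by metis
      have diff: "norm (w j - w k) \<le> s ^ n * norm (x j - x k)" for j k
      proof -
        have "x j - x k \<in> G s" using x G_subspace by (simp add: subspace_diff)
        then obtain u where u: "u \<in> H" "(T ^^ n) u = x j - x k" "norm u \<le> s ^ n * norm (x j - x k)"
          unfolding G_def by blast
        have "u = w j - w k" using u w H.subspace
          by (intro pow_inj[of u _ n]) (simp_all add: subspace_diff linear_diff[OF pow_linear])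
        then show ?thesis using u by simp
      qed
      have "Cauchy w"
      proof (rule metric_CauchyI)
        fix e :: real assume "e > 0"
        then have "e / s ^ n > 0" using False by simp
        moreover have "Cauchy x" using x LIMSEQ_imp_Cauchy by blast
        ultimately obtain M where M: "\<forall>m\<ge>M. \<forall>n'\<ge>M. dist (x m) (x n') < e / s ^ n"
          using metric_CauchyD by blast
        have "dist (w i) (w j) < e" if "i \<ge> M" "j \<ge> M" for i j
        proof -
          have "s ^ n * norm (x i - x j) < e"
            using M that False unfolding dist_norm by (simp add: pos_less_divide_eq mult.commute)
          then show ?thesis using diff[of i j] unfolding dist_norm by linarith
        qed
        then show "\<exists>M. \<forall>m\<ge>M. \<forall>n\<ge>M. dist (w m) (w n) < e" by blast
      qed
      then obtain v where v: "v \<in> H" "w \<longlonglongrightarrow> v"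
        using H.complete w(1) unfolding complete_def by blast
      have "x \<longlonglongrightarrow> (T ^^ n) v" using pow_tendsto[OF w(1) v, of n] w(2) by simp
      then have "(T ^^ n) v = l" using x LIMSEQ_unique by blast
      moreover have "norm v \<le> s ^ n * norm l"
      proof (rule LIMSEQ_le)
        show "(\<lambda>k. norm (w k)) \<longlonglongrightarrow> norm v" by (intro tendsto_norm v)
        show "(\<lambda>k. s ^ n * norm (x k)) \<longlonglongrightarrow> s ^ n * norm l"
          using x by (intro tendsto_intros) simp
      qed (use w(3) in blast)
      ultimately show ?thesis using v(1) by blast
    qed
    then show "l \<in> G s" using l by (simp add: G_def)
  qed
qed (simp add: G_trivial)

lemma G_complete_subspace: "complete_subspace (G s)"
  using complete_subspace_closed[OF _ G_closed G_subspace G_subset] H.complete_subspace_axioms by blast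

text \<open>
  The norm bound does not make the preimages of a convergent sequence convergent, but a weak
  cluster point of them is mapped to the limit.
\<close>

lemma image_ball_closed:
  "closed {y. \<exists>w\<in>H. (T ^^ n) w = y \<and> norm w \<le> M}"
  unfolding closed_sequential_limits
proof (intro allI impI)
  fix x l assume x: "(\<forall>k. x k \<in> {y. \<exists>w\<in>H. (T ^^ n) w = y \<and> norm w \<le> M}) \<and> x \<longlonglongrightarrow> l"
  then have "\<forall>k. \<exists>w. w \<in> H \<and> (T ^^ n) w = x k \<and> norm w \<le> M" by blast
  then obtain w where w: "\<And>k. w k \<in> H" "\<And>k. (T ^^ n) (w k) = x k" "\<And>k. norm (w k) \<le> M" by metis
  obtain v where v: "v \<in> H" "\<forall>k. v \<in> closure (convex hull (w ` {k..}))"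
    by (rule weak_cluster_point[OF H.complete H.subspace w(1,3)])
  have "closure (convex hull (w ` {0..})) \<subseteq> cball 0 M"
    using w(3) by (intro closure_minimal hull_minimal) (auto simp: dist_norm)
  then have "v \<in> cball 0 M" using v(2) by blast
  then have nv: "norm v \<le> M" by simp
  have "dist ((T ^^ n) v) l \<le> e" if e: "e > 0" for e
  proof -
    obtain k where k: "\<And>j. j \<ge> k \<Longrightarrow> dist (x j) l \<le> e"
      using x e by (metis (no_types, lifting) lim_sequentially less_imp_le)
    have lin: "linear (T ^^ n)" by (rule pow_linear)
    have sub: "convex hull (w ` {k..}) \<subseteq> H \<inter> (T ^^ n) -` cball l e"
    proof (rule hull_minimal)
      show "w ` {k..} \<subseteq> H \<inter> (T ^^ n) -` cball l e" using w k by (auto simp: dist_commute)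
      show "convex (H \<inter> (T ^^ n) -` cball l e)"
        using subspace_imp_convex[OF H.subspace] convex_linear_vimage[OF lin convex_cball]
        by (rule convex_Int)
    qed
    obtain u where u: "\<And>i. u i \<in> convex hull (w ` {k..})" "u \<longlonglongrightarrow> v"
      using v(2) closure_sequential by metis
    have "(\<lambda>i. (T ^^ n) (u i)) \<longlonglongrightarrow> (T ^^ n) v"
      using u sub v(1) by (intro pow_tendsto) auto
    moreover have "(T ^^ n) (u i) \<in> cball l e" for i using u(1)[of i] sub by blast
    ultimately have "(T ^^ n) v \<in> cball l e" using closed_cball closed_sequentially by metis
    then show ?thesis by (simp add: dist_commute)
  qed
  then have "(T ^^ n) v = l" by (meson dist_le_zero_iff dense_ge)
  then show "l \<in> {y. \<exists>w\<in>H. (T ^^ n) w = y \<and> norm w \<le> M}" using v(1) nv by blast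
qed

lemma scaled_pow: "((\<lambda>x. s *\<^sub>R T x) ^^ n) x = s ^ n *\<^sub>R (T ^^ n) x"
  by (induction n) (simp_all add: scale)

text \<open>
  Let \<open>U = s T\<close> and suppose that \<open>\<parallel>Ux\<parallel> > \<parallel>x\<parallel>\<close> for some \<open>x\<close> in the complement \<open>K\<close> of \<open>G s\<close>. The
  vectors \<open>y = U\<^sup>N (1 + U\<^sup>N)\<^sup>-\<^sup>1 x\<close>, with \<open>N\<close> large and even, approximate the projection of \<open>x\<close> to
  the spectral subspace of \<open>U\<close> for \<open>[1, \<infinity>)\<close>, which is \<open>G s\<close>. They lie in \<open>K\<close>, have preimages
  under \<open>T\<^sup>k\<close> of norm at most \<open>s\<^sup>k \<parallel>x\<parallel>\<close> for all \<open>k \<le> N\<close>, and satisfy \<open>\<langle>y, x\<rangle> \<ge> \<delta>\<close> with a \<open>\<delta> > 0\<close>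
  independent of \<open>N\<close>. These conditions define decreasing nonempty closed convex sets, whose
  common point lies in \<open>G s\<close> and in \<open>K\<close>, but is not orthogonal to \<open>x\<close>.
\<close>

lemma norm_le_on_perp:
  assumes x: "x \<in> H" "\<And>g. g \<in> G s \<Longrightarrow> inner x g = 0" and s: "0 < s"
  shows "s * norm (T x) \<le> norm x"
proof (rule ccontr)
  assume "\<not> ?thesis"
  then have big: "norm x < s * norm (T x)" by simp
  define K where "K = {x\<in>H. \<forall>g\<in>G s. inner x g = 0}"
  have cK: "complete_subspace K"
    unfolding K_def by (rule complete_subspace_perp[OF H.complete_subspace_axioms])
  interpret K: complete_subspace K by (rule cK)
  have KH: "K \<subseteq> H" and xK: "x \<in> K" using x by (auto simp: K_def)
  define U where "U = (\<lambda>x. s *\<^sub>R T x)"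
  have Upow: "(U ^^ n) y = s ^ n *\<^sub>R (T ^^ n) y" for n y unfolding U_def by (rule scaled_pow)
  have TK: "T y \<in> K" if "y \<in> K" for y
    using that G_invariant[of _ s] G_subset[of s] sym[of y] mem
    unfolding K_def by auto
  have TnK: "(T ^^ n) y \<in> K" if "y \<in> K" for n y
    by (induction n) (simp_all add: that TK)
  have UK: "(U ^^ n) y \<in> K" if "y \<in> K" for n y
    unfolding Upow using TnK[OF that] K.subspace by (simp add: subspace_scale)
  have Ulin: "linear (U ^^ n)" for n
    unfolding linear_iff Upow using pow_linear[of n] by (simp add: linear_iff scaleR_add_right)
  have Usym: "inner ((U ^^ n) y) z = inner y ((U ^^ n) z)" if "y \<in> K" "z \<in> K" for n y z
    using pow_sym[of y z n] that KH unfolding Upow by auto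
  have Uhalf: "inner ((U ^^ (2 * j)) y) y = (norm ((U ^^ j) y))\<^sup>2" if "y \<in> K" for j y
  proof -
    have "(U ^^ (2 * j)) y = (U ^^ j) ((U ^^ j) y)" by (simp add: mult_2 funpow_add)
    then show ?thesis using Usym[OF UK[OF that] that] by (simp add: power2_norm_eq_inner)
  qed
  have Unorm: "norm ((U ^^ Suc i) y) \<le> s * norm ((U ^^ i) y)" if "y \<in> K" for i y
  proof -
    have "(U ^^ i) y \<in> H" using UK[OF that] KH by blast
    then show ?thesis using norm_le s by (simp add: U_def)
  qed
  define \<delta> where "\<delta> = ((norm (U x))\<^sup>2 - (norm x)\<^sup>2) / (2 * s\<^sup>2)"
  have "norm x < norm (U x)" using big s by (simp add: U_def)
  then have \<delta>: "\<delta> > 0" using s by (simp add: \<delta>_def power_strict_mono)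
  define C where "C n = {y\<in>K. \<delta> \<le> inner y x \<and>
      (\<forall>k\<le>n. y \<in> {y. \<exists>w\<in>H. (T ^^ k) w = y \<and> norm w \<le> s ^ k * norm x})}" for n
  have ne: "\<exists>y\<in>C n. norm y \<le> norm x" for n
  proof -
    define j where "j = Suc n"
    \<comment> \<open>An even exponent makes \<open>U\<^sup>N\<close> positive with square root \<open>U\<^sup>j\<close>, and \<open>N \<ge> n\<close>.\<close>
    define N where "N = 2 * j"
    obtain z where z: "z \<in> K" "z + (U ^^ N) z = x"
    proof (rule identity_plus_positive_surjective[OF cK Ulin UK Usym _ xK, of N])
      show "0 \<le> inner ((U ^^ N) y) y" if "y \<in> K" for y
        using Uhalf[OF that] by (simp add: N_def)
    qed
    define a where "a i = norm ((U ^^ i) z)" for i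
    have a: "0 \<le> a i" "(a (Suc i))\<^sup>2 \<le> a i * a (Suc (Suc i))" for i
    proof -
      have zH: "z \<in> H" using z KH by blast
      show "0 \<le> a i" by (simp add: a_def)
      have ai: "a i = s ^ i * norm ((T ^^ i) z)" for i using s by (simp add: a_def Upow)
      have "(a (Suc i))\<^sup>2 = (s ^ Suc i)\<^sup>2 * (norm ((T ^^ Suc i) z))\<^sup>2"
        by (simp only: ai power_mult_distrib)
      also have "\<dots> \<le> (s ^ Suc i)\<^sup>2 * (norm ((T ^^ i) z) * norm ((T ^^ Suc (Suc i)) z))"
        by (intro mult_left_mono pow_log_convex zH) simp
      also have "(s ^ Suc i)\<^sup>2 = s ^ i * s ^ Suc (Suc i)" by (simp add: power2_eq_square)
      finally show "(a (Suc i))\<^sup>2 \<le> a i * a (Suc (Suc i))" unfolding ai by (simp only: ac_simps)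
    qed
    have zx: "inner ((U ^^ N) z) x = (a j)\<^sup>2 + (a N)\<^sup>2"
      using Uhalf[OF z(1), of j] z(2)[symmetric]
      by (simp add: inner_add_right a_def N_def power2_norm_eq_inner)
    have nx: "(norm x)\<^sup>2 = (a 0)\<^sup>2 + 2 * (a j)\<^sup>2 + (a N)\<^sup>2"
      using Uhalf[OF z(1), of j] z(2)[symmetric]
      by (simp add: inner_add_right inner_add_left a_def N_def power2_norm_eq_inner inner_commute)
    have nUx: "(norm (U x))\<^sup>2 = (a 1)\<^sup>2 + 2 * (a (Suc j))\<^sup>2 + (a (Suc N))\<^sup>2"
    proof -
      have Uz: "U z \<in> K" using UK[OF z(1), of 1] by simp
      have Ulin1: "linear U" using Ulin[of 1] by simp
      have "U x = U z + U ((U ^^ N) z)"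
        unfolding z(2)[symmetric] by (rule linear_add[OF Ulin1])
      then have "U x = U z + (U ^^ N) (U z)" by (simp only: funpow_swap1)
      then have "(norm (U x))\<^sup>2 = (norm (U z))\<^sup>2 + 2 * inner ((U ^^ N) (U z)) (U z) + (norm ((U ^^ N) (U z)))\<^sup>2"
        by (simp add: power2_norm_eq_inner inner_add_left inner_add_right inner_commute)
      then show ?thesis using Uhalf[OF Uz, of j] by (simp add: a_def N_def funpow_swap1)
    qed
    have a0x: "a 0 \<le> norm x" "a N \<le> norm x"
    proof -
      have "(a 0)\<^sup>2 \<le> (norm x)\<^sup>2" "(a N)\<^sup>2 \<le> (norm x)\<^sup>2" unfolding nx by simp_all
      then show "a 0 \<le> norm x" "a N \<le> norm x" using power2_le_imp_le norm_ge_zero by blast+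
    qed
    have amid: "a i \<le> norm x" if "i \<le> N" for i
      by (rule log_convex_le_endpoints[where a = a, OF a a0x that])
    \<comment> \<open>Comparing the expansions of \<open>\<parallel>Ux\<parallel>\<^sup>2\<close> and \<open>\<parallel>x\<parallel>\<^sup>2\<close>: the term \<open>a 1\<close> is dominated by the end points,
      all other terms of \<open>\<parallel>Ux\<parallel>\<^sup>2\<close> by \<open>s\<^sup>2\<close> times terms of \<open>\<langle>y, x\<rangle>\<close>.\<close>
    have a1: "(a 1)\<^sup>2 \<le> (a 0)\<^sup>2 + (a N)\<^sup>2"
    proof (cases "a 1 \<le> a 0")
      case True
      then have "(a 1)\<^sup>2 \<le> (a 0)\<^sup>2" using a(1) by (simp add: power_mono)
      moreover have "0 \<le> (a N)\<^sup>2" by simp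
      ultimately show ?thesis by linarith
    next
      case False
      have "a 1 \<le> a k" if "1 \<le> k" for k
        using that
      proof (induction rule: dec_induct)
        case (step k)
        then show ?case using log_convex_increasing[where a = a, OF a, of 0 k] False by simp
      qed simp
      then have "a 1 \<le> a N" by (simp add: N_def j_def)
      then have "(a 1)\<^sup>2 \<le> (a N)\<^sup>2" using a(1) by (simp add: power_mono)
      moreover have "0 \<le> (a 0)\<^sup>2" by simp
      ultimately show ?thesis by linarith
    qed
    have aS: "(a (Suc i))\<^sup>2 \<le> s\<^sup>2 * (a i)\<^sup>2" for i
      using power_mono[OF Unorm[OF z(1), of i] norm_ge_zero, of 2]
      by (simp add: a_def power_mult_distrib)
    have "(norm (U x))\<^sup>2 - (norm x)\<^sup>2 \<le> 2 * s\<^sup>2 * ((a j)\<^sup>2 + (a N)\<^sup>2)"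
    proof -
      have "0 \<le> s\<^sup>2 * (a N)\<^sup>2" "0 \<le> (a j)\<^sup>2" by simp_all
      then show ?thesis unfolding nx nUx using a1 aS[of j] aS[of N]
        by (simp only: distrib_left mult.assoc)
    qed
    then have \<delta>le: "\<delta> \<le> inner ((U ^^ N) z) x"
      unfolding \<delta>_def zx using s by (simp add: divide_le_eq ac_simps)
    have "\<exists>w\<in>H. (T ^^ k) w = (U ^^ N) z \<and> norm w \<le> s ^ k * norm x" if "k \<le> n" for k
    proof (rule bexI[of _ "s ^ k *\<^sub>R (U ^^ (N - k)) z"], rule conjI)
      have kN: "k \<le> N" using that by (simp add: N_def j_def)
      have "(T ^^ k) (s ^ k *\<^sub>R (U ^^ (N - k)) z) = (U ^^ k) ((U ^^ (N - k)) z)"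
        unfolding Upow[of k] by (simp add: linear_scale[OF pow_linear])
      also have "\<dots> = (U ^^ N) z" using kN by (simp flip: comp_apply[of "U ^^ k"] funpow_add)
      finally show "(T ^^ k) (s ^ k *\<^sub>R (U ^^ (N - k)) z) = (U ^^ N) z" .
      show "norm (s ^ k *\<^sub>R (U ^^ (N - k)) z) \<le> s ^ k * norm x"
        using amid[of "N - k"] s by (simp add: a_def mult_left_mono)
      show "s ^ k *\<^sub>R (U ^^ (N - k)) z \<in> H"
        using UK[OF z(1), of "N - k"] KH H.subspace by (auto simp: subspace_scale)
    qed
    then have "(U ^^ N) z \<in> C n" using UK[OF z(1)] \<delta>le by (simp add: C_def)
    moreover have "norm ((U ^^ N) z) \<le> norm x" using a0x(2) by (simp add: a_def)
    ultimately show ?thesis by blast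
  qed
  have clos: "closed (C n)" for n
  proof -
    have "C n = K \<inter> {y. \<delta> \<le> inner y x} \<inter>
        (\<Inter>k\<in>{..n}. {y. \<exists>w\<in>H. (T ^^ k) w = y \<and> norm w \<le> s ^ k * norm x})"
      unfolding C_def by blast
    moreover have "closed {y. \<delta> \<le> inner y x}"
      by (intro closed_Collect_le continuous_intros)
    moreover have "closed K" using K.complete complete_imp_closed by blast
    ultimately show ?thesis using image_ball_closed by (simp add: closed_Int closed_INT)
  qed
  have conv: "convex (C n)" for n
  proof (rule convexI)
    fix y z and u v :: real assume yz: "y \<in> C n" "z \<in> C n" and uv: "0 \<le> u" "0 \<le> v" "u + v = 1"
    have 1: "u *\<^sub>R y + v *\<^sub>R z \<in> K"
      using yz K.subspace by (simp add: C_def subspace_add subspace_scale)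
    have "u * \<delta> + v * \<delta> \<le> u * inner y x + v * inner z x"
      using yz uv by (intro add_mono mult_left_mono) (simp_all add: C_def)
    then have 2: "\<delta> \<le> inner (u *\<^sub>R y + v *\<^sub>R z) x"
      using uv by (simp add: inner_add_left flip: distrib_right)
    have "\<exists>w\<in>H. (T ^^ k) w = u *\<^sub>R y + v *\<^sub>R z \<and> norm w \<le> s ^ k * norm x" if k: "k \<le> n" for k
    proof -
      obtain w where w: "w \<in> H" "(T ^^ k) w = y" "norm w \<le> s ^ k * norm x"
        using yz(1) k unfolding C_def by blast
      obtain w' where w': "w' \<in> H" "(T ^^ k) w' = z" "norm w' \<le> s ^ k * norm x"
        using yz(2) k unfolding C_def by blast
      have "norm (u *\<^sub>R w + v *\<^sub>R w') \<le> u * norm w + v * norm w'"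
        using norm_triangle_ineq[of "u *\<^sub>R w" "v *\<^sub>R w'"] uv by simp
      also have "\<dots> \<le> u * (s ^ k * norm x) + v * (s ^ k * norm x)"
        using w w' uv by (intro add_mono mult_left_mono) simp_all
      also have "\<dots> = s ^ k * norm x" using uv by (simp flip: distrib_right)
      finally have "norm (u *\<^sub>R w + v *\<^sub>R w') \<le> s ^ k * norm x" .
      moreover have "(T ^^ k) (u *\<^sub>R w + v *\<^sub>R w') = u *\<^sub>R y + v *\<^sub>R z"
        using w w' by (simp add: linear_add[OF pow_linear] linear_scale[OF pow_linear])
      moreover have "u *\<^sub>R w + v *\<^sub>R w' \<in> H"
        using w w' H.subspace by (simp add: subspace_add subspace_scale)
      ultimately show ?thesis by blast
    qed
    then show "u *\<^sub>R y + v *\<^sub>R z \<in> C n" using 1 2 by (simp add: C_def)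
  qed
  have ex: "\<exists>y\<in>C n. norm (y - 0) \<le> norm x" for n using ne by simp
  have nonempty: "C n \<noteq> {}" for n using ne by blast
  have sub: "C 0 \<subseteq> H" using KH by (auto simp: C_def)
  have dec: "C (Suc n) \<subseteq> C n" for n by (auto simp: C_def)
  obtain y where y: "y \<in> (\<Inter>n. C n)" "\<forall>z\<in>(\<Inter>n. C n). norm (y - 0) \<le> norm (z - 0)"
    by (rule nested_convex_sets[OF H.complete sub dec conv clos nonempty ex])
  have yC: "y \<in> C n" for n using y(1) by blast
  have "y \<in> G s"
  proof -
    have "\<forall>n. \<exists>w. w \<in> H \<and> (T ^^ n) w = y \<and> norm w \<le> s ^ n * norm x"
      using yC unfolding C_def by blast
    then obtain w where w: "\<And>n. w n \<in> H" "\<And>n. (T ^^ n) (w n) = y" "\<And>n. norm (w n) \<le> s ^ n * norm x"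
      by metis
    show ?thesis
    proof (rule G_I)
      show "y \<in> H" using yC[of 0] KH by (auto simp: C_def)
      show "norm (w n) \<le> norm x * s ^ n" for n using w(3)[of n] by (simp add: mult.commute)
    qed (use w s in blast)+
  qed
  moreover have "y \<in> K" "\<delta> \<le> inner y x" using yC[of 0] by (simp_all add: C_def)
  ultimately have "inner y y = 0" unfolding K_def by blast
  then show False using \<open>\<delta> \<le> inner y x\<close> \<delta> by simp
qed

text \<open>
  Positivity of \<open>T\<close> at \<open>v = x - s T x\<close>, together with the norm bound applied to \<open>T x\<close>.
\<close>

lemma form_bound_on_perp:
  assumes x: "x \<in> H" "\<And>g. g \<in> G s \<Longrightarrow> inner x g = 0" and s: "0 < s"
  shows "s * (norm (T x))\<^sup>2 \<le> inner (T x) x"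
proof -
  have Tx: "T x \<in> H" "\<And>g. g \<in> G s \<Longrightarrow> inner (T x) g = 0"
    using x sym[of x] mem G_invariant[of _ s] G_subset[of s] by auto
  define v where "v = x - s *\<^sub>R T x"
  have v: "v \<in> H" using x Tx H.subspace by (simp add: v_def subspace_diff subspace_scale)
  have "0 \<le> inner (T v) v" using positive[OF v] by (meson order_trans zero_le_power2)
  also have "inner (T v) v = inner (T x) x - 2 * s * inner (T x) (T x) + s * (s * inner (T (T x)) (T x))"
    using sym[OF Tx(1) x(1)] 
    by (simp add: v_def diff scale inner_diff_left inner_diff_right algebra_simps)
  also have "s * inner (T (T x)) (T x) \<le> (s * norm (T (T x))) * norm (T x)"
    using norm_cauchy_schwarz[of "T (T x)" "T x"] s by simp
  also have "\<dots> \<le> norm (T x) * norm (T x)"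
    using norm_le_on_perp[OF Tx s] by (intro mult_right_mono) simp_all
  finally have "0 \<le> inner (T x) x - 2 * s * inner (T x) (T x) + s * (norm (T x) * norm (T x))"
    using s by (simp add: mult_left_mono)
  then show ?thesis by (simp add: power2_norm_eq_inner norm_eq_sqrt_inner power2_eq_square)
qed

text \<open>
  Here \<open>T w\<close> is an element of the spectral subspace of \<open>T\<^sup>-\<^sup>1\<close> for \<open>(u, v]\<close>: the operator \<open>T\<^sup>-\<^sup>1\<close>
  and its form are bounded there by \<open>u\<close> from below and by \<open>v\<close> from above.
\<close>

lemma interval_bounds:
  assumes w: "w \<in> G v" "\<And>g. g \<in> G u \<Longrightarrow> inner (T w) g = 0" and u: "0 < u"
  shows "u * (norm (T w))\<^sup>2 \<le> inner w (T w)" "inner w (T w) \<le> v * (norm (T w))\<^sup>2"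
    "u\<^sup>2 * (norm (T w))\<^sup>2 \<le> (norm w)\<^sup>2" "(norm w)\<^sup>2 \<le> v\<^sup>2 * (norm (T w))\<^sup>2"
    "\<And>g. g \<in> G u \<Longrightarrow> inner w g = 0"
proof -
  have wH: "w \<in> H" using w(1) G_subset by blast
  show perp: "inner w g = 0" if g: "g \<in> G u" for g
  proof -
    obtain g' where g': "g' \<in> G u" "T g' = g" "norm g' \<le> u * norm g" by (rule G_inverse[OF g])
    then show ?thesis using w(2)[OF g'(1)] sym[OF wH, of g'] G_subset[of u] by auto
  qed
  obtain w' where w': "w' \<in> G v" "T w' = T w" "norm w' \<le> v * norm (T w)"
    by (rule G_inverse[OF G_invariant[OF w(1)]])
  have "w' = w" using inj_eq[of w' w] w'(1,2) wH G_subset by blast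
  then have up: "norm w \<le> v * norm (T w)" using w'(3) by simp
  show "u * (norm (T w))\<^sup>2 \<le> inner w (T w)"
    using form_bound_on_perp[OF wH perp u] by (simp add: inner_commute)
  show "inner w (T w) \<le> v * (norm (T w))\<^sup>2"
  proof -
    have "inner w (T w) \<le> norm w * norm (T w)" by (rule norm_cauchy_schwarz)
    also have "\<dots> \<le> v * norm (T w) * norm (T w)" using up by (intro mult_right_mono) simp_all
    finally show ?thesis by (simp add: power2_eq_square mult.assoc)
  qed
  show "u\<^sup>2 * (norm (T w))\<^sup>2 \<le> (norm w)\<^sup>2"
    using power_mono[OF norm_le_on_perp[OF wH perp u], of 2] u by (simp add: power_mult_distrib)
  show "(norm w)\<^sup>2 \<le> v\<^sup>2 * (norm (T w))\<^sup>2"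
    using power_mono[OF up, of 2] by (simp add: power_mult_distrib)
qed

end

section \<open>Lebesgue--Stieltjes integrals\<close>

locale stieltjes =
  fixes F :: "real \<Rightarrow> real"
  assumes mono: "x \<le> y \<Longrightarrow> F x \<le> F y"
    and right_cont: "continuous (at_right a) F"
begin

abbreviation "\<mu> \<equiv> interval_measure F"

lemma measure_Ioc: "s \<le> t \<Longrightarrow> measure \<mu> {s<..t} = F t - F s"
  by (rule measure_interval_measure_Ioc[OF _ mono right_cont])

lemma emeasure_Ioc: "s \<le> t \<Longrightarrow> emeasure \<mu> {s<..t} = ennreal (F t - F s)"
  by (rule emeasure_interval_measure_Ioc[OF _ mono right_cont])

lemma finite_measure:
  assumes bound: "\<And>t. 0 \<le> F t" "\<And>t. F t \<le> M"
  shows "finite_measure \<mu>"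
proof (rule finite_measureI)
  define A where "A n = {- real n<..real n}" for n
  have "incseq A" unfolding A_def incseq_def by auto
  moreover have "(\<Union>n. A n) = UNIV"
  proof -
    have "x \<in> (\<Union>n. A n)" for x
    proof -
      obtain n where "\<bar>x\<bar> < real n" using reals_Archimedean2 by blast
      then have "x \<in> A n" by (auto simp: A_def)
      then show ?thesis by blast
    qed
    then show ?thesis by blast
  qed
  moreover have "range A \<subseteq> sets \<mu>" by (auto simp: A_def)
  ultimately have "emeasure \<mu> UNIV = (SUP n. emeasure \<mu> (A n))"
    using SUP_emeasure_incseq[of A \<mu>] by simp
  also have "\<dots> \<le> ennreal M"
  proof (rule SUP_least)
    fix n
    have "F (real n) - F (- real n) \<le> M" using bound[of "real n"] bound[of "- real n"] by linarith
    then show "emeasure \<mu> (A n) \<le> ennreal M" unfolding A_def by (simp add: emeasure_Ioc ennreal_leI)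
  qed
  finally have "emeasure \<mu> UNIV < \<infinity>" using ennreal_less_top le_less_trans by (metis infinity_ennreal_def)
  then show "emeasure \<mu> (space \<mu>) \<noteq> \<infinity>" by simp
qed

text \<open>
  Subdivide the interval into \<open>n\<close> equal parts: the increments of \<open>D\<close> sum up to \<open>O(1/n)\<close>.
\<close>

lemma increments_dominated:
  fixes D :: "real \<Rightarrow> real"
  assumes uv: "u \<le> v"
    and D: "\<And>s t. u \<le> s \<Longrightarrow> s \<le> t \<Longrightarrow> t \<le> v \<Longrightarrow> \<bar>D t - D s\<bar> \<le> C * (t - s) * (F t - F s)"
  shows "D v = D u"
proof (rule ccontr)
  assume ne: "D v \<noteq> D u"
  have le: "\<bar>D v - D u\<bar> \<le> C * (v - u) * (F v - F u) / real n" if n: "n > 0" for n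
  proof -
    define h where "h = (v - u) / real n"
    have h: "h \<ge> 0" "real n * h = v - u" using uv n by (simp_all add: h_def)
    define p where "p k = u + real k * h" for k
    have "\<bar>D (p k) - D u\<bar> \<le> C * h * (F (p k) - F u)" if "k \<le> n" for k
      using that
    proof (induction k)
      case (Suc k)
      have "real (Suc k) * h \<le> real n * h" using Suc.prems h by (intro mult_right_mono) simp_all
      then have "p (Suc k) \<le> v" using h(2) by (simp add: p_def)
      moreover have "u \<le> p k" using h(1) by (simp add: p_def)
      moreover have "p (Suc k) - p k = h" by (simp add: p_def algebra_simps)
      ultimately have "\<bar>D (p (Suc k)) - D (p k)\<bar> \<le> C * h * (F (p (Suc k)) - F (p k))"
        using D[of "p k" "p (Suc k)"] h(1) by simp
      moreover have "\<bar>D (p k) - D u\<bar> \<le> C * h * (F (p k) - F u)" using Suc by simp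
      ultimately show ?case by (simp add: right_diff_distrib)
    qed (simp add: p_def)
    from this[of n] show ?thesis using h n by (simp add: p_def h_def)
  qed
  obtain n where n: "\<bar>C * (v - u) * (F v - F u)\<bar> / \<bar>D v - D u\<bar> < real n"
    using reals_Archimedean2 by blast
  moreover have "0 \<le> \<bar>C * (v - u) * (F v - F u)\<bar> / \<bar>D v - D u\<bar>" by simp
  ultimately have n0: "0 < real n" by linarith
  have "\<bar>C * (v - u) * (F v - F u)\<bar> < \<bar>D v - D u\<bar> * real n"
    using n ne by (simp add: field_simps)
  moreover have "\<bar>D v - D u\<bar> * real n \<le> C * (v - u) * (F v - F u)"
    using le[of n] n0 by (simp add: field_simps)
  ultimately show False by linarith
qed

text \<open>
  The primitive \<open>t \<mapsto> \<integral>\<^bsub>(u,t]\<^esub> g dF\<close> satisfies the same two-sided estimate as \<open>G\<close>, and the two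
  bounds differ by at most \<open>C (t - s) (F t - F s)\<close>.
\<close>

lemma integral_eq:
  fixes g G :: "real \<Rightarrow> real"
  assumes uv: "u \<le> v" and g: "g \<in> borel_measurable borel"
    and gmono: "\<And>s t. u \<le> s \<Longrightarrow> s \<le> t \<Longrightarrow> t \<le> v \<Longrightarrow> g s \<le> g t"
    and lip: "\<And>s t. u \<le> s \<Longrightarrow> s \<le> t \<Longrightarrow> t \<le> v \<Longrightarrow> g t - g s \<le> C * (t - s)"
    and low: "\<And>s t. u \<le> s \<Longrightarrow> s \<le> t \<Longrightarrow> t \<le> v \<Longrightarrow> g s * (F t - F s) \<le> G t - G s"
    and up: "\<And>s t. u \<le> s \<Longrightarrow> s \<le> t \<Longrightarrow> t \<le> v \<Longrightarrow> G t - G s \<le> g t * (F t - F s)"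
  shows "set_integrable \<mu> {u<..v} g \<and> (LINT x:{u<..v}|\<mu>. g x) = G v - G u"
proof
  have fin: "emeasure \<mu> {s<..t} < \<infinity>" for s t
    by (cases "s \<le> t") (simp_all add: emeasure_Ioc)
  have int: "set_integrable \<mu> {s<..t} g" if "u \<le> s" "t \<le> v" for s t
    unfolding set_integrable_def
  proof (rule integrableI_bounded_set_indicator)
    show "AE x in \<mu>. x \<in> {s<..t} \<longrightarrow> norm (g x) \<le> max \<bar>g u\<bar> \<bar>g v\<bar>"
    proof (rule AE_I2, rule impI)
      fix x assume "x \<in> {s<..t}"
      then have "g u \<le> g x" "g x \<le> g v" using gmono that by auto
      then show "norm (g x) \<le> max \<bar>g u\<bar> \<bar>g v\<bar>" by auto
    qed
  qed (use g fin in \<open>simp_all add: measurable_def\<close>)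
  show "set_integrable \<mu> {u<..v} g" by (rule int) simp_all
  define D where "D t = G t - (LINT x:{u<..t}|\<mu>. g x)" for t
  have "\<bar>D t - D s\<bar> \<le> C * (t - s) * (F t - F s)" if st: "u \<le> s" "s \<le> t" "t \<le> v" for s t
  proof -
    let ?I = "LINT x:{s<..t}|\<mu>. g x"
    have "{u<..t} = {u<..s} \<union> {s<..t}" using st by auto
    moreover have "(LINT x:{u<..s} \<union> {s<..t}|\<mu>. g x) = (LINT x:{u<..s}|\<mu>. g x) + ?I"
      using st by (intro set_integral_Un int) auto
    ultimately have D: "D t - D s = (G t - G s) - ?I" by (simp add: D_def)
    have const: "set_integrable \<mu> {s<..t} (\<lambda>x. c)" "(LINT x:{s<..t}|\<mu>. c) = c * (F t - F s)" for c :: real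
      using fin[of s t] set_integral_const[of "{s<..t}" \<mu> c] measure_Ioc[OF st(2)]
      by (simp_all add: set_integrable_def less_top)
    have "g s * (F t - F s) \<le> ?I" unfolding const(2)[symmetric]
      using st gmono by (intro set_integral_mono const int) auto
    moreover have "?I \<le> g t * (F t - F s)" unfolding const(2)[symmetric]
      using st gmono by (intro set_integral_mono const int) auto
    ultimately have "\<bar>D t - D s\<bar> \<le> g t * (F t - F s) - g s * (F t - F s)"
      unfolding D using low[OF st] up[OF st] by linarith
    also have "\<dots> = (g t - g s) * (F t - F s)" by (simp add: algebra_simps)
    also have "\<dots> \<le> C * (t - s) * (F t - F s)"
      using lip[OF st] mono[OF st(2)] by (intro mult_right_mono) simp_all
    finally show ?thesis .
  qed
  then have "D v = D u" by (rule increments_dominated[OF uv])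
  then show "(LINT x:{u<..v}|\<mu>. g x) = G v - G u" by (simp add: D_def set_lebesgue_integral_def)
qed

end

section \<open>The spectral theorem for semibounded self-adjoint operators\<close>

text \<open>
  Orthogonal increments: for increasing projections the squared norm of a difference is the
  difference of the squared norms, which form a monotone bounded sequence.
\<close>

lemma Cauchy_of_norm_increments:
  fixes y :: "nat \<Rightarrow> 'a::real_normed_vector"
  assumes y: "\<And>n k. n \<le> k \<Longrightarrow> (norm (y k - y n))\<^sup>2 \<le> \<bar>f k - f n\<bar>" and f: "convergent f"
  shows "Cauchy y"
proof (rule metric_CauchyI)
  fix e :: real assume e: "e > 0"
  have "Cauchy f" using f convergent_Cauchy by blast
  then obtain M where M: "\<forall>m\<ge>M. \<forall>n\<ge>M. dist (f m) (f n) < e\<^sup>2"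
    using e by (metis metric_CauchyD zero_less_power)
  have *: "dist (y m) (y n) < e" if "n \<le> m" "M \<le> n" for m n
  proof -
    have "(norm (y m - y n))\<^sup>2 < e\<^sup>2"
      using y[OF that(1)] M[rule_format, of m n] that by (simp add: dist_real_def)
    then show ?thesis using e unfolding dist_norm by (meson less_imp_le power2_less_imp_less)
  qed
  have "dist (y m) (y n) < e" if "M \<le> m" "M \<le> n" for m n
    using *[of n m] *[of m n] that by (cases "n \<le> m") (simp_all add: dist_commute)
  then show "\<exists>M. \<forall>m\<ge>M. \<forall>n\<ge>M. dist (y m) (y n) < e" by blast
qed

context positive_injective_contraction
begin

text \<open>
  The spectral family of \<open>T\<^sup>-\<^sup>1\<close>.
\<close>

definition P :: "real \<Rightarrow> 'a \<Rightarrow> 'a" where "P s = proj (G s)"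

lemma P_mem: "P s x \<in> G s" "P s x \<in> H"
  using complete_subspace.proj(1)[OF G_complete_subspace] G_subset unfolding P_def by blast+

lemma P_inner: "g \<in> G s \<Longrightarrow> inner (P s x) g = inner x g"
  unfolding P_def by (rule complete_subspace.proj_inner'[OF G_complete_subspace])

lemma P_eqI: "p \<in> G s \<Longrightarrow> (\<And>g. g \<in> G s \<Longrightarrow> inner (x - p) g = 0) \<Longrightarrow> P s x = p"
  unfolding P_def by (rule complete_subspace.proj_eqI[OF G_complete_subspace])

lemma P_id: "x \<in> G s \<Longrightarrow> P s x = x"
  unfolding P_def by (rule complete_subspace.proj_id[OF G_complete_subspace])

lemma P_norm_le: "norm (P s x) \<le> norm x"
  unfolding P_def by (rule complete_subspace.norm_proj_le[OF G_complete_subspace])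

lemma P_self: "inner (P s x) x = (norm (P s x))\<^sup>2"
  unfolding P_def by (rule complete_subspace.proj_inner[OF G_complete_subspace])

lemma P_trivial: "s < 1 \<Longrightarrow> P s x = 0"
  using P_mem(1)[of s x] G_trivial by simp

lemma P_increment_perp:
  assumes "s \<le> t" "g \<in> G s" shows "inner (P t x - P s x) g = 0"
proof -
  have "g \<in> G t" using assms G_mono by blast
  then show ?thesis using P_inner assms(2) by (simp add: inner_diff_left)
qed

lemma P_increment_norm:
  assumes "s \<le> t" shows "(norm (P t x - P s x))\<^sup>2 = (norm (P t x))\<^sup>2 - (norm (P s x))\<^sup>2"
proof -
  have "inner (P t x - P s x) (P s x) = 0" by (rule P_increment_perp[OF assms P_mem(1)])
  then show ?thesis
    by (simp add: power2_norm_eq_inner inner_diff_left inner_diff_right inner_commute)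
qed

lemma P_norm_mono: "s \<le> t \<Longrightarrow> (norm (P s x))\<^sup>2 \<le> (norm (P t x))\<^sup>2"
  using P_increment_norm[of s t x] zero_le_power2[of "norm (P t x - P s x)"] by linarith

lemma P_commute: assumes "x \<in> H" shows "P s (T x) = T (P s x)"
proof (rule P_eqI)
  show "T (P s x) \<in> G s" by (rule G_invariant[OF P_mem(1)])
  fix g assume g: "g \<in> G s"
  have "inner (T x - T (P s x)) g = inner (x - P s x) (T g)"
    using sym[of "x - P s x" g] assms P_mem(2) g G_subset[of s] H.subspace
    by (auto simp: diff[symmetric] subspace_diff)
  then show "inner (T x - T (P s x)) g = 0"
    using P_inner[OF G_invariant[OF g], of x] by (simp add: inner_diff_left)
qed

lemma G_right_continuous:
  assumes "\<And>n::nat. y \<in> G (s n)" "s \<longlonglongrightarrow> t" shows "y \<in> G t"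
proof -
  have y: "y \<in> H" using assms(1) G_subset by blast
  have "\<exists>w\<in>H. (T ^^ k) w = y \<and> norm w \<le> t ^ k * norm y" for k
  proof -
    have "\<forall>n. \<exists>w. w \<in> H \<and> (T ^^ k) w = y \<and> norm w \<le> s n ^ k * norm y"
      using assms(1) unfolding G_def by blast
    then obtain w where w: "\<And>n. w n \<in> H" "\<And>n. (T ^^ k) (w n) = y" "\<And>n. norm (w n) \<le> s n ^ k * norm y"
      by metis
    have "w n = w 0" for n using pow_inj[OF w(1) w(1), of k n 0] w(2) by simp
    then have le: "norm (w 0) \<le> s n ^ k * norm y" for n using w(3)[of n] by metis
    have "(\<lambda>n. s n ^ k * norm y) \<longlonglongrightarrow> t ^ k * norm y" by (intro tendsto_intros assms)
    then have "norm (w 0) \<le> t ^ k * norm y" using LIMSEQ_le_const le by blast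
    then show ?thesis using w by blast
  qed
  then show ?thesis using y by (simp add: G_def)
qed

lemma P_tendsto_right: "((\<lambda>s. P s x) \<longlongrightarrow> P t x) (at_right t)"
proof (rule tendsto_at_right_sequentially[of t "t + 1"])
  fix S :: "nat \<Rightarrow> real" assume S: "\<And>n. t < S n" "decseq S" "S \<longlonglongrightarrow> t"
  define a where "a n = (norm (P (S n) x))\<^sup>2" for n
  have Sle: "S k \<le> S n" if "n \<le> k" for n k using S(2) that by (simp add: decseq_def)
  have "decseq a" using P_norm_mono Sle by (simp add: a_def decseq_def)
  then have "convergent a" using decseq_convergent[of a 0] by (auto simp: a_def convergent_def)
  then have "Cauchy (\<lambda>n. P (S n) x)"
  proof (rule Cauchy_of_norm_increments[rotated])
    show "(norm (P (S k) x - P (S n) x))\<^sup>2 \<le> \<bar>a k - a n\<bar>" if "n \<le> k" for n k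
      using P_increment_norm[OF Sle[OF that], of x] norm_minus_commute[of "P (S k) x"] by (simp add: a_def)
  qed
  then obtain y where y: "(\<lambda>n. P (S n) x) \<longlonglongrightarrow> y"
    using H.complete P_mem(2) unfolding complete_def by meson
  have "y \<in> G (S n)" for n
  proof (rule Lim_in_closed_set[OF G_closed])
    show "\<forall>\<^sub>F k in sequentially. P (S k) x \<in> G (S n)"
      using eventually_ge_at_top[of n]
    proof eventually_elim
      case (elim k)
      then show ?case using P_mem(1)[of "S k" x] G_mono[OF Sle] by blast
    qed
  qed (use y in auto)
  then have "y \<in> G t" using G_right_continuous S(3) by blast
  moreover have "inner (x - y) g = 0" if g: "g \<in> G t" for g
  proof -
    have "(\<lambda>n. inner (x - P (S n) x) g) \<longlonglongrightarrow> inner (x - y) g" by (intro tendsto_intros y)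
    moreover have "inner (x - P (S n) x) g = 0" for n
    proof -
      have "g \<in> G (S n)" using g G_mono[OF less_imp_le[OF S(1)]] by blast
      then show ?thesis using P_inner by (simp add: inner_diff_left)
    qed
    ultimately show ?thesis by (simp add: LIMSEQ_const_iff)
  qed
  ultimately have "P t x = y" by (rule P_eqI)
  then show "(\<lambda>n. P (S n) x) \<longlonglongrightarrow> P t x" using y by simp
qed simp

lemma P_tendsto_bot: "((\<lambda>s. P s x) \<longlongrightarrow> 0) at_bot"
proof (rule tendsto_eventually)
  show "\<forall>\<^sub>F s in at_bot. P s x = 0"
    unfolding eventually_at_bot_linorder by (rule exI[of _ 0]) (simp add: P_trivial)
qed

text \<open>
  The limit \<open>y\<close> of the projections leaves a remainder orthogonal to all \<open>G s\<close>, so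
  \<open>norm_le_on_perp\<close>, for all \<open>s\<close>, forces its image under \<open>T\<close> to vanish.
\<close>

lemma P_tendsto_top: assumes x: "x \<in> H" shows "((\<lambda>s. P s x) \<longlongrightarrow> x) at_top"
proof -
  define a where "a n = (norm (P (real n) x))\<^sup>2" for n
  have "incseq a" using P_norm_mono by (simp add: a_def incseq_def)
  moreover have "a n \<le> (norm x)\<^sup>2" for n using P_norm_le by (simp add: a_def power_mono)
  ultimately have "convergent a" using incseq_convergent[of a] by (metis convergentI)
  then have "Cauchy (\<lambda>n. P (real n) x)"
  proof (rule Cauchy_of_norm_increments[rotated])
    show "(norm (P (real k) x - P (real n) x))\<^sup>2 \<le> \<bar>a k - a n\<bar>" if "n \<le> k" for n k
      using P_increment_norm[of "real n" "real k" x] that by (simp add: a_def)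
  qed
  then obtain y where y: "y \<in> H" "(\<lambda>n. P (real n) x) \<longlonglongrightarrow> y"
    using H.complete P_mem(2) unfolding complete_def by meson
  define r where "r = x - y"
  have r: "r \<in> H" using x y H.subspace by (simp add: r_def subspace_diff)
  have perp: "inner r g = 0" if g: "g \<in> G s" for g s
  proof -
    have "(\<lambda>n. inner (x - P (real n) x) g) \<longlonglongrightarrow> inner r g" unfolding r_def by (intro tendsto_intros y)
    moreover have "\<forall>\<^sub>F n in sequentially. inner (x - P (real n) x) g = 0"
    proof -
      obtain N where N: "s \<le> real N" using real_arch_simple by blast
      show ?thesis using eventually_ge_at_top[of N]
      proof eventually_elim
        case (elim n)
        then have "g \<in> G (real n)" using g G_mono[of s "real n"] N by auto
        then show ?case using P_inner[of g "real n" x] by (simp add: inner_diff_left)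
      qed
    qed
    ultimately have "(\<lambda>n. 0) \<longlonglongrightarrow> inner r g" by (rule Lim_transform_eventually)
    then show ?thesis by (simp add: LIMSEQ_const_iff)
  qed
  have "T r = 0"
  proof (rule ccontr)
    assume "T r \<noteq> 0"
    then have n: "norm (T r) > 0" by simp
    obtain n where n': "norm r / norm (T r) < real n" using reals_Archimedean2 by blast
    have s: "0 < real n" using n n' by (smt (verit) divide_nonneg_pos norm_ge_zero)
    show False using norm_le_on_perp[OF r perp s] n' n by (simp add: field_simps)
  qed
  then have "r = 0" using inj r by blast
  then have yx: "y = x" by (simp add: r_def)
  show ?thesis
  proof (rule tendstoI)
    fix e :: real assume "e > 0"
    then obtain N where N: "dist (P (real N) x) x < e"
      using y(2) yx by (metis (no_types, lifting) lim_sequentially order_refl)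
    have "dist (P s x) x < e" if "real N \<le> s" for s
    proof -
      have eq: "(norm (x - P s x))\<^sup>2 = (norm x)\<^sup>2 - (norm (P s x))\<^sup>2" for s
        using P_self[of s x] by (simp add: power2_norm_eq_inner inner_diff_left inner_diff_right inner_commute)
      have "(norm (x - P s x))\<^sup>2 \<le> (norm (x - P (real N) x))\<^sup>2"
        unfolding eq using P_norm_mono[OF that] by simp
      then have "norm (x - P s x) \<le> norm (x - P (real N) x)"
        using power2_le_imp_le norm_ge_zero by blast
      then show ?thesis using N by (simp add: dist_norm norm_minus_commute)
    qed
    then show "\<forall>\<^sub>F s in at_top. dist (P s x) x < e"
      unfolding eventually_at_top_linorder by blast
  qed
qed

lemma spectral_family_P: "spectral_family H (\<lambda>t. P (t + m))"
proof -
  have "orthogonal_projection_in H (P s)" for s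
    unfolding orthogonal_projection_in_def
  proof (intro exI[of _ "G s"] conjI ballI)
    show "inner (x - P s x) y = 0" if "y \<in> G s" for x y
      using P_inner[OF that] by (simp add: inner_diff_left)
  qed (rule G_subspace G_closed G_subset P_mem)+
  moreover have "P (s + m) ` H \<subseteq> P (t + m) ` H" if "s \<le> t" for s t
  proof
    fix y assume "y \<in> P (s + m) ` H"
    then have "y \<in> G (t + m)" using P_mem(1) G_mono[of "s + m" "t + m"] that by auto
    then show "y \<in> P (t + m) ` H" using P_id G_subset by (metis image_eqI subsetD)
  qed
  moreover have "((\<lambda>s. P (s + m) x) \<longlongrightarrow> P (t + m) x) (at_right t)" for x t
  proof -
    have "filtermap (\<lambda>s. s + m) (at_right t) = at_right (t + m)"
      using filtermap_at_right_shift[of "- m" t] by simp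
    then have "((\<lambda>s. P s x) \<longlongrightarrow> P (t + m) x) (filtermap (\<lambda>s. s + m) (at_right t))"
      using P_tendsto_right[of x "t + m"] by (rule ssubst)
    then show ?thesis by (simp add: filterlim_filtermap)
  qed
  moreover have "((\<lambda>s. P (s + m) x) \<longlongrightarrow> 0) at_bot" for x
  proof (rule filterlim_compose[OF P_tendsto_bot])
    show "filterlim (\<lambda>s. s + m) at_bot at_bot" unfolding filterlim_at_bot
    proof
      fix Z show "\<forall>\<^sub>F s in at_bot. s + m \<le> Z"
        using eventually_le_at_bot[of "Z - m"] by eventually_elim simp
    qed
  qed
  moreover have "((\<lambda>s. P (s + m) x) \<longlongrightarrow> x) at_top" if "x \<in> H" for x
  proof (rule filterlim_compose[OF P_tendsto_top[OF that]])
    show "filterlim (\<lambda>s. s + m) at_top at_top" unfolding filterlim_at_top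
    proof
      fix Z show "\<forall>\<^sub>F s in at_top. Z \<le> s + m"
        using eventually_ge_at_top[of "Z - m"] by eventually_elim simp
    qed
  qed
  ultimately show ?thesis unfolding spectral_family_def by blast
qed

end

context stieltjes
begin

lemma AE_notin_Ioc:
  assumes "\<And>n::nat. \<alpha> n \<le> \<beta> n" "\<And>n. F (\<beta> n) = F (\<alpha> n)"
  shows "AE x in \<mu>. x \<notin> (\<Union>n. {\<alpha> n<..\<beta> n})"
proof -
  have "(\<Union>n. {\<alpha> n<..\<beta> n}) \<in> null_sets \<mu>"
    using emeasure_Ioc[OF assms(1)] assms(2) by (intro null_sets_UN) (simp add: null_sets_def)
  then show ?thesis by (rule AE_not_in)
qed

lemma AE_greater:
  assumes "\<And>t. t \<le> c \<Longrightarrow> F t = 0" shows "AE x in \<mu>. c < x"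
proof -
  have "(\<Union>n. {c - real n<..c}) = {..c}"
  proof (intro equalityI subsetI)
    fix x assume "x \<in> {..c}"
    moreover obtain n where "c - x < real n" using reals_Archimedean2 by blast
    ultimately have "x \<in> {c - real n<..c}" by simp
    then show "x \<in> (\<Union>n. {c - real n<..c})" by blast
  qed auto
  then show ?thesis using AE_notin_Ioc[of "\<lambda>n. c - real n" "\<lambda>n. c"] assms by (simp add: not_le)
qed

lemma AE_at_most:
  assumes "\<And>t. c \<le> t \<Longrightarrow> F t = M" shows "AE x in \<mu>. x \<le> c"
proof -
  have "(\<Union>n. {c<..c + real n}) = {c<..}"
  proof (intro equalityI subsetI)
    fix x assume "x \<in> {c<..}"
    moreover obtain n where "x - c < real n" using reals_Archimedean2 by blast
    ultimately show "x \<in> (\<Union>n. {c<..c + real n})" by (auto intro!: exI[of _ n])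
  qed auto
  then show ?thesis using AE_notin_Ioc[of "\<lambda>n. c" "\<lambda>n. c + real n"] assms by (simp add: not_less)
qed

lemma AE_at_least:
  assumes "\<And>t. t < c \<Longrightarrow> F t = 0" shows "AE x in \<mu>. c \<le> x"
proof -
  have "AE x in \<mu>. \<forall>n::nat. c - 1 / real (Suc n) < x"
    unfolding AE_all_countable
  proof (intro allI AE_greater)
    fix n :: nat and t assume "t \<le> c - 1 / real (Suc n)"
    moreover have "0 < 1 / real (Suc n)" by simp
    ultimately have "t < c" by linarith
    then show "F t = 0" by (rule assms)
  qed
  then show ?thesis
  proof eventually_elim
    case (elim x)
    show ?case
    proof (rule ccontr)
      assume "\<not> c \<le> x"
      then obtain n where "1 / real (Suc n) < c - x" using nat_approx_posE[of "c - x"] by auto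
      then show False using elim[rule_format, of n] by linarith
    qed
  qed
qed

text \<open>
  Monotone convergence along the intervals \<open>(c, c + n]\<close>, which exhaust the support of the
  measure.
\<close>

lemma integral_exhaust:
  fixes g :: "real \<Rightarrow> real"
  assumes c: "\<And>t. t \<le> c \<Longrightarrow> F t = 0" and g: "g \<in> borel_measurable borel"
    and nonneg: "\<And>t. c < t \<Longrightarrow> 0 \<le> g t"
    and int: "\<And>n. set_integrable \<mu> {c<..c + real n} g"
    and lim: "(\<lambda>n. LINT x:{c<..c + real n}|\<mu>. g x) \<longlonglongrightarrow> I"
  shows "integrable \<mu> g" "(LINT x|\<mu>. g x) = I"
proof -
  define f where "f n x = indicator {c<..c + real n} x * g x" for n x
  have f: "integrable \<mu> (f n)" for n using int[of n] by (simp add: set_integrable_def f_def[abs_def])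
  have ae: "AE x in \<mu>. c < x" using c by (rule AE_greater)
  have m: "AE x in \<mu>. mono (\<lambda>n. f n x)" using ae
  proof eventually_elim
    case (elim x)
    show ?case
    proof (rule monoI)
      fix n k :: nat assume "n \<le> k"
      then show "f n x \<le> f k x" using nonneg[OF elim] by (auto simp: f_def indicator_def)
    qed
  qed
  have p: "AE x in \<mu>. 0 \<le> f n x" for n using ae
    by eventually_elim (simp add: f_def nonneg)
  have l: "AE x in \<mu>. (\<lambda>n. f n x) \<longlonglongrightarrow> g x" using ae
  proof eventually_elim
    case (elim x)
    obtain N where N: "x - c < real N" using reals_Archimedean2 by blast
    show ?case
    proof (rule tendsto_eventually)
      show "\<forall>\<^sub>F n in sequentially. f n x = g x"
        using eventually_ge_at_top[of N]
      proof eventually_elim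
        case (elim n)
        then have "x \<in> {c<..c + real n}" using \<open>c < x\<close> N by auto
        then show ?case by (simp add: f_def)
      qed
    qed
  qed
  have i: "(\<lambda>n. integral\<^sup>L \<mu> (f n)) \<longlonglongrightarrow> I"
    using lim by (simp add: set_lebesgue_integral_def f_def[abs_def])
  have g': "g \<in> borel_measurable \<mu>" using g by simp
  show "integrable \<mu> g" "(LINT x|\<mu>. g x) = I"
    using integral_monotone_convergence_nonneg[OF f m p l i g'] by blast+
qed

end

context positive_injective_contraction
begin

lemma stieltjes_distribution: "stieltjes (\<lambda>t. inner (P (t + m) x) x)"
proof
  fix s t :: real assume "s \<le> t"
  then show "inner (P (s + m) x) x \<le> inner (P (t + m) x) x" unfolding P_self by (intro P_norm_mono) simp
next
  fix a :: real
  have "filtermap (\<lambda>s. s + m) (at_right a) = at_right (a + m)"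
    using filtermap_at_right_shift[of "- m" a] by simp
  then have "((\<lambda>s. P s x) \<longlongrightarrow> P (a + m) x) (filtermap (\<lambda>s. s + m) (at_right a))"
    using P_tendsto_right[of x "a + m"] by (rule ssubst)
  then have "((\<lambda>s. P (s + m) x) \<longlongrightarrow> P (a + m) x) (at_right a)" by (simp add: filterlim_filtermap)
  then show "continuous (at_right a) (\<lambda>t. inner (P (t + m) x) x)"
    unfolding continuous_within by (intro tendsto_intros)
qed

text \<open>
  \<open>Q s x\<close> is \<open>T\<^sup>-\<^sup>1 (P s x)\<close>, the truncation of the operator \<open>T\<^sup>-\<^sup>1\<close> to the spectral subspace \<open>G s\<close>.
\<close>

definition Q :: "real \<Rightarrow> 'a \<Rightarrow> 'a" where
  "Q s x = (SOME w. w \<in> G s \<and> T w = P s x)"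

lemma Q: "Q s x \<in> G s" "T (Q s x) = P s x"
proof -
  obtain w where "w \<in> G s" "T w = P s x" "norm w \<le> s * norm (P s x)"
    by (rule G_inverse[OF P_mem(1)])
  then have "\<exists>w. w \<in> G s \<and> T w = P s x" by blast
  then have "Q s x \<in> G s \<and> T (Q s x) = P s x" unfolding Q_def by (rule someI_ex)
  then show "Q s x \<in> G s" "T (Q s x) = P s x" by blast+
qed

lemma Q_H: "Q s x \<in> H" using Q(1) G_subset by blast

lemma Q_trivial: "s < 1 \<Longrightarrow> Q s x = 0" using Q(1)[of s x] G_trivial by simp

lemma Q_image: assumes "w \<in> H" shows "Q s (T w) = P s w"
  using inj_eq[OF Q_H P_mem(2), of s "T w" s w] Q(2)[of s "T w"] P_commute[OF assms] by simp

text \<open>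
  The difference \<open>Q t x - Q s x\<close> belongs to the spectral subspace for \<open>(s, t]\<close>, to which
  \<open>interval_bounds\<close> applies. In the limit of fine partitions the estimates become the integral
  formulas for the first and the second moment.
\<close>

lemma Q_increment:
  assumes st: "s \<le> t" and s: "0 < s"
  shows "(norm (Q t x - Q s x))\<^sup>2 = (norm (Q t x))\<^sup>2 - (norm (Q s x))\<^sup>2"
    "s * ((norm (P t x))\<^sup>2 - (norm (P s x))\<^sup>2) \<le> inner (Q t x) x - inner (Q s x) x"
    "inner (Q t x) x - inner (Q s x) x \<le> t * ((norm (P t x))\<^sup>2 - (norm (P s x))\<^sup>2)"
    "s\<^sup>2 * ((norm (P t x))\<^sup>2 - (norm (P s x))\<^sup>2) \<le> (norm (Q t x))\<^sup>2 - (norm (Q s x))\<^sup>2"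
    "(norm (Q t x))\<^sup>2 - (norm (Q s x))\<^sup>2 \<le> t\<^sup>2 * ((norm (P t x))\<^sup>2 - (norm (P s x))\<^sup>2)"
proof -
  define d where "d = Q t x - Q s x"
  have "Q s x \<in> G t" using Q(1) G_mono[OF st] by blast
  then have dG: "d \<in> G t" unfolding d_def using Q(1) G_subspace by (simp add: subspace_diff)
  have Td: "T d = P t x - P s x" by (simp add: d_def diff Q(2))
  have perp: "inner (T d) g = 0" if "g \<in> G s" for g
    unfolding Td by (rule P_increment_perp[OF st that])
  have dperp: "inner d g = 0" if "g \<in> G s" for g
    by (rule interval_bounds(5)[OF dG perp s that])
  have bounds: "s * (norm (T d))\<^sup>2 \<le> inner d (T d)" "inner d (T d) \<le> t * (norm (T d))\<^sup>2"
    "s\<^sup>2 * (norm (T d))\<^sup>2 \<le> (norm d)\<^sup>2" "(norm d)\<^sup>2 \<le> t\<^sup>2 * (norm (T d))\<^sup>2"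
    by (rule interval_bounds(1)[OF dG perp s] interval_bounds(2)[OF dG perp s]
        interval_bounds(3)[OF dG perp s] interval_bounds(4)[OF dG perp s]; assumption)+
  have nT: "(norm (T d))\<^sup>2 = (norm (P t x))\<^sup>2 - (norm (P s x))\<^sup>2"
    unfolding Td by (rule P_increment_norm[OF st])
  have "inner d (Q s x) = 0" by (rule dperp[OF Q(1)])
  then have nd: "(norm d)\<^sup>2 = (norm (Q t x))\<^sup>2 - (norm (Q s x))\<^sup>2"
    unfolding d_def by (simp add: power2_norm_eq_inner inner_diff_left inner_diff_right inner_commute)
  have "inner d (T d) = inner d (P t x) - inner d (P s x)" by (simp add: Td inner_diff_right)
  also have "\<dots> = inner d x" using dperp[OF P_mem(1)] P_inner[OF dG, of x] by (simp add: inner_commute)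
  also have "\<dots> = inner (Q t x) x - inner (Q s x) x" by (simp add: d_def inner_diff_left)
  finally have dT: "inner d (T d) = inner (Q t x) x - inner (Q s x) x" .
  show "(norm (Q t x - Q s x))\<^sup>2 = (norm (Q t x))\<^sup>2 - (norm (Q s x))\<^sup>2" using nd by (simp add: d_def)
  show "s * ((norm (P t x))\<^sup>2 - (norm (P s x))\<^sup>2) \<le> inner (Q t x) x - inner (Q s x) x"
    "inner (Q t x) x - inner (Q s x) x \<le> t * ((norm (P t x))\<^sup>2 - (norm (P s x))\<^sup>2)"
    "s\<^sup>2 * ((norm (P t x))\<^sup>2 - (norm (P s x))\<^sup>2) \<le> (norm (Q t x))\<^sup>2 - (norm (Q s x))\<^sup>2"
    "(norm (Q t x))\<^sup>2 - (norm (Q s x))\<^sup>2 \<le> t\<^sup>2 * ((norm (P t x))\<^sup>2 - (norm (P s x))\<^sup>2)"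
    by (fact bounds[unfolded nT nd dT])+
qed

text \<open>
  The spectral measure \<open>M\<close> of a vector \<open>x\<close> for the operator \<open>T\<^sup>-\<^sup>1 - m\<close>. As \<open>P s = 0\<close> for \<open>s < 1\<close>,
  it is concentrated to the right of \<open>c\<close>; instead of \<open>1/2\<close> any number strictly between \<open>0\<close> and
  \<open>1\<close> would do, so that \<open>t + m\<close> stays positive on the support.
\<close>

context
  fixes m :: real and x :: 'a and c :: real and M :: "real measure"
  defines "c \<equiv> 1/2 - m"
  defines "M \<equiv> interval_measure (\<lambda>t. inner (P (t + m) x) x)"
  assumes x: "x \<in> H"
begin

lemma distribution_zero: "t \<le> c \<Longrightarrow> inner (P (t + m) x) x = 0"
  by (simp add: c_def P_trivial)

lemma first_moment:
  assumes t: "c \<le> t"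
  shows "set_integrable M {c<..t} (\<lambda>\<tau>. \<tau> + m)" "(LINT \<tau>:{c<..t}|M. \<tau> + m) = inner (Q (t + m) x) x"
proof -
  interpret S: stieltjes "\<lambda>t. inner (P (t + m) x) x" by (rule stieltjes_distribution)
  have *: "set_integrable M {c<..t} (\<lambda>\<tau>. \<tau> + m) \<and>
    (LINT \<tau>:{c<..t}|M. \<tau> + m) = inner (Q (t + m) x) x - inner (Q (c + m) x) x"
    unfolding M_def
  proof (rule S.integral_eq[where C = 1 and G = "\<lambda>t. inner (Q (t + m) x) x"])
    fix s r assume sr: "c \<le> s" "s \<le> r" "r \<le> t"
    then have pos: "0 < s + m" and le: "s + m \<le> r + m" by (simp_all add: c_def)
    show "(s + m) * (inner (P (r + m) x) x - inner (P (s + m) x) x) \<le> inner (Q (r + m) x) x - inner (Q (s + m) x) x"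
      unfolding P_self by (rule Q_increment(2)[OF le pos])
    show "inner (Q (r + m) x) x - inner (Q (s + m) x) x \<le> (r + m) * (inner (P (r + m) x) x - inner (P (s + m) x) x)"
      unfolding P_self by (rule Q_increment(3)[OF le pos])
  qed (use t in simp_all)
  then show "set_integrable M {c<..t} (\<lambda>\<tau>. \<tau> + m)" by blast
  show "(LINT \<tau>:{c<..t}|M. \<tau> + m) = inner (Q (t + m) x) x"
    using * Q_trivial[of "c + m" x] by (simp add: c_def)
qed

lemma second_moment:
  assumes t: "c \<le> t"
  shows "set_integrable M {c<..t} (\<lambda>\<tau>. (\<tau> + m)\<^sup>2)" "(LINT \<tau>:{c<..t}|M. (\<tau> + m)\<^sup>2) = (norm (Q (t + m) x))\<^sup>2"
proof -
  interpret S: stieltjes "\<lambda>t. inner (P (t + m) x) x" by (rule stieltjes_distribution)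
  have *: "set_integrable M {c<..t} (\<lambda>\<tau>. (\<tau> + m)\<^sup>2) \<and>
    (LINT \<tau>:{c<..t}|M. (\<tau> + m)\<^sup>2) = (norm (Q (t + m) x))\<^sup>2 - (norm (Q (c + m) x))\<^sup>2"
    unfolding M_def
  proof (rule S.integral_eq[where C = "2 * (t + m)" and G = "\<lambda>t. (norm (Q (t + m) x))\<^sup>2"])
    fix s r assume sr: "c \<le> s" "s \<le> r" "r \<le> t"
    then have pos: "0 < s + m" and le: "s + m \<le> r + m" by (simp_all add: c_def)
    show "(s + m)\<^sup>2 \<le> (r + m)\<^sup>2" using pos le by (intro power_mono) simp_all
    have "(r + m)\<^sup>2 - (s + m)\<^sup>2 = ((r + m) + (s + m)) * (r - s)"
      by (simp add: power2_eq_square algebra_simps)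
    also have "\<dots> \<le> (2 * (t + m)) * (r - s)" using sr by (intro mult_right_mono) simp_all
    finally show "(r + m)\<^sup>2 - (s + m)\<^sup>2 \<le> 2 * (t + m) * (r - s)" .
    show "(s + m)\<^sup>2 * (inner (P (r + m) x) x - inner (P (s + m) x) x) \<le> (norm (Q (r + m) x))\<^sup>2 - (norm (Q (s + m) x))\<^sup>2"
      unfolding P_self by (rule Q_increment(4)[OF le pos])
    show "(norm (Q (r + m) x))\<^sup>2 - (norm (Q (s + m) x))\<^sup>2 \<le> (r + m)\<^sup>2 * (inner (P (r + m) x) x - inner (P (s + m) x) x)"
      unfolding P_self by (rule Q_increment(5)[OF le pos])
  qed (use t in simp_all)
  then show "set_integrable M {c<..t} (\<lambda>\<tau>. (\<tau> + m)\<^sup>2)" by blast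
  show "(LINT \<tau>:{c<..t}|M. (\<tau> + m)\<^sup>2) = (norm (Q (t + m) x))\<^sup>2"
    using * Q_trivial[of "c + m" x] by (simp add: c_def)
qed

lemma P_exhaust: "y \<in> H \<Longrightarrow> (\<lambda>n. P (c + real n + m) y) \<longlonglongrightarrow> y"
proof -
  assume "y \<in> H"
  moreover have "filterlim (\<lambda>n. c + real n + m) at_top sequentially"
  proof -
    have "filterlim (\<lambda>n. (c + m) + real n) at_top sequentially"
      by (rule filterlim_tendsto_add_at_top[OF tendsto_const filterlim_real_sequentially])
    then show ?thesis by (simp add: ac_simps)
  qed
  ultimately show ?thesis by (rule filterlim_compose[OF P_tendsto_top])
qed

lemma total_mass: "finite_measure M" "measure M UNIV = (norm x)\<^sup>2"
proof -
  interpret S: stieltjes "\<lambda>t. inner (P (t + m) x) x" by (rule stieltjes_distribution)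
  show fin: "finite_measure M" unfolding M_def
    by (rule S.finite_measure[of "(norm x)\<^sup>2"]) (simp_all add: P_self P_norm_le power_mono)
  interpret M: finite_measure M by (rule fin)
  have mi: "measure M {c<..c + real n} = (norm (P (c + real n + m) x))\<^sup>2" for n
  proof -
    have "measure M {c<..c + real n} = inner (P (c + real n + m) x) x - inner (P (c + m) x) x"
      unfolding M_def by (rule S.measure_Ioc) simp
    then show ?thesis using distribution_zero[of c] P_self[of "c + real n + m" x] by simp
  qed
  have sM: "sets M = sets borel" "space M = UNIV" by (simp_all add: M_def)
  have ms: "(LINT \<tau>:{c<..c + real n}|M. 1) = (norm (P (c + real n + m) x))\<^sup>2" for n
    unfolding mi[symmetric] by (subst set_integral_const) (simp_all add: sM M.emeasure_finite)
  have mint: "set_integrable M {c<..c + real n} (\<lambda>\<tau>. 1::real)" for n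
    unfolding set_integrable_def by (simp add: sM M.emeasure_finite less_top[symmetric])
  have "(\<lambda>n. LINT \<tau>:{c<..c + real n}|M. 1) \<longlonglongrightarrow> (norm x)\<^sup>2"
    unfolding ms by (intro tendsto_intros P_exhaust x)
  note lim = this
  have "(LINT \<tau>|M. 1) = (norm x)\<^sup>2"
    using S.integral_exhaust(2)[OF distribution_zero _ _ mint[unfolded M_def] lim[unfolded M_def]]
    by (simp add: M_def)
  then show "measure M UNIV = (norm x)\<^sup>2" by (simp add: sM)
qed

text \<open>
  For \<open>x = T w\<close> the truncations \<open>Q s x\<close> are \<open>P s w\<close>, which converge to \<open>w\<close>.
\<close>

lemma moments_of_image:
  assumes w: "w \<in> H" "x = T w"
  shows "integrable M (\<lambda>\<tau>. (\<tau> + m)\<^sup>2)" "integrable M (\<lambda>\<tau>. \<tau> + m)" "(LINT \<tau>|M. \<tau> + m) = inner w x"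
proof -
  interpret S: stieltjes "\<lambda>t. inner (P (t + m) x) x" by (rule stieltjes_distribution)
  have Qw: "Q s x = P s w" for s using Q_image[OF w(1)] w(2) by simp
  have lim1: "(\<lambda>n. LINT \<tau>:{c<..c + real n}|M. \<tau> + m) \<longlonglongrightarrow> inner w x"
    unfolding first_moment(2)[of "c + real _", simplified] Qw
    by (intro tendsto_intros P_exhaust w)
  have lim2: "(\<lambda>n. LINT \<tau>:{c<..c + real n}|M. (\<tau> + m)\<^sup>2) \<longlonglongrightarrow> (norm w)\<^sup>2"
    unfolding second_moment(2)[of "c + real _", simplified] Qw
    by (intro tendsto_intros P_exhaust w)
  show "integrable M (\<lambda>\<tau>. (\<tau> + m)\<^sup>2)"
    using second_moment(1)[of "c + real _"] lim2 distribution_zero unfolding M_def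
    by (intro S.integral_exhaust(1)[where c = c]) simp_all
  show "integrable M (\<lambda>\<tau>. \<tau> + m)" "(LINT \<tau>|M. \<tau> + m) = inner w x"
    using first_moment(1)[of "c + real _"] lim1 distribution_zero unfolding M_def
    by (intro S.integral_exhaust[where c = c]; simp add: c_def)+
qed

text \<open>
  A finite second moment bounds the truncations \<open>Q s x\<close>; these have orthogonal increments, hence
  converge, and the limit is a preimage of \<open>x\<close> under \<open>T\<close>.
\<close>

lemma image_of_moment:
  assumes int: "integrable M (\<lambda>\<tau>. (\<tau> + m)\<^sup>2)"
  shows "x \<in> T ` H"
proof -
  define a where "a n = (norm (Q (c + real n + m) x))\<^sup>2" for n
  have pos: "0 < c + real n + m" for n by (simp add: c_def)
  have inc: "(norm (Q (c + real k + m) x - Q (c + real n + m) x))\<^sup>2 = a k - a n" if "n \<le> k" for n k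
    unfolding a_def using that pos by (intro Q_increment(1)) simp_all
  have "incseq a" unfolding incseq_def
    using inc zero_le_power2 by (metis diff_ge_0_iff_ge)
  moreover have "a n \<le> (LINT \<tau>|M. (\<tau> + m)\<^sup>2)" for n
  proof -
    have "a n = (LINT \<tau>:{c<..c + real n}|M. (\<tau> + m)\<^sup>2)"
      unfolding a_def by (rule second_moment(2)[symmetric]) simp
    also have "\<dots> \<le> (LINT \<tau>|M. (\<tau> + m)\<^sup>2)"
      unfolding set_lebesgue_integral_def
      using second_moment(1)[of "c + real n"] int
      by (intro integral_mono) (auto simp: set_integrable_def indicator_def)
    finally show ?thesis .
  qed
  ultimately have "convergent a" using incseq_convergent[of a] by (metis convergentI)
  then have "Cauchy (\<lambda>n. Q (c + real n + m) x)"
    by (rule Cauchy_of_norm_increments[rotated]) (simp add: inc)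
  then obtain w where w: "w \<in> H" "(\<lambda>n. Q (c + real n + m) x) \<longlonglongrightarrow> w"
    using H.complete Q_H unfolding complete_def by meson
  have "(\<lambda>n. P (c + real n + m) x) \<longlonglongrightarrow> T w"
    using pow_tendsto[OF Q_H w, of 1] by (simp add: Q(2))
  then have "x = T w" using P_exhaust[OF x] LIMSEQ_unique by blast
  then show ?thesis using w(1) by blast
qed

end

end

definition op_shift :: "real \<Rightarrow> ('a::real_vector \<times> 'a) set \<Rightarrow> ('a \<times> 'a) set" where
  "op_shift m A = {(x, z + m *\<^sub>R x) |x z. (x, z) \<in> A}"

lemma op_shift_iff: "(x, z) \<in> op_shift m A \<longleftrightarrow> (x, z - m *\<^sub>R x) \<in> A"
  unfolding op_shift_def by (auto intro: exI[of _ "z - m *\<^sub>R x"])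

lemma linear_operator_shift:
  assumes "linear_operator H A" "subspace H" shows "linear_operator H (op_shift m A)"
  unfolding linear_operator_def
proof (intro conjI)
  note A = assms(1)[unfolded linear_operator_def]
  show "op_shift m A \<subseteq> H \<times> H"
    using A assms(2) unfolding op_shift_def by (auto simp: subspace_add subspace_scale)
  have sub: "subspace A" using A by blast
  show "subspace (op_shift m A)"
  proof (rule subspaceI)
    show "0 \<in> op_shift m A" using subspace_0[OF sub] by (simp add: zero_prod_def op_shift_iff)
  next
    fix x y assume "x \<in> op_shift m A" "y \<in> op_shift m A"
    then have "(fst x, snd x - m *\<^sub>R fst x) + (fst y, snd y - m *\<^sub>R fst y) \<in> A"
      using sub by (intro subspace_add) (simp_all add: op_shift_iff[symmetric])
    then have "(fst x + fst y, snd x + snd y) \<in> op_shift m A"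
      unfolding op_shift_iff by (simp add: algebra_simps)
    then show "x + y \<in> op_shift m A" by (simp add: plus_prod_def)
  next
    fix c x assume "x \<in> op_shift m A"
    then have "c *\<^sub>R (fst x, snd x - m *\<^sub>R fst x) \<in> A"
      using sub by (intro subspace_scale) (simp_all add: op_shift_iff[symmetric])
    then have "(c *\<^sub>R fst x, c *\<^sub>R snd x) \<in> op_shift m A"
      unfolding op_shift_iff by (simp add: algebra_simps)
    then show "c *\<^sub>R x \<in> op_shift m A" by (simp add: scaleR_prod_def)
  qed
  show "single_valued (op_shift m A)"
  proof (rule single_valuedI)
    fix x y z assume "(x, y) \<in> op_shift m A" "(x, z) \<in> op_shift m A"
    then have "y - m *\<^sub>R x = z - m *\<^sub>R x"
      using A unfolding op_shift_iff by (blast dest: single_valuedD)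
    then show "y = z" by simp
  qed
qed

lemma Domain_op_shift: "Domain (op_shift m A) = Domain A"
  unfolding op_shift_def by blast

lemma op_adjoint_shift:
  assumes "subspace H" shows "op_adjoint H (op_shift m A) = op_shift m (op_adjoint H A)"
proof -
  have "(y, w) \<in> op_adjoint H (op_shift m A) \<longleftrightarrow> (y, w - m *\<^sub>R y) \<in> op_adjoint H A" for y w
  proof -
    have "w - m *\<^sub>R y \<in> H \<longleftrightarrow> w \<in> H" if "y \<in> H"
      using assms that subspace_add[OF assms, of "w - m *\<^sub>R y" "m *\<^sub>R y"]
      by (auto simp: subspace_diff subspace_scale)
    moreover have "(\<forall>p\<in>op_shift m A. inner (snd p) y = inner (fst p) w)
        \<longleftrightarrow> (\<forall>p\<in>A. inner (snd p) y = inner (fst p) (w - m *\<^sub>R y))"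
      unfolding op_shift_def by (force simp: inner_add_left inner_diff_right)
    ultimately show ?thesis unfolding op_adjoint_def by (auto simp: case_prod_unfold)
  qed
  then show ?thesis by (auto simp: op_shift_iff)
qed

lemma selfadjoint_shift:
  assumes "selfadjoint_operator H A" "subspace H" shows "selfadjoint_operator H (op_shift m A)"
  using assms linear_operator_shift[of H A m] op_adjoint_shift[OF assms(2), of m A]
  unfolding selfadjoint_operator_def by (simp add: Domain_op_shift)

text \<open>
  With \<open>m = 1 - c\<close> the operator \<open>A + m\<close> is at least \<open>1\<close>, so it has an inverse \<open>T\<close> as above. The
  spectral family of \<open>T\<^sup>-\<^sup>1\<close>, shifted by \<open>m\<close>, resolves \<open>A\<close>: its domain is the range of \<open>T\<close>, which
  is described by the second moment, and its form is given by the first moment.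
\<close>

theorem spectral_resolution_exists:
  fixes A :: "('a::real_inner \<times> 'a) set"
  assumes H: "complete_subspace H" and A: "selfadjoint_operator H A"
    and bounded: "\<And>x z. (x, z) \<in> A \<Longrightarrow> c * (norm x)\<^sup>2 \<le> inner z x"
  shows "\<exists>E. spectral_resolution H A E"
proof -
  interpret H: complete_subspace H by (rule H)
  define m where "m = 1 - c"
  define B where "B = op_shift m A"
  have B: "selfadjoint_operator H B" unfolding B_def by (rule selfadjoint_shift[OF A H.subspace])
  have coercive: "(norm x)\<^sup>2 \<le> inner z x" if "(x, z) \<in> B" for x z
    using bounded[of x "z - m *\<^sub>R x"] that unfolding B_def op_shift_iff
    by (simp add: inner_diff_left m_def power2_norm_eq_inner algebra_simps)
  have subB: "subspace B" "B \<subseteq> H \<times> H" and sv: "single_valued B" and adjB: "op_adjoint H B = B"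
    using B by (simp_all add: selfadjoint_operator_def linear_operator_def)
  have "\<forall>w\<in>H. \<exists>x. (x, w) \<in> B" using coercive_selfadjoint_surjective[OF H B coercive] by blast
  then obtain T0 where T0: "\<And>w. w \<in> H \<Longrightarrow> (T0 w, w) \<in> B" by metis
  have unique: "x = y" if "(x, w) \<in> B" "(y, w) \<in> B" for x y w
  proof -
    have "(x - y, 0) \<in> B" using subspace_diff[OF subB(1) that] by simp
    then have "(norm (x - y))\<^sup>2 \<le> inner 0 (x - y)" by (rule coercive)
    then show ?thesis by simp
  qed
  obtain T where linT: "linear T" and TT0: "\<forall>w\<in>H. T w = T0 w"
  proof (rule linear_extension[OF H.subspace, of T0])
    fix x y assume xy: "x \<in> H" "y \<in> H"
    have "(T0 x + T0 y, x + y) \<in> B" using subspace_add[OF subB(1) T0[OF xy(1)] T0[OF xy(2)]] by simp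
    then show "T0 (x + y) = T0 x + T0 y"
      using unique[OF T0] subspace_add[OF H.subspace xy] by blast
  next
    fix k x assume x: "x \<in> H"
    have "(k *\<^sub>R T0 x, k *\<^sub>R x) \<in> B" using subspace_scale[OF subB(1) T0[OF x]] by simp
    then show "T0 (k *\<^sub>R x) = k *\<^sub>R T0 x"
      using unique[OF T0] subspace_scale[OF H.subspace x] by blast
  qed
  have TB: "(T w, w) \<in> B" if "w \<in> H" for w using T0 TT0 that by simp
  have Biff: "(x, w) \<in> B \<longleftrightarrow> w \<in> H \<and> x = T w" for x w using TB unique subB(2) by blast
  interpret T: positive_injective_contraction H T
  proof (intro positive_injective_contraction.intro positive_injective_contraction_axioms.intro H)
    show "linear T" by (rule linT)
    show "T x \<in> H" if "x \<in> H" for x using TB[OF that] subB(2) by blast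
    show "inner (T x) y = inner x (T y)" if "x \<in> H" "y \<in> H" for x y
    proof -
      have "(T x, x) \<in> op_adjoint H B" using TB[OF that(1)] adjB by simp
      then have "inner y (T x) = inner (T y) x"
        using TB[OF that(2)] unfolding op_adjoint_def by blast
      then show ?thesis by (simp add: inner_commute)
    qed
    show "(norm (T x))\<^sup>2 \<le> inner (T x) x" if "x \<in> H" for x
      using coercive[OF TB[OF that]] by (simp add: inner_commute)
    show "x = 0" if "x \<in> H" "T x = 0" for x
    proof -
      have "(0, x) \<in> B" using TB[OF that(1)] that(2) by simp
      moreover have "(0, 0) \<in> B" using subspace_0[OF subB(1)] by (simp add: zero_prod_def)
      ultimately show ?thesis using sv by (blast dest: single_valuedD)
    qed
  qed
  define E where "E = (\<lambda>t. T.P (t + m))"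
  have dist: "spectral_distribution E x = interval_measure (\<lambda>t. inner (T.P (t + m) x) x)" for x
    by (simp add: spectral_distribution_def E_def)
  have Aiff: "(x, z) \<in> A \<longleftrightarrow> z + m *\<^sub>R x \<in> H \<and> x = T (z + m *\<^sub>R x)" for x z
    using Biff[of x "z + m *\<^sub>R x"] by (simp add: B_def op_shift_iff)
  have dom: "Domain A = T ` H"
  proof -
    have "Domain B = T ` H" using Biff by (auto simp: Domain_iff image_iff)
    then show ?thesis by (simp add: B_def Domain_op_shift)
  qed
  have sq: "integrable (spectral_distribution E x) (\<lambda>t. t\<^sup>2)
      \<longleftrightarrow> integrable (spectral_distribution E x) (\<lambda>t. (t + m)\<^sup>2)" if x: "x \<in> H" for x
  proof -
    interpret M: finite_measure "spectral_distribution E x"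
      unfolding dist by (rule T.total_mass(1)[OF x])
    have meas: "f \<in> borel_measurable (spectral_distribution E x)" if "f \<in> borel_measurable borel" for f :: "real \<Rightarrow> real"
      using that by (simp add: spectral_distribution_def)
    have ineq: "(r + k)\<^sup>2 \<le> 2 * r\<^sup>2 + 2 * k\<^sup>2" for r k :: real
      using sum_squares_bound[of r k] by (simp add: power2_sum)
    have shift: "integrable (spectral_distribution E x) (\<lambda>t. (t + k)\<^sup>2)"
      if "integrable (spectral_distribution E x) (\<lambda>t. (t + l)\<^sup>2)" for k l :: real
    proof (rule Bochner_Integration.integrable_bound)
      show "integrable (spectral_distribution E x) (\<lambda>t. 2 * (t + l)\<^sup>2 + 2 * (k - l)\<^sup>2)"
        using that by simp
      show "AE t in spectral_distribution E x. norm ((t + k)\<^sup>2) \<le> norm (2 * (t + l)\<^sup>2 + 2 * (k - l)\<^sup>2)"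
      proof (rule AE_I2)
        fix t show "norm ((t + k)\<^sup>2) \<le> norm (2 * (t + l)\<^sup>2 + 2 * (k - l)\<^sup>2)"
          using ineq[of "t + l" "k - l"] by simp
      qed
    qed (intro meas, simp)
    show ?thesis using shift[of 0 m] shift[of m 0] by auto
  qed
  have "Domain A = {x\<in>H. integrable (spectral_distribution E x) (\<lambda>t. t\<^sup>2)}"
  proof (intro set_eqI iffI)
    fix x assume "x \<in> Domain A"
    then obtain w where w: "w \<in> H" "x = T w" using dom by blast
    then have x: "x \<in> H" using T.mem by simp
    show "x \<in> {x\<in>H. integrable (spectral_distribution E x) (\<lambda>t. t\<^sup>2)}"
      using x sq[OF x] T.moments_of_image(1)[OF x w] by (simp add: dist)
  next
    fix x assume "x \<in> {x\<in>H. integrable (spectral_distribution E x) (\<lambda>t. t\<^sup>2)}"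
    then have x: "x \<in> H" and "integrable (spectral_distribution E x) (\<lambda>t. (t + m)\<^sup>2)" using sq by blast+
    then show "x \<in> Domain A" unfolding dom dist by (intro T.image_of_moment)
  qed
  moreover have "inner z x = (LINT t|spectral_distribution E x. t)" if xz: "(x, z) \<in> A" for x z
  proof -
    have w: "z + m *\<^sub>R x \<in> H" "x = T (z + m *\<^sub>R x)" using xz Aiff by blast+
    then have x: "x \<in> H" using T.mem by metis
    interpret M: finite_measure "spectral_distribution E x"
      unfolding dist by (rule T.total_mass(1)[OF x])
    have int: "integrable (spectral_distribution E x) (\<lambda>t. t + m)"
      unfolding dist by (rule T.moments_of_image(2)[OF x w])
    have "(LINT t|spectral_distribution E x. (t + m) - m) = inner (z + m *\<^sub>R x) x - m * (norm x)\<^sup>2"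
      using int T.moments_of_image(3)[OF x w] T.total_mass(2)[OF x, of m] M.integrable_const[of m]
      by (subst Bochner_Integration.integral_diff) (simp_all add: dist)
    then show ?thesis by (simp add: inner_add_left power2_norm_eq_inner)
  qed
  ultimately have "spectral_resolution H A E"
    unfolding spectral_resolution_def using A T.spectral_family_P[of m] by (auto simp: E_def)
  then show ?thesis by blast
qed

section \<open>The Morse index as the negative index of the quadratic form\<close>

lemma subspace_closure:
  fixes U :: "'a::real_normed_vector set"
  assumes "subspace U" shows "subspace (closure U)"
proof (rule subspaceI)
  show "0 \<in> closure U" using subspace_0[OF assms] closure_subset by blast
next
  fix x y assume "x \<in> closure U" "y \<in> closure U"
  then obtain u v where uv: "\<And>n. u n \<in> U" "u \<longlonglongrightarrow> x" "\<And>n. v n \<in> U" "v \<longlonglongrightarrow> y"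
    unfolding closure_sequential by metis
  have "(\<lambda>n. u n + v n) \<longlonglongrightarrow> x + y" by (intro tendsto_intros uv)
  moreover have "u n + v n \<in> U" for n using uv assms by (simp add: subspace_add)
  ultimately show "x + y \<in> closure U" unfolding closure_sequential by (intro exI[of _ "\<lambda>n. u n + v n"]) simp
next
  fix c x assume "x \<in> closure U"
  then obtain u where u: "\<And>n. u n \<in> U" "u \<longlonglongrightarrow> x" unfolding closure_sequential by metis
  have "(\<lambda>n. c *\<^sub>R u n) \<longlonglongrightarrow> c *\<^sub>R x" by (intro tendsto_intros u)
  moreover have "c *\<^sub>R u n \<in> U" for n using u assms by (simp add: subspace_scale)
  ultimately show "c *\<^sub>R x \<in> closure U" unfolding closure_sequential by (intro exI[of _ "\<lambda>n. c *\<^sub>R u n"]) simp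
qed

lemma subspace_eqI_dim:
  assumes "subspace V" "fin_dim V" "subspace U" "U \<subseteq> V" "dim V \<le> dim U" shows "U = V"
proof (rule ccontr)
  assume "U \<noteq> V"
  then obtain v where v: "v \<in> V" "v \<notin> U" using assms(4) by blast
  have fU: "fin_dim U" using fin_dim_subset[OF assms(2,4)] .
  have "U \<inter> span {v} = {0}"
  proof -
    have "k *\<^sub>R v \<in> U \<Longrightarrow> k = 0" for k
      using v(2) subspace_scale[OF assms(3), of "k *\<^sub>R v" "inverse k"] by (cases "k = 0") simp_all
    then show ?thesis using subspace_0[OF assms(3)] by (auto simp: span_singleton)
  qed
  then have "dim (U + span {v}) = dim U + dim (span {v})"
    using assms(3) fU by (intro dim_direct_sum) (simp_all add: fin_dim_span)
  moreover have "v \<noteq> 0" using v(2) subspace_0[OF assms(3)] by blast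
  then have "dim (span {v}) = 1" using real_vector.dim_span_eq_card_independent[of "{v}"] by simp
  moreover have "dim (U + span {v}) \<le> dim V"
  proof (rule dim_mono_fin[OF assms(2,1)])
    show "subspace (U + span {v})" using assms(3) by (simp add: subspace_set_plus)
    show "U + span {v} \<subseteq> V"
      using assms(1,4) v(1) by (auto simp: set_plus_def span_singleton subset_iff intro!: subspace_add subspace_scale)
  qed
  ultimately show False using assms(5) by linarith
qed

locale resolution = H: complete_subspace H for H :: "'a::real_inner set" +
  fixes A :: "('a \<times> 'a) set" and E :: "real \<Rightarrow> 'a \<Rightarrow> 'a"
  assumes resolution: "spectral_resolution H A E"
begin

definition R :: "real \<Rightarrow> 'a set" where "R t = E t ` H"

lemma R: "complete_subspace (R t)" "R t \<subseteq> H" "x \<in> H \<Longrightarrow> E t x = proj (R t) x"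
proof -
  obtain S where S: "subspace S" "closed S" "S \<subseteq> H"
      "\<And>x. x \<in> H \<Longrightarrow> E t x \<in> S \<and> (\<forall>y\<in>S. inner (x - E t x) y = 0)"
    using resolution unfolding spectral_resolution_def spectral_family_def orthogonal_projection_in_def
    by metis
  have cS: "complete_subspace S" by (rule complete_subspace_closed[OF H.complete_subspace_axioms S(2,1,3)])
  interpret S: complete_subspace S by (rule cS)
  have E: "E t x = proj S x" if "x \<in> H" for x
    using S.proj_eqI[of "E t x" x] S(4)[OF that] by simp
  have "R t = S"
  proof
    show "R t \<subseteq> S" unfolding R_def using S(4) by blast
    show "S \<subseteq> R t"
    proof
      fix x assume "x \<in> S"
      then have "x \<in> H" "E t x = x" using S(3) E S.proj_id by auto
      then show "x \<in> R t" unfolding R_def by (metis imageI)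
    qed
  qed
  then show "complete_subspace (R t)" "R t \<subseteq> H" "x \<in> H \<Longrightarrow> E t x = proj (R t) x"
    using cS S(3) E by simp_all
qed

lemma R_mono: "s \<le> t \<Longrightarrow> R s \<subseteq> R t"
  using resolution unfolding spectral_resolution_def spectral_family_def R_def by blast

lemma R_subspace: "subspace (R t)" using R(1) complete_subspace.subspace by blast

lemma distribution_function: "x \<in> H \<Longrightarrow> inner (E t x) x = (norm (proj (R t) x))\<^sup>2"
  using R(3) complete_subspace.proj_inner[OF R(1)] by simp

lemma E_tendsto:
  "x \<in> H \<Longrightarrow> ((\<lambda>s. E s x) \<longlongrightarrow> E t x) (at_right t)" "x \<in> H \<Longrightarrow> ((\<lambda>s. E s x) \<longlongrightarrow> 0) at_bot"
  using resolution unfolding spectral_resolution_def spectral_family_def by blast+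

lemma proj_R_norm_mono:
  assumes "s \<le> t" shows "norm (proj (R s) x) \<le> norm (proj (R t) x)"
proof -
  interpret s: complete_subspace "R s" by (rule R(1))
  interpret t: complete_subspace "R t" by (rule R(1))
  have "proj (R s) x = proj (R s) (proj (R t) x)"
  proof (rule s.proj_eqI[OF s.proj(1)])
    fix y assume y: "y \<in> R s"
    then have "y \<in> R t" using R_mono[OF assms] by blast
    then show "inner (x - proj (R s) (proj (R t) x)) y = 0"
      using s.proj_inner'[OF y] t.proj_inner' by (simp add: inner_diff_left)
  qed
  then show ?thesis using s.norm_proj_le[of "proj (R t) x"] by simp
qed

lemma stieltjes: assumes x: "x \<in> H" shows "stieltjes (\<lambda>t. inner (E t x) x)"
proof
  show "inner (E s x) x \<le> inner (E t x) x" if "s \<le> t" for s t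
    unfolding distribution_function[OF x] using proj_R_norm_mono[OF that] by (simp add: power_mono)
  show "continuous (at_right t) (\<lambda>t. inner (E t x) x)" for t
    unfolding continuous_within by (intro tendsto_intros E_tendsto(1) x)
qed

lemma finite_distribution: assumes x: "x \<in> H" shows "finite_measure (spectral_distribution E x)"
  unfolding spectral_distribution_def
  by (rule stieltjes.finite_measure[OF stieltjes[OF x], of "(norm x)\<^sup>2"])
    (simp_all add: distribution_function[OF x] complete_subspace.norm_proj_le[OF R(1)] power_mono)

lemma A_D: assumes "(x, z) \<in> A"
  shows "x \<in> H" "inner z x = (LINT t|spectral_distribution E x. t)"
proof -
  have dom: "Domain A = {x\<in>H. integrable (spectral_distribution E x) (\<lambda>t. t\<^sup>2)}"
    and form: "\<forall>(x, z)\<in>A. inner z x = (LINT t|spectral_distribution E x. t)"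
    using resolution[unfolded spectral_resolution_def, THEN conjunct2, THEN conjunct2]
    by (rule conjunct1, rule conjunct2)
  have "x \<in> Domain A" using assms by (rule DomainI)
  then show "x \<in> H" unfolding dom by simp
  show "inner z x = (LINT t|spectral_distribution E x. t)" using bspec[OF form assms] by simp
qed

text \<open>
  The closure of \<open>U\<close> is the negative spectral subspace. The union is directed, so finitely many
  of its vectors lie in a common \<open>R t\<close> with \<open>t < 0\<close>.
\<close>

definition U :: "'a set" where "U = (\<Union>t\<in>{..<0}. R t)"

lemma U_directed:
  assumes "finite B" "B \<subseteq> U" obtains t where "t < 0" "B \<subseteq> R t"
proof -
  have "\<exists>t<0. B \<subseteq> R t"
    using assms
  proof (induction B)
    case empty show ?case by (intro exI[of _ "-1"]) simp
  next
    case (insert b B)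
    then obtain t where t: "t < 0" "B \<subseteq> R t" by auto
    obtain s where s: "s < 0" "b \<in> R s" using insert.prems by (auto simp: U_def)
    have "insert b B \<subseteq> R (max s t)"
      using s t R_mono[of s "max s t"] R_mono[of t "max s t"] by auto
    then show ?case using s t by (intro exI[of _ "max s t"]) simp
  qed
  then show ?thesis using that by blast
qed

lemma U_subspace: "subspace U"
proof (rule subspaceI)
  show "0 \<in> U" unfolding U_def using subspace_0[OF R_subspace] by (intro UN_I[of "-1"]) simp_all
next
  fix x y assume "x \<in> U" "y \<in> U"
  then obtain t where t: "t < 0" "{x, y} \<subseteq> R t" using U_directed[of "{x, y}"] by auto
  then have "x + y \<in> R t" using subspace_add[OF R_subspace] by simp
  then show "x + y \<in> U" using t unfolding U_def by blast
next
  fix c x assume "x \<in> U"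
  then show "c *\<^sub>R x \<in> U" unfolding U_def using subspace_scale[OF R_subspace] by blast
qed

lemma U_H: "U \<subseteq> H" unfolding U_def using R(2) by blast

text \<open>
  The spectral measure of \<open>x\<close> is concentrated on \<open>[0, \<infinity>)\<close>.
\<close>

lemma form_nonneg_of_perp:
  assumes xz: "(x, z) \<in> A" and perp: "\<And>y. y \<in> U \<Longrightarrow> inner x y = 0"
  shows "0 \<le> inner z x"
proof -
  have x: "x \<in> H" using A_D(1)[OF xz] .
  interpret S: stieltjes "\<lambda>t. inner (E t x) x" by (rule stieltjes[OF x])
  have "inner (E t x) x = 0" if "t < 0" for t
  proof -
    have "proj (R t) x = 0"
      using perp that by (intro complete_subspace.proj_eq_0[OF R(1)]) (auto simp: U_def)
    then show ?thesis by (simp add: distribution_function[OF x])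
  qed
  then have "AE t in S.\<mu>. 0 \<le> t" by (rule S.AE_at_least)
  then show ?thesis unfolding A_D(2)[OF xz] spectral_distribution_def by (rule integral_nonneg_AE)
qed

text \<open>
  The space \<open>V\<close> is contained in some \<open>R t\<close> with \<open>t < 0\<close>, but need not be contained in the
  domain. The spaces \<open>V \<inter> R s\<close> decrease to \<open>0\<close> as \<open>s \<rightarrow> -\<infinity>\<close>, so one of them is \<open>0\<close>. Subtracting
  the projection to this \<open>R s\<close> is injective on \<open>V\<close> and yields vectors with spectral measure on
  \<open>(s, t]\<close>, which belong to the domain and have negative form.
\<close>

lemma negative_subspace_in_domain:
  assumes V: "subspace V" "fin_dim V" "V \<subseteq> U"
  obtains V' where "subspace V'" "fin_dim V'" "dim V' = dim V" "V' \<subseteq> Domain A"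
    "\<forall>y\<in>V'. \<forall>z. y \<noteq> 0 \<longrightarrow> (y, z) \<in> A \<longrightarrow> inner z y < 0"
proof -
  obtain B where B: "finite B" "independent B" "span B = V" "card B = dim V"
    by (rule fin_dim_basis[OF V(1,2)])
  have BU: "B \<subseteq> U" using V(3) B(3) span_superset[of B] by blast
  obtain t where t: "t < 0" "B \<subseteq> R t" by (rule U_directed[OF B(1) BU])
  have VR: "V \<subseteq> R t" using B(3) t(2) span_minimal[OF _ R_subspace] by blast
  have VH: "V \<subseteq> H" using V(3) U_H by blast
  have sub: "subspace (V \<inter> R s)" for s using V(1) R_subspace by (simp add: subspace_inter)
  have "\<exists>s. V \<inter> R s = {0}"
  proof -
    obtain s where s: "\<And>s'. dim (V \<inter> R s) \<le> dim (V \<inter> R s')"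
      using ex_has_least_nat[of "\<lambda>_. True" 0 "\<lambda>s. dim (V \<inter> R s)"] by blast
    have "x = 0" if x: "x \<in> V" "x \<in> R s" for x
    proof -
      have "x \<in> R s'" if "s' \<le> s" for s'
      proof -
        have "V \<inter> R s' = V \<inter> R s"
          using R_mono[OF that] s[of s'] fin_dim_subset[OF V(2)]
          by (intro subspace_eqI_dim sub) auto
        then show ?thesis using x by blast
      qed
      then have "E s' x = x" if "s' \<le> s" for s'
        using that R(3) x(1) VH complete_subspace.proj_id[OF R(1)] by auto
      then have "\<forall>\<^sub>F s' in at_bot. E s' x = x" unfolding eventually_at_bot_linorder by blast
      then have "((\<lambda>s'. E s' x) \<longlongrightarrow> x) at_bot" by (rule tendsto_eventually)
      moreover have "((\<lambda>s'. E s' x) \<longlongrightarrow> 0) at_bot" using E_tendsto(2) x(1) VH by blast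
      ultimately show "x = 0" by (rule tendsto_unique[OF trivial_limit_at_bot_linorder])
    qed
    then show ?thesis using subspace_0[OF sub] by blast
  qed
  then obtain s0 where s0: "V \<inter> R s0 = {0}" by blast
  define s where "s = min s0 t"
  have st: "s \<le> t" and s: "V \<inter> R s = {0}"
    using s0 R_mono[of s s0] subspace_0[OF sub] by (auto simp: s_def)
  interpret s: complete_subspace "R s" by (rule R(1))
  define g where "g x = x - proj (R s) x" for x
  have lin: "linear g"
    unfolding g_def by (rule linearI) (simp_all add: s.proj_add s.proj_scale algebra_simps)
  have inj: "x = 0" if "x \<in> V" "g x = 0" for x
  proof -
    have "x = proj (R s) x" using that(2) by (simp add: g_def)
    then have "x \<in> R s" using s.proj(1) by metis
    then show ?thesis using s that(1) by blast
  qed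
  have y: "y \<in> Domain A \<and> (\<forall>z. y \<noteq> 0 \<longrightarrow> (y, z) \<in> A \<longrightarrow> inner z y < 0)" if yV: "y \<in> g ` V" for y
  proof -
    obtain x where x: "x \<in> V" "y = g x" using yV by blast
    have "proj (R s) x \<in> R t" using s.proj(1) R_mono[OF st] by blast
    then have yt: "y \<in> R t" using x VR R_subspace by (auto simp: g_def subspace_diff)
    then have yH: "y \<in> H" using R(2) by blast
    have ys: "inner y r = 0" if "r \<in> R s" for r
      using s.proj(2)[OF that] x(2) by (simp add: g_def)
    interpret S: stieltjes "\<lambda>t. inner (E t y) y" by (rule stieltjes[OF yH])
    interpret M: finite_measure "S.\<mu>" using finite_distribution[OF yH] by (simp add: spectral_distribution_def)
    have F0: "inner (E r y) y = 0" if "r \<le> s" for r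
    proof -
      have "proj (R r) y = 0"
        using ys R_mono[OF that] by (intro complete_subspace.proj_eq_0[OF R(1)]) blast
      then show ?thesis by (simp add: distribution_function[OF yH])
    qed
    have F1: "inner (E r y) y = (norm y)\<^sup>2" if "t \<le> r" for r
    proof -
      have "proj (R r) y = y"
        using yt R_mono[OF that] by (intro complete_subspace.proj_id[OF R(1)]) blast
      then show ?thesis by (simp add: distribution_function[OF yH])
    qed
    have ae1: "AE \<tau> in S.\<mu>. s < \<tau>" using F0 by (rule S.AE_greater)
    have ae2: "AE \<tau> in S.\<mu>. \<tau> \<le> t" using F1 by (rule S.AE_at_most)
    have bound: "AE \<tau> in S.\<mu>. \<bar>\<tau>\<bar> \<le> \<bar>s\<bar> + \<bar>t\<bar>" using ae1 ae2 by eventually_elim simp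
    have "integrable S.\<mu> (\<lambda>\<tau>. \<tau>\<^sup>2)"
    proof (rule M.integrable_const_bound)
      show "AE \<tau> in S.\<mu>. norm (\<tau>\<^sup>2) \<le> (\<bar>s\<bar> + \<bar>t\<bar>)\<^sup>2" using bound
      proof eventually_elim
        case (elim \<tau>)
        then show ?case using power_mono[OF elim, of 2] by simp
      qed
    qed simp
    then have dom: "y \<in> Domain A"
      using yH resolution unfolding spectral_resolution_def spectral_distribution_def by simp
    moreover have "inner z y < 0" if "y \<noteq> 0" "(y, z) \<in> A" for z
    proof -
      have int: "integrable S.\<mu> (\<lambda>\<tau>. \<tau>)"
        by (rule M.integrable_const_bound[of _ "\<bar>s\<bar> + \<bar>t\<bar>"]) (use bound in simp_all)
      have "inner z y = (LINT \<tau>|S.\<mu>. \<tau>)" using A_D(2)[OF that(2)] by (simp add: spectral_distribution_def)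
      also have "\<dots> \<le> (LINT \<tau>|S.\<mu>. t)" using ae2 int by (intro integral_mono_AE) simp_all
      also have "\<dots> = measure S.\<mu> UNIV * t" by simp
      also have "\<dots> < 0"
      proof -
        have "measure S.\<mu> {s - 1<..t} = inner (E t y) y - inner (E (s - 1) y) y"
          by (rule S.measure_Ioc) (use st in simp)
        then have "measure S.\<mu> {s - 1<..t} = (norm y)\<^sup>2" using F0[of "s - 1"] F1[of t] by simp
        moreover have "measure S.\<mu> {s - 1<..t} \<le> measure S.\<mu> UNIV"
          by (rule M.finite_measure_mono) simp_all
        moreover have "0 < (norm y)\<^sup>2" using that(1) by simp
        ultimately have "0 < measure S.\<mu> UNIV" by linarith
        then show ?thesis using t(1) by (simp add: mult_pos_neg)
      qed
      finally show ?thesis .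
    qed
    ultimately show ?thesis by blast
  qed
  show ?thesis
  proof (rule that[of "g ` V"])
    show "subspace (g ` V)" by (rule linear_subspace_image[OF lin V(1)])
    show "fin_dim (g ` V)" by (rule fin_dim_linear_image[OF lin V(2)])
    show "dim (g ` V) = dim V" by (rule dim_linear_image_inj[OF lin V(1,2) inj])
    show "g ` V \<subseteq> Domain A" "\<forall>y\<in>g ` V. \<forall>z. y \<noteq> 0 \<longrightarrow> (y, z) \<in> A \<longrightarrow> inner z y < 0"
      using y by blast+
  qed
qed

text \<open>
  Finite-dimensional pieces of \<open>U\<close> embed into the domain as negative definite subspaces.
  Conversely a negative definite subspace of larger dimension than \<open>closure U\<close> would contain a
  nonzero vector orthogonal to \<open>U\<close>, on which the form is nonnegative.
\<close>

lemma edim_eq_neg_index: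
  assumes a: "\<And>x z. (x, z) \<in> A \<longleftrightarrow> x \<in> D \<and> z = a x"
  shows "edim (closure U) = neg_index (\<lambda>x. inner (a x) x) D"
proof (rule antisym)
  have low: "enat (dim V) \<le> neg_index (\<lambda>x. inner (a x) x) D" if V: "subspace V" "fin_dim V" "V \<subseteq> U" for V
  proof -
    obtain V' where V': "subspace V'" "fin_dim V'" "dim V' = dim V" "V' \<subseteq> Domain A"
        "\<forall>y\<in>V'. \<forall>z. y \<noteq> 0 \<longrightarrow> (y, z) \<in> A \<longrightarrow> inner z y < 0"
      by (rule negative_subspace_in_domain[OF V])
    have D: "V' \<subseteq> D" using V'(4) a by blast
    have "neg_def (\<lambda>x. inner (a x) x) V'" unfolding neg_def_def using V'(1,2,5) D a by blast
    then show ?thesis using neg_index_upper[OF _ D] V'(3) by metis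
  qed
  show "edim (closure U) \<le> neg_index (\<lambda>x. inner (a x) x) D"
  proof (cases "fin_dim U")
    case True
    have "complete_subspace U"
      by (rule complete_subspace_fin_dim[OF U_subspace True H.complete_subspace_axioms U_H])
    then have "closure U = U" by (simp add: complete_subspace_def complete_imp_closed)
    then have "edim (closure U) = enat (dim U)" using True by (simp add: edim_def fin_dim_def)
    then show ?thesis using low[OF U_subspace True order_refl] by simp
  next
    case False
    have "neg_index (\<lambda>x. inner (a x) x) D = \<infinity>"
    proof (rule ccontr)
      assume "neg_index (\<lambda>x. inner (a x) x) D \<noteq> \<infinity>"
      then obtain k where k: "neg_index (\<lambda>x. inner (a x) x) D = enat k" by auto
      have "fin_dim U"
      proof (rule fin_dim_if_bounded[of U k])
        fix B assume B: "finite B" "independent B" "B \<subseteq> U"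
        have "enat (dim (span B)) \<le> enat k" unfolding k[symmetric]
          using B(3) by (intro low fin_dim_span B(1) span_minimal U_subspace) simp_all
        then show "card B \<le> k" using real_vector.dim_span_eq_card_independent[OF B(2)] by simp
      qed
      then show False using False by simp
    qed
    then show ?thesis by simp
  qed
  show "neg_index (\<lambda>x. inner (a x) x) D \<le> edim (closure U)"
  proof (cases "fin_dim (closure U)")
    case True
    have sN: "subspace (closure U)" by (rule subspace_closure[OF U_subspace])
    obtain B where B: "finite B" "independent B" "span B = closure U" "card B = dim (closure U)"
      by (rule fin_dim_basis[OF sN True])
    have "dim V \<le> dim (closure U)" if V: "neg_def (\<lambda>x. inner (a x) x) V" "V \<subseteq> D" for V
    proof (rule ccontr)
      assume "\<not> ?thesis"
      then have less: "card B < dim V" using B(4) by simp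
      have lin: "linear (\<lambda>x. inner x r)" for r :: 'a by (rule linearI) (simp_all add: inner_add_left)
      obtain u where u: "u \<in> V" "u \<noteq> 0" "\<forall>r\<in>B. inner u r = 0"
        by (rule common_zero_of_functionals[where f = "\<lambda>r x. inner x r", OF neg_defD(1,2)[OF V(1)] B(1) lin less])
      have "inner u y = 0" if "y \<in> U" for y
      proof -
        have "y \<in> span B" using that B(3) closure_subset by blast
        then show ?thesis by (induction rule: span_induct_alt) (simp_all add: u(3) inner_add_right)
      qed
      moreover have "(u, a u) \<in> A" using a u(1) V(2) by blast
      ultimately have "0 \<le> inner (a u) u" using form_nonneg_of_perp by blast
      then show False using neg_defD(3)[OF V(1) u(1,2)] by simp
    qed
    then have "neg_index (\<lambda>x. inner (a x) x) D \<le> enat (dim (closure U))"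
      by (intro neg_index_least) simp
    then show ?thesis using True by (simp add: edim_def fin_dim_def)
  next
    case False
    then have "edim (closure U) = \<infinity>" unfolding edim_def fin_dim_def by (rule if_not_P)
    then show ?thesis by simp
  qed
qed

end

theorem morse_index_eq_neg_index:
  assumes H: "complete_subspace H" and A: "selfadjoint_operator H A"
    and bounded: "\<And>x. x \<in> D \<Longrightarrow> c * (norm x)\<^sup>2 \<le> inner (a x) x"
    and a: "\<And>x z. (x, z) \<in> A \<longleftrightarrow> x \<in> D \<and> z = a x"
  shows "morse_index H A = neg_index (\<lambda>x. inner (a x) x) D"
proof -
  define E where "E = (SOME E. spectral_resolution H A E)"
  have "\<exists>E. spectral_resolution H A E"
  proof (rule spectral_resolution_exists[OF H A])
    show "c * (norm x)\<^sup>2 \<le> inner z x" if "(x, z) \<in> A" for x z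
      using bounded that unfolding a by simp
  qed
  then have "spectral_resolution H A E" unfolding E_def by (rule someI_ex)
  then interpret resolution H A E
    using H by (simp add: resolution_def resolution_axioms_def)
  have "morse_index H A = edim (closure U)"
    by (simp add: morse_index_def negative_spectral_subspace_def E_def[symmetric] U_def R_def)
  then show ?thesis using edim_eq_neg_index[OF a] by simp
qed

section \<open>Estimates for forms\<close>

text \<open>
  On a finite-dimensional space any linear map is bounded with respect to any definite form; the
  proof adds one vector of an orthogonalised basis at a time.
\<close>

lemma neg_def_bounds_linear_map:
  fixes b :: "'a::real_vector \<Rightarrow> 'a \<Rightarrow> real" and g :: "'a \<Rightarrow> 'c::real_normed_vector"
  assumes V: "symmetric_form V b" and nd: "neg_def (\<lambda>x. b x x) V" and g: "linear g"
  obtains C where "0 \<le> C" "\<forall>v\<in>V. (norm (g v))\<^sup>2 \<le> C * (- b v v)"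
proof -
  interpret symmetric_form V b by (rule V)
  obtain B where B: "finite B" "independent B" "span B = V" "card B = dim V"
    by (rule fin_dim_basis[OF neg_defD(1,2)[OF nd]])
  have "\<exists>C\<ge>0. \<forall>v\<in>span D. (norm (g v))\<^sup>2 \<le> C * (- b v v)" if "D \<subseteq> B" for D
    using finite_subset[OF that B(1)] that
  proof (induction D)
    case empty
    show ?case by (intro exI[of _ 0]) (simp add: linear_0[OF g])
  next
    case (insert w D)
    obtain C where C: "0 \<le> C" "\<forall>v\<in>span D. (norm (g v))\<^sup>2 \<le> C * (- b v v)"
      using insert by blast
    have DV: "span D \<subseteq> V" using insert.prems B(3) span_mono[of D B] by blast
    have wV: "w \<in> V" using insert.prems B(3) span_base[of w B] by blast
    have fin: "fin_dim (span D)" by (rule fin_dim_span[OF insert.hyps(1)])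
    have def0: "u = 0" if "u \<in> V" "b u u = 0" for u
      using neg_defD(3)[OF nd that(1)] that(2) by (cases "u = 0") simp_all
    obtain r where r: "r \<in> span D" "\<forall>u\<in>span D. b (w - r) u = 0"
    proof (rule form_projection[OF bilinear subspace_span fin])
      show "u = 0" if "u \<in> span D" "b u u = 0" for u using def0 that DV by blast
    qed blast
    define w' where "w' = w - r"
    have w'V: "w' \<in> V" using wV r(1) DV subspace unfolding w'_def by (intro subspace_diff) auto
    define K where "K = (if w' = 0 then 0 else (norm (g w'))\<^sup>2 / (- b w' w'))"
    have neg: "w' \<noteq> 0 \<Longrightarrow> b w' w' < 0" using neg_defD(3)[OF nd w'V] .
    have K: "0 \<le> K" "(norm (g w'))\<^sup>2 = K * (- b w' w')"
    proof -
      have "0 \<le> K \<and> (norm (g w'))\<^sup>2 = K * (- b w' w')"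
      proof (cases "w' = 0")
        case True then show ?thesis by (simp add: K_def linear_0[OF g])
      next
        case False
        then have "b w' w' < 0" using neg by simp
        then show ?thesis using False unfolding K_def by (simp add: divide_nonneg_neg)
      qed
      then show "0 \<le> K" "(norm (g w'))\<^sup>2 = K * (- b w' w')" by blast+
    qed
    show ?case
    proof (intro exI[of _ "2 * C + 2 * K"] conjI ballI)
      show "0 \<le> 2 * C + 2 * K" using C K by simp
      fix v assume "v \<in> span (insert w D)"
      then obtain k where k: "v - k *\<^sub>R w \<in> span D" unfolding span_breakdown_eq by blast
      define u where "u = v - k *\<^sub>R w + k *\<^sub>R r"
      have u: "u \<in> span D" unfolding u_def using k r(1) by (intro span_add span_scale)
      have v: "v = u + k *\<^sub>R w'" by (simp add: u_def w'_def algebra_simps)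
      have "b w' u = 0" using r(2) u by (simp add: w'_def)
      moreover have "b u w' = b w' u" using sym w'V u DV by blast
      ultimately have bv: "- b v v = - b u u + k\<^sup>2 * (- b w' w')"
        unfolding v by (simp add: simps power2_eq_square)
      have nu: "0 \<le> - b u u"
        using neg_defD(3)[OF nd, of u] u DV by (cases "u = 0") (auto simp: simps)
      have nw: "0 \<le> - b w' w'" using neg by (cases "w' = 0") (auto simp: simps)
      have "norm (g v) \<le> norm (g u) + \<bar>k\<bar> * norm (g w')"
        unfolding v using norm_triangle_ineq[of "g u" "k *\<^sub>R g w'"]
        by (simp add: linear_add[OF g] linear_scale[OF g])
      then have "(norm (g v))\<^sup>2 \<le> (norm (g u) + \<bar>k\<bar> * norm (g w'))\<^sup>2"
        by (simp add: power_mono)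
      also have "\<dots> \<le> 2 * (norm (g u))\<^sup>2 + 2 * (k\<^sup>2 * (norm (g w'))\<^sup>2)"
        using sum_squares_bound[of "norm (g u)" "\<bar>k\<bar> * norm (g w')"]
        by (simp add: power2_sum power_mult_distrib)
      also have "\<dots> \<le> 2 * (C * (- b u u)) + 2 * (k\<^sup>2 * (K * (- b w' w')))"
        using C(2) u K(2) by simp
      also have "\<dots> \<le> (2 * C + 2 * K) * (- b v v)"
      proof -
        have "0 \<le> K * (- b u u)" "0 \<le> C * (k\<^sup>2 * (- b w' w'))"
          using C K nu nw by (simp_all only: mult_nonneg_nonneg zero_le_power2)
        then show ?thesis unfolding bv by (simp only: distrib_left distrib_right) (simp add: ac_simps)
      qed
      finally show "(norm (g v))\<^sup>2 \<le> (2 * C + 2 * K) * (- b v v)" .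
    qed
  qed
  from this[OF order_refl] show ?thesis using that unfolding B(3) by blast
qed

text \<open>
  If \<open>t\<close> is at most \<open>\<delta> y\<close> and \<open>y\<close> is of the order of \<open>sqrt t\<close>, then \<open>t\<close> is of the order of \<open>\<delta>\<^sup>2\<close>.
  This is how a small perturbation of an orthogonality relation makes a value of the form small.
\<close>

lemma le_of_quadratic_bounds:
  fixes t C \<delta> :: real
  assumes "0 \<le> t" "t \<le> \<delta> * y" "y\<^sup>2 \<le> C * t" "0 \<le> C" "0 \<le> \<delta>"
  shows "t \<le> C * \<delta>\<^sup>2"
proof (cases "t = 0")
  case False
  have "t * t \<le> (\<delta> * y)\<^sup>2" using assms(1,2) by (metis power2_eq_square power_mono)
  also have "\<dots> \<le> \<delta>\<^sup>2 * (C * t)" using assms(3) by (simp add: power_mult_distrib mult_left_mono)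
  finally have "t * t \<le> (C * \<delta>\<^sup>2) * t" by (simp add: ac_simps)
  then show ?thesis using False assms(1) by simp
qed (use assms in simp)

locale nonneg_form = symmetric_form +
  assumes nonneg: "x \<in> X \<Longrightarrow> 0 \<le> b x x"
begin

lemma cauchy_schwarz:
  assumes "x \<in> X" "y \<in> X" shows "(b x y)\<^sup>2 \<le> b x x * b y y"
proof -
  have q: "0 \<le> b x x + 2 * t * b x y + t\<^sup>2 * b y y" for t
  proof -
    have "x + t *\<^sub>R y \<in> X" using assms subspace by (simp add: subspace_add subspace_scale)
    then have "0 \<le> b (x + t *\<^sub>R y) (x + t *\<^sub>R y)" by (rule nonneg)
    then show ?thesis using sym[OF assms] by (simp add: simps power2_eq_square algebra_simps)
  qed
  show ?thesis
  proof (cases "b y y = 0")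
    case True
    have "b x y = 0"
    proof (rule ccontr)
      assume n: "b x y \<noteq> 0"
      then have "2 * ((- b x x - 1) / (2 * b x y)) * b x y = - b x x - 1" by (simp add: field_simps)
      then show False using q[of "(- b x x - 1) / (2 * b x y)"] True by simp
    qed
    then show ?thesis using True by simp
  next
    case False
    then have pos: "b y y > 0" using nonneg[OF assms(2)] by simp
    define t where "t = - b x y / b y y"
    have "t * b y y = - b x y" using False by (simp add: t_def)
    then have "2 * t * b x y + t\<^sup>2 * b y y = t * b x y" by (simp add: power2_eq_square mult.assoc)
    then have "0 \<le> b x x + t * b x y" using q[of t] by linarith
    then have "0 \<le> (b x x + t * b x y) * b y y" using pos by simp
    also have "\<dots> = b x x * b y y + b x y * (t * b y y)" by (simp add: algebra_simps)
    also have "\<dots> = b x x * b y y - (b x y)\<^sup>2"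
      using \<open>t * b y y = - b x y\<close> by (simp add: power2_eq_square)
    finally show ?thesis by simp
  qed
qed

lemma parallelogram_le:
  assumes "x \<in> X" "y \<in> X" shows "b (x + y) (x + y) \<le> 2 * b x x + 2 * b y y"
proof -
  have "0 \<le> b (x - y) (x - y)" using nonneg subspace_diff[OF subspace assms] by blast
  then show ?thesis using sym[OF assms] by (simp add: simps)
qed

end

lemma bilinear_inner_linear:
  assumes "linear A" shows "bilinear (\<lambda>x y::'a::real_inner. inner (A x) y)"
  unfolding bilinear_def
  by (intro conjI allI linearI) (simp_all add: linear_add[OF assms] linear_scale[OF assms] inner_add_left inner_add_right)

section \<open>Extensions of a semibounded symmetric Fredholm operator\<close>

locale semibounded_fredholm = H: complete_subspace H for H :: "'a::real_inner set" +
  fixes L :: "('a \<times> 'a) set" and c :: real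
  assumes L_closed: "closed_operator H L" and L_symmetric: "symmetric_operator H L"
    and L_fredholm: "fredholm_operator H L"
    and L_bounded: "\<And>x z. (x, z) \<in> L \<Longrightarrow> c * (norm x)\<^sup>2 \<le> inner z x"
begin

definition Ladj where "Ladj = op_adjoint H L"
definition D0 where "D0 = Domain L"
definition X where "X = Domain Ladj"
text \<open>
  A linear map of the whole type that represents \<open>L\<^sup>*\<close> on its domain \<open>X\<close>, with arbitrary values
  elsewhere; so \<open>\<langle>Ax, y\<rangle>\<close> is bilinear without domain conditions.
\<close>

definition A :: "'a \<Rightarrow> 'a" where "A = (SOME A. linear A \<and> (\<forall>x\<in>X. (x, A x) \<in> Ladj))"

lemma L_basic: "L \<subseteq> H \<times> H" "subspace L" "single_valued L" "closed L" "H \<subseteq> closure D0"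
  using L_closed L_symmetric
  by (simp_all add: closed_operator_def linear_operator_def symmetric_operator_def D0_def)

lemma L_sym: "(x, z) \<in> L \<Longrightarrow> (y, w) \<in> L \<Longrightarrow> inner z y = inner x w"
  using L_symmetric unfolding symmetric_operator_def by blast

lemma D0_dense: assumes y: "y \<in> H" "\<And>x. x \<in> D0 \<Longrightarrow> inner x y = 0" shows "y = 0"
proof -
  have "y \<in> closure D0" using L_basic(5) y(1) by blast
  then obtain u where u: "\<And>n. u n \<in> D0" "u \<longlonglongrightarrow> y" unfolding closure_sequential by blast
  have "(\<lambda>n. inner (u n) y) \<longlonglongrightarrow> inner y y" by (intro tendsto_intros u)
  then have "inner y y = 0" using y(2)[OF u(1)] by (simp add: LIMSEQ_const_iff)
  then show ?thesis by simp
qed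

lemma Ladj_iff: "(y, w) \<in> Ladj \<longleftrightarrow> y \<in> H \<and> w \<in> H \<and> (\<forall>x z. (x, z) \<in> L \<longrightarrow> inner z y = inner x w)"
  unfolding Ladj_def op_adjoint_def by blast

lemma Ladj_subspace: "subspace Ladj"
  unfolding Ladj_def by (rule op_adjoint_subspace[OF H.subspace])

lemma Ladj_single: assumes "(x, y) \<in> Ladj" "(x, z) \<in> Ladj" shows "y = z"
proof -
  have "y - z = 0"
  proof (rule D0_dense)
    show "y - z \<in> H" using assms H.subspace by (simp add: Ladj_iff subspace_diff)
    fix u assume "u \<in> D0"
    then obtain v where "(u, v) \<in> L" unfolding D0_def by blast
    then have "inner u y = inner v x" "inner u z = inner v x" using assms unfolding Ladj_iff by metis+
    then show "inner u (y - z) = 0" by (simp add: inner_diff_right)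
  qed
  then show ?thesis by simp
qed

lemma X_subspace: "subspace X" unfolding X_def by (rule subspace_Domain[OF Ladj_subspace])

lemma A: "linear A" "x \<in> X \<Longrightarrow> (x, A x) \<in> Ladj"
proof -
  have "\<forall>x. \<exists>z. x \<in> X \<longrightarrow> (x, z) \<in> Ladj" unfolding X_def by blast
  then obtain f where f: "\<And>x. x \<in> X \<Longrightarrow> (x, f x) \<in> Ladj" by metis
  obtain g where g: "linear g" "\<forall>x\<in>X. g x = f x"
  proof (rule linear_extension[OF X_subspace, of f])
    fix x y assume xy: "x \<in> X" "y \<in> X"
    have "(x + y, f x + f y) \<in> Ladj"
      using subspace_add[OF Ladj_subspace f[OF xy(1)] f[OF xy(2)]] by simp
    then show "f (x + y) = f x + f y"
      using Ladj_single[OF f] subspace_add[OF X_subspace xy] by blast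
  next
    fix k x assume x: "x \<in> X"
    have "(k *\<^sub>R x, k *\<^sub>R f x) \<in> Ladj" using subspace_scale[OF Ladj_subspace f[OF x]] by simp
    then show "f (k *\<^sub>R x) = k *\<^sub>R f x"
      using Ladj_single[OF f] subspace_scale[OF X_subspace x] by blast
  qed
  then have "\<exists>g. linear g \<and> (\<forall>x\<in>X. (x, g x) \<in> Ladj)" using f by (intro exI[of _ g]) simp
  then have "linear A \<and> (\<forall>x\<in>X. (x, A x) \<in> Ladj)" unfolding A_def by (rule someI_ex)
  then show "linear A" "x \<in> X \<Longrightarrow> (x, A x) \<in> Ladj" by blast+
qed

lemmas A_simps = linear_add[OF A(1)] linear_diff[OF A(1)] linear_scale[OF A(1)] linear_0[OF A(1)]
  linear_neg[OF A(1)]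

lemma Ladj_A: "(x, z) \<in> Ladj \<longleftrightarrow> x \<in> X \<and> z = A x"
  using A(2) Ladj_single unfolding X_def by blast

lemma X_H: "x \<in> X \<Longrightarrow> x \<in> H" "x \<in> X \<Longrightarrow> A x \<in> H" using A(2) unfolding Ladj_iff by blast+

lemma L_Ladj: "L \<subseteq> Ladj"
proof
  fix p assume p: "p \<in> L"
  then show "p \<in> Ladj" using L_basic(1) L_sym by (cases p) (auto simp: Ladj_iff)
qed

lemma L_A: "(x, z) \<in> L \<longleftrightarrow> x \<in> D0 \<and> z = A x"
proof
  assume "(x, z) \<in> L"
  then show "x \<in> D0 \<and> z = A x" using L_Ladj Ladj_A unfolding D0_def by blast
next
  assume *: "x \<in> D0 \<and> z = A x"
  then obtain z' where "(x, z') \<in> L" unfolding D0_def by blast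
  moreover have "z' = A x" using calculation L_Ladj Ladj_A by blast
  ultimately show "(x, z) \<in> L" using * by simp
qed

lemma D0_X: "D0 \<subseteq> X" using L_A L_Ladj Ladj_A by blast

lemma D0_subspace: "subspace D0" unfolding D0_def by (rule subspace_Domain[OF L_basic(2)])

lemma form_D0: "x \<in> D0 \<Longrightarrow> c * (norm x)\<^sup>2 \<le> inner (A x) x" using L_bounded L_A by blast

lemma sym_D0: assumes "x \<in> X" "d \<in> D0" shows "inner (A x) d = inner x (A d)"
proof -
  have "(x, A x) \<in> Ladj" "(d, A d) \<in> L" using A(2) L_A assms by blast+
  then have "inner (A d) x = inner d (A x)" unfolding Ladj_iff by blast
  then show ?thesis by (simp add: inner_commute)
qed

lemma op_app_Ladj: "x \<in> X \<Longrightarrow> op_app Ladj x = A x"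
  unfolding op_app_def by (rule the_equality) (simp_all add: Ladj_A)

lemma op_app_L: "x \<in> D0 \<Longrightarrow> op_app L x = A x"
  unfolding op_app_def by (rule the_equality) (simp_all add: L_A)

definition \<omega> :: "'a \<Rightarrow> 'a \<Rightarrow> real" where "\<omega> x y = inner x (A y) - inner (A x) y"

lemma boundary_form_\<omega>: "x \<in> X \<Longrightarrow> y \<in> X \<Longrightarrow> boundary_form Ladj x y = \<omega> x y"
  by (simp add: boundary_form_def \<omega>_def op_app_Ladj)

lemma \<omega>_simps: "\<omega> (x + y) z = \<omega> x z + \<omega> y z" "\<omega> x (y + z) = \<omega> x y + \<omega> x z"
  "\<omega> (x - y) z = \<omega> x z - \<omega> y z" "\<omega> x (y - z) = \<omega> x y - \<omega> x z"
  by (simp_all add: \<omega>_def A_simps inner_add_left inner_add_right inner_diff_left inner_diff_right inner_commute)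

lemma \<omega>_D0: "x \<in> X \<Longrightarrow> d \<in> D0 \<Longrightarrow> \<omega> x d = 0" "x \<in> X \<Longrightarrow> d \<in> D0 \<Longrightarrow> \<omega> d x = 0"
  using sym_D0[of x d] by (simp_all add: \<omega>_def inner_commute)

definition N where "N = {x\<in>X. A x = 0}"

lemma N_kernel: "op_kernel Ladj = N" unfolding op_kernel_def N_def by (auto simp: Ladj_A)

lemma N_subspace: "subspace N"
  unfolding N_def using X_subspace by (auto simp: subspace_def A_simps)

lemma N_perp_range: assumes "n \<in> N" "d \<in> D0" shows "inner (A d) n = 0"
  using sym_D0[of n d] assms unfolding N_def by (simp add: inner_commute)

lemma Range_L: "Range L = A ` D0" by (auto simp: L_A image_iff Range_iff)

text \<open>
  The range of \<open>L\<close> is closed by the Fredholm property, and its orthogonal complement is the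
  kernel of \<open>L\<^sup>*\<close>.
\<close>

lemma perp_kernel_in_range:
  assumes h: "h \<in> H" "\<And>n. n \<in> N \<Longrightarrow> inner h n = 0" shows "\<exists>d\<in>D0. A d = h"
proof -
  have cl: "closed (Range L)" using L_fredholm by (simp add: fredholm_operator_def)
  have sub: "Range L \<subseteq> H" using L_basic(1) by blast
  have cR: "complete_subspace (Range L)"
    using complete_subspace_closed[OF H.complete_subspace_axioms cl subspace_Range[OF L_basic(2)] sub] .
  interpret R: complete_subspace "Range L" by (rule cR)
  define r where "r = h - proj (Range L) h"
  have rH: "r \<in> H" unfolding r_def using h(1) R.proj(1) sub H.subspace by (intro subspace_diff) auto
  have perp: "inner r z = 0" if "z \<in> Range L" for z using R.proj(2)[OF that] by (simp add: r_def)
  have "inner z r = inner y 0" if "(y, z) \<in> L" for y z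
  proof -
    have "inner r z = 0" using perp that by blast
    then show ?thesis by (simp add: inner_commute)
  qed
  then have "(r, 0) \<in> Ladj" using rH subspace_0[OF H.subspace] unfolding Ladj_iff by blast
  then have "r \<in> X" "A r = 0" using Ladj_A[of r 0] by simp_all
  then have "r \<in> N" by (simp add: N_def)
  then have "inner h r = 0" using h(2) by blast
  moreover have "inner (proj (Range L) h) r = 0" using perp[OF R.proj(1)] by (simp add: inner_commute)
  ultimately have "inner r r = 0" by (simp add: r_def inner_diff_left)
  then have "h = proj (Range L) h" by (simp add: r_def)
  then show ?thesis using R.proj(1)[of h] unfolding Range_L by auto
qed

text \<open>
  The kernel of \<open>L\<^sup>*\<close> is orthogonal to the range of \<open>L\<close>, which has finite codimension.
\<close>

lemma N_fin_dim: "fin_dim N"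
proof -
  obtain B where B: "finite B" "H \<subseteq> span (Range L \<union> B)"
    using L_fredholm by (auto simp: fredholm_operator_def)
  show ?thesis
  proof (rule fin_dim_if_bounded[of N "card B"])
    fix C assume C: "finite C" "independent C" "C \<subseteq> N"
    show "card C \<le> card B"
    proof (rule ccontr)
      assume "\<not> ?thesis"
      then have less: "card B < dim (span C)" using real_vector.dim_span_eq_card_independent[OF C(2)] by simp
      have lin: "linear (\<lambda>x. inner x r)" for r :: 'a by (rule linearI) (simp_all add: inner_add_left)
      obtain u where u: "u \<in> span C" "u \<noteq> 0" "\<forall>r\<in>B. inner u r = 0"
        by (rule common_zero_of_functionals[where f = "\<lambda>r x. inner x r", OF subspace_span fin_dim_span[OF C(1)] B(1) lin less])
      have uN: "u \<in> N" using u(1) span_minimal[OF C(3) N_subspace] by blast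
      have r0: "inner u r = 0" if "r \<in> Range L \<union> B" for r
        using that u(3) N_perp_range[OF uN] unfolding Range_L by (auto simp: inner_commute)
      have "inner u z = 0" if "z \<in> span (Range L \<union> B)" for z
        using that
      proof (induction rule: span_induct_alt)
        case (step k y z)
        then show ?case using r0[OF step(1)] by (simp add: inner_add_right)
      qed simp
      moreover have "u \<in> H" using uN X_H(1) unfolding N_def by blast
      ultimately have "inner u u = 0" using B(2) by blast
      then show False using u(2) by simp
    qed
  qed
qed

text \<open>
  The subspaces between \<open>D(L)\<close> and \<open>D(L\<^sup>*)\<close> that coincide with their \<open>\<omega>\<close>-complement, that is,
  whose images in \<open>D(L\<^sup>*) / D(L)\<close> are Lagrangian. They are domains of self-adjoint extensions of
  \<open>L\<close>.
\<close>

definition lagr :: "'a set \<Rightarrow> bool" where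
  "lagr M \<longleftrightarrow> subspace M \<and> D0 \<subseteq> M \<and> M \<subseteq> X \<and> (\<forall>x\<in>M. \<forall>y\<in>M. \<omega> x y = 0) \<and>
     (\<forall>x\<in>X. (\<forall>y\<in>M. \<omega> x y = 0) \<longrightarrow> x \<in> M)"

lemma lagrD:
  assumes "lagr M"
  shows "subspace M" "D0 \<subseteq> M" "M \<subseteq> X" "x \<in> M \<Longrightarrow> y \<in> M \<Longrightarrow> inner (A x) y = inner x (A y)"
    "x \<in> X \<Longrightarrow> (\<And>y. y \<in> M \<Longrightarrow> \<omega> x y = 0) \<Longrightarrow> x \<in> M"
proof -
  show "subspace M" "D0 \<subseteq> M" "M \<subseteq> X" using assms by (simp_all add: lagr_def)
  show "inner (A x) y = inner x (A y)" if "x \<in> M" "y \<in> M"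
  proof -
    have "\<omega> x y = 0" using assms that unfolding lagr_def by blast
    then show ?thesis by (simp add: \<omega>_def)
  qed
  show "x \<in> X \<Longrightarrow> (\<And>y. y \<in> M \<Longrightarrow> \<omega> x y = 0) \<Longrightarrow> x \<in> M" using assms unfolding lagr_def by blast
qed

lemma op_restrict_iff: "M \<subseteq> X \<Longrightarrow> (x, z) \<in> op_restrict Ladj M \<longleftrightarrow> x \<in> M \<and> z = A x"
  unfolding op_restrict_def by (auto simp: Ladj_A)

text \<open>
  The adjoint of the restriction is a restriction of \<open>L\<^sup>*\<close>, and its domain is the \<open>\<omega>\<close>-complement
  of \<open>M\<close>.
\<close>

lemma selfadjoint_restrict:
  assumes M: "lagr M" shows "selfadjoint_operator H (op_restrict Ladj M)"
proof -
  note MD = lagrD[OF M]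
  note iff = op_restrict_iff[OF MD(3)]
  let ?R = "op_restrict Ladj M"
  have eq: "?R = (\<lambda>x. (x, A x)) ` M" using iff by auto
  have lin: "linear (\<lambda>x. (x, A x))" by (rule linearI) (simp_all add: A_simps)
  have "linear_operator H ?R" unfolding linear_operator_def
  proof (intro conjI)
    show "?R \<subseteq> H \<times> H" unfolding eq using MD(3) X_H by blast
    show "subspace ?R" unfolding eq by (rule linear_subspace_image[OF lin MD(1)])
    show "single_valued ?R" unfolding eq by (auto simp: single_valued_def)
  qed
  moreover have "H \<subseteq> closure (Domain ?R)"
  proof -
    have "D0 \<subseteq> Domain ?R" using MD(2) iff by blast
    then show ?thesis using L_basic(5) closure_mono by blast
  qed
  moreover have "(y, w) \<in> op_adjoint H ?R \<longleftrightarrow> (y, w) \<in> ?R" for y w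
  proof
    assume "(y, w) \<in> op_adjoint H ?R"
    then have yw: "y \<in> H" "w \<in> H" "\<And>x. x \<in> M \<Longrightarrow> inner (A x) y = inner x w"
      unfolding op_adjoint_def eq by auto
    have "inner z y = inner x w" if "(x, z) \<in> L" for x z
    proof -
      have "x \<in> D0" "z = A x" using that L_A by simp_all
      then show ?thesis using yw(3) MD(2) by blast
    qed
    then have "(y, w) \<in> Ladj" unfolding Ladj_iff using yw(1,2) by blast
    then have y: "y \<in> X" "w = A y" using Ladj_A by simp_all
    have "\<omega> y x = 0" if "x \<in> M" for x
      using yw(3)[OF that] y(2) by (simp add: \<omega>_def inner_commute)
    then have "y \<in> M" using MD(5)[OF y(1)] by blast
    then show "(y, w) \<in> ?R" using y(2) iff by blast
  next
    assume "(y, w) \<in> ?R"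
    then have yw: "y \<in> M" "w = A y" using iff by simp_all
    then have "y \<in> H" "w \<in> H" using X_H MD(3) by blast+
    moreover have "inner (A x) y = inner x w" if "x \<in> M" for x using MD(4)[OF that yw(1)] yw(2) by simp
    ultimately show "(y, w) \<in> op_adjoint H ?R" unfolding op_adjoint_def eq by auto
  qed
  then have "op_adjoint H ?R = ?R" by auto
  ultimately show ?thesis unfolding selfadjoint_operator_def by blast
qed

definition form_cauchy :: "(nat \<Rightarrow> 'a) \<Rightarrow> bool" where
  "form_cauchy u \<longleftrightarrow> (\<forall>k. u k \<in> D0) \<and>
     (\<forall>e>0. \<exists>n. \<forall>k\<ge>n. \<forall>m\<ge>n. \<bar>inner (A (u k - u m)) (u k - u m)\<bar> < e)"

text \<open>
  The domain of the Friedrichs extension.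
\<close>

definition MF where "MF = {x\<in>X. \<exists>u. form_cauchy u \<and> u \<longlonglongrightarrow> x}"

lemma friedrichs_MF: "friedrichs_extension H L = op_restrict Ladj MF"
proof -
  have *: "(\<forall>k. u k \<in> Domain L) \<and> u \<longlonglongrightarrow> x \<and>
      (\<forall>e>0. \<exists>N::nat. \<forall>k\<ge>N. \<forall>m\<ge>N. \<bar>inner (op_app L (u k - u m)) (u k - u m)\<bar> < e)
    \<longleftrightarrow> form_cauchy u \<and> u \<longlonglongrightarrow> x" for u x
  proof (cases "\<forall>k. u k \<in> D0")
    case True
    then have "op_app L (u k - u m) = A (u k - u m)" for k m
      using subspace_diff[OF D0_subspace] op_app_L by simp
    then show ?thesis using True unfolding form_cauchy_def D0_def by auto
  next
    case False
    then show ?thesis unfolding form_cauchy_def D0_def by blast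
  qed
  show ?thesis
    unfolding friedrichs_extension_def Ladj_def[symmetric] * op_restrict_def MF_def
    by (auto simp: Ladj_A)
qed

text \<open>
  The form of \<open>L + 1 - c\<close>, which dominates the norm; on \<open>D(L)\<close>, Cauchy sequences for it are the
  norm Cauchy sequences that are Cauchy for the form of \<open>L\<close>.
\<close>

definition sform :: "'a \<Rightarrow> 'a \<Rightarrow> real" where
  "sform x y = inner (A x) y + (1 - c) * inner x y"

lemma bilinear_sform: "bilinear sform"
  unfolding bilinear_def sform_def
  by (intro conjI allI linearI) (simp_all add: A_simps inner_add_left inner_add_right algebra_simps)

lemma sform_ge: "x \<in> D0 \<Longrightarrow> (norm x)\<^sup>2 \<le> sform x x"
  using form_D0[of x] by (simp add: sform_def power2_norm_eq_inner algebra_simps)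

sublocale S: nonneg_form D0 sform
proof (intro nonneg_form.intro symmetric_form.intro nonneg_form_axioms.intro)
  show "subspace D0" by (rule D0_subspace)
  show "bilinear sform" by (rule bilinear_sform)
  show "sform x y = sform y x" if "x \<in> D0" "y \<in> D0" for x y
    using sym_D0[of x y] that D0_X by (auto simp: sform_def inner_commute)
  show "0 \<le> sform x x" if "x \<in> D0" for x
    using sform_ge[OF that] zero_le_power2 order_trans by blast
qed

lemma form_cauchy_sform:
  assumes "form_cauchy u" "u \<longlonglongrightarrow> x" "0 < e"
  obtains n where "\<forall>k\<ge>n. \<forall>m\<ge>n. sform (u k - u m) (u k - u m) < e"
proof -
  define K where "K = \<bar>1 - c\<bar> + 1"
  have K: "0 < K" unfolding K_def using abs_ge_zero[of "1 - c"] by linarith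
  define e' where "e' = e / (2 * K)"
  have e': "0 < e'" using K assms(3) by (simp add: e'_def)
  have half: "0 < e / 2" using assms(3) by simp
  obtain n1 where n1: "\<forall>k\<ge>n1. \<forall>m\<ge>n1. \<bar>inner (A (u k - u m)) (u k - u m)\<bar> < e / 2"
    using assms(1) half unfolding form_cauchy_def by blast
  have "Cauchy u" using assms(2) LIMSEQ_imp_Cauchy by blast
  then obtain n2 where n2: "\<forall>k\<ge>n2. \<forall>m\<ge>n2. dist (u k) (u m) < sqrt e'"
    using metric_CauchyD[of u "sqrt e'"] e' by auto
  have "sform (u k - u m) (u k - u m) < e" if "k \<ge> max n1 n2" "m \<ge> max n1 n2" for k m
  proof -
    have "norm (u k - u m) < sqrt e'" using n2 that by (simp add: dist_norm)
    then have "(norm (u k - u m))\<^sup>2 < (sqrt e')\<^sup>2" by (intro power_strict_mono) simp_all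
    then have "(norm (u k - u m))\<^sup>2 \<le> e'" using e' by simp
    then have "\<bar>1 - c\<bar> * (norm (u k - u m))\<^sup>2 \<le> \<bar>1 - c\<bar> * e'" by (intro mult_left_mono) simp_all
    also have "\<dots> \<le> K * e'" using e' by (simp add: K_def)
    also have "\<dots> = e / 2" using K by (simp add: e'_def)
    finally have "\<bar>1 - c\<bar> * (norm (u k - u m))\<^sup>2 \<le> e / 2" .
    moreover have "(1 - c) * inner (u k - u m) (u k - u m) \<le> \<bar>1 - c\<bar> * (norm (u k - u m))\<^sup>2"
      unfolding power2_norm_eq_inner by (intro mult_right_mono) simp_all
    moreover have "inner (A (u k - u m)) (u k - u m) < e / 2"
    proof -
      have "\<bar>inner (A (u k - u m)) (u k - u m)\<bar> < e / 2" using n1 that by simp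
      then show ?thesis by (rule abs_less_iff[THEN iffD1, THEN conjunct1])
    qed
    ultimately show ?thesis unfolding sform_def by linarith
  qed
  then show ?thesis using that[of "max n1 n2"] by blast
qed

lemma form_cauchyI:
  assumes u: "\<And>k. u k \<in> D0" and lim: "\<And>e. 0 < e \<Longrightarrow> \<exists>n. \<forall>k\<ge>n. \<forall>m\<ge>n. sform (u k - u m) (u k - u m) < e"
  shows "form_cauchy u" "Cauchy u"
proof -
  have d: "u k - u m \<in> D0" for k m using u D0_subspace by (simp add: subspace_diff)
  show "form_cauchy u" unfolding form_cauchy_def
  proof (intro conjI allI impI)
    show "u k \<in> D0" for k by (rule u)
    fix e :: real assume e: "0 < e"
    define e' where "e' = e / (\<bar>1 - c\<bar> + 1)"
    have "0 < \<bar>1 - c\<bar> + 1" using abs_ge_zero[of "1 - c"] by linarith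
    then have "0 < e'" unfolding e'_def by (rule divide_pos_pos[OF e])
    then obtain n where n: "\<forall>k\<ge>n. \<forall>m\<ge>n. sform (u k - u m) (u k - u m) < e'" using lim by blast
    have "\<bar>inner (A (u k - u m)) (u k - u m)\<bar> < e" if "k \<ge> n" "m \<ge> n" for k m
    proof -
      let ?s = "sform (u k - u m) (u k - u m)" and ?x = "u k - u m"
      have s: "0 \<le> ?s" "?s < e'" "(norm ?x)\<^sup>2 \<le> ?s" using S.nonneg[OF d] n that sform_ge[OF d] by blast+
      have "\<bar>(1 - c) * inner ?x ?x\<bar> = \<bar>1 - c\<bar> * (norm ?x)\<^sup>2"
        by (simp add: abs_mult power2_norm_eq_inner)
      also have "\<dots> \<le> \<bar>1 - c\<bar> * ?s" using s(3) by (intro mult_left_mono) simp_all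
      finally have "\<bar>inner (A ?x) ?x\<bar> \<le> (\<bar>1 - c\<bar> + 1) * ?s"
        using s(1) unfolding sform_def by (simp add: algebra_simps) linarith
      also have "\<dots> < (\<bar>1 - c\<bar> + 1) * e'" using s(2) by (intro mult_strict_left_mono) simp_all
      also have "\<dots> = e" by (simp add: e'_def field_simps)
      finally show ?thesis .
    qed
    then show "\<exists>n. \<forall>k\<ge>n. \<forall>m\<ge>n. \<bar>inner (A (u k - u m)) (u k - u m)\<bar> < e" by blast
  qed
  show "Cauchy u"
  proof (rule metric_CauchyI)
    fix e :: real assume e: "0 < e"
    then have "0 < e\<^sup>2" by simp
    then obtain n where n: "\<forall>k\<ge>n. \<forall>m\<ge>n. sform (u k - u m) (u k - u m) < e\<^sup>2" using lim by blast
    have "dist (u k) (u m) < e" if "k \<ge> n" "m \<ge> n" for k m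
    proof -
      have "(norm (u k - u m))\<^sup>2 < e\<^sup>2" using n that sform_ge[OF d, of k m] le_less_trans by blast
      then show ?thesis using e unfolding dist_norm by (meson less_imp_le power2_less_imp_less)
    qed
    then show "\<exists>n. \<forall>k\<ge>n. \<forall>m\<ge>n. dist (u k) (u m) < e" by blast
  qed
qed

text \<open>
  The form is not continuous in the norm, but it is along form Cauchy sequences. By the
  Cauchy--Schwarz inequality \<open>sform (u k - u l) (v k)\<close> is small for large \<open>k\<close> and \<open>l\<close>. Symmetry
  moves \<open>A\<close> to \<open>v k \<in> D(L)\<close>, so \<open>l\<close> can tend to infinity with \<open>k\<close> fixed; this replaces \<open>u k\<close> by
  \<open>x\<close> in \<open>A (u k)\<close>, and then only norm convergence of \<open>v k\<close> is needed.
\<close>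

lemma form_limit:
  assumes u: "form_cauchy u" "u \<longlonglongrightarrow> x" and x: "x \<in> X" and v: "form_cauchy v" "v \<longlonglongrightarrow> y"
  shows "(\<lambda>k. inner (A (u k)) (v k)) \<longlonglongrightarrow> inner (A x) y"
proof -
  have uD: "u k \<in> D0" and vD: "v k \<in> D0" for k using u(1) v(1) by (simp_all add: form_cauchy_def)
  have ud: "u k - u l \<in> D0" for k l using uD D0_subspace by (simp add: subspace_diff)
  obtain n0 where n0: "\<forall>k\<ge>n0. \<forall>m\<ge>n0. sform (v k - v m) (v k - v m) < 1"
    by (rule form_cauchy_sform[OF v zero_less_one])
  define K where "K = 2 * sform (v n0) (v n0) + 2"
  have K: "0 < K" using S.nonneg[OF vD, of n0] by (simp add: K_def)
  have vK: "sform (v k) (v k) \<le> K" if "k \<ge> n0" for k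
  proof -
    have "v k - v n0 \<in> D0" using vD D0_subspace by (simp add: subspace_diff)
    then have "sform (v k) (v k) \<le> 2 * sform (v k - v n0) (v k - v n0) + 2 * sform (v n0) (v n0)"
      using S.parallelogram_le[of "v k - v n0" "v n0"] vD by simp
    moreover have "sform (v k - v n0) (v k - v n0) < 1" using n0 that by blast
    ultimately show ?thesis by (simp add: K_def)
  qed
  have lim_l: "(\<lambda>l. sform (u k - u l) w) \<longlonglongrightarrow> inner (A (u k)) w - inner (A x) w + (1 - c) * inner (u k - x) w"
    if "w \<in> D0" for k w
  proof -
    have eq: "sform (u k - u l) w = inner (A (u k)) w - inner (u l) (A w) + (1 - c) * inner (u k - u l) w" for l
      using sym_D0[of "u l" w] uD D0_X that by (auto simp: sform_def A_simps inner_diff_left)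
    show ?thesis unfolding eq sym_D0[OF x that] by (intro tendsto_intros u(2))
  qed
  have main: "(\<lambda>k. inner (A (u k)) (v k) - inner (A x) (v k) + (1 - c) * inner (u k - x) (v k)) \<longlonglongrightarrow> 0"
  proof (rule LIMSEQ_I)
    fix e :: real assume e: "0 < e"
    define e' where "e' = (e/2)\<^sup>2 / K"
    have e': "0 < e'" using e K by (simp add: e'_def)
    obtain n where n: "\<forall>k\<ge>n. \<forall>m\<ge>n. sform (u k - u m) (u k - u m) < e'"
      by (rule form_cauchy_sform[OF u e'])
    have "\<bar>inner (A (u k)) (v k) - inner (A x) (v k) + (1 - c) * inner (u k - x) (v k)\<bar> < e"
      if k: "k \<ge> max n n0" for k
    proof -
      have "\<bar>sform (u k - u l) (v k)\<bar> \<le> e / 2" if "l \<ge> n" for l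
      proof -
        have "(sform (u k - u l) (v k))\<^sup>2 \<le> sform (u k - u l) (u k - u l) * sform (v k) (v k)"
          by (rule S.cauchy_schwarz[OF ud vD])
        also have "\<dots> \<le> e' * K"
          using n k that vK[of k] S.nonneg[OF vD, of k] e' by (intro mult_mono) (auto intro: less_imp_le)
        also have "\<dots> = (e/2)\<^sup>2" using K by (simp add: e'_def)
        finally have "\<bar>sform (u k - u l) (v k)\<bar> \<le> \<bar>e / 2\<bar>" by (simp only: abs_le_square_iff)
        then show ?thesis using e by simp
      qed
      then have "\<forall>\<^sub>F l in sequentially. \<bar>sform (u k - u l) (v k)\<bar> \<le> e / 2"
        unfolding eventually_sequentially by blast
      then have "\<bar>inner (A (u k)) (v k) - inner (A x) (v k) + (1 - c) * inner (u k - x) (v k)\<bar> \<le> e / 2"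
        by (rule tendsto_upperbound[OF tendsto_rabs[OF lim_l[OF vD]]]) simp
      then show ?thesis using e by simp
    qed
    then show "\<exists>no. \<forall>k\<ge>no. norm (inner (A (u k)) (v k) - inner (A x) (v k) + (1 - c) * inner (u k - x) (v k) - 0) < e"
      by (intro exI[of _ "max n n0"]) simp
  qed
  have "(\<lambda>k. inner (A x) (v k) - (1 - c) * inner (u k - x) (v k)) \<longlonglongrightarrow> inner (A x) y - (1 - c) * inner (x - x) y"
    by (intro tendsto_intros u(2) v(2))
  from tendsto_add[OF main this] show ?thesis by simp
qed

lemma MF_subspace: "subspace MF"
proof (rule subspaceI)
  show "0 \<in> MF" unfolding MF_def
  proof (intro CollectI conjI exI)
    show "0 \<in> X" by (rule subspace_0[OF X_subspace])
    show "form_cauchy (\<lambda>_. 0)" using subspace_0[OF D0_subspace] by (simp add: form_cauchy_def)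
  qed simp
next
  fix x y assume "x \<in> MF" "y \<in> MF"
  then obtain u v where xy: "x \<in> X" "y \<in> X" and u: "form_cauchy u" "u \<longlonglongrightarrow> x"
    and v: "form_cauchy v" "v \<longlonglongrightarrow> y" unfolding MF_def by blast
  have uD: "u k \<in> D0" and vD: "v k \<in> D0" for k using u(1) v(1) by (simp_all add: form_cauchy_def)
  have "form_cauchy (\<lambda>k. u k + v k)"
  proof (rule form_cauchyI(1))
    show "u k + v k \<in> D0" for k using uD vD D0_subspace by (simp add: subspace_add)
    fix e :: real assume "0 < e"
    then have e: "0 < e / 4" by simp
    obtain n1 where n1: "\<forall>k\<ge>n1. \<forall>m\<ge>n1. sform (u k - u m) (u k - u m) < e / 4"
      by (rule form_cauchy_sform[OF u e])
    obtain n2 where n2: "\<forall>k\<ge>n2. \<forall>m\<ge>n2. sform (v k - v m) (v k - v m) < e / 4"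
      by (rule form_cauchy_sform[OF v e])
    have "sform (u k + v k - (u m + v m)) (u k + v k - (u m + v m)) < e" if "k \<ge> max n1 n2" "m \<ge> max n1 n2" for k m
    proof -
      have eq: "u k + v k - (u m + v m) = (u k - u m) + (v k - v m)" by simp
      have "sform (u k + v k - (u m + v m)) (u k + v k - (u m + v m))
          \<le> 2 * sform (u k - u m) (u k - u m) + 2 * sform (v k - v m) (v k - v m)"
        unfolding eq using uD vD D0_subspace by (intro S.parallelogram_le) (simp_all add: subspace_diff)
      moreover have "sform (u k - u m) (u k - u m) < e / 4" "sform (v k - v m) (v k - v m) < e / 4"
        using n1 n2 that by simp_all
      ultimately show ?thesis by linarith
    qed
    then show "\<exists>n. \<forall>k\<ge>n. \<forall>m\<ge>n. sform (u k + v k - (u m + v m)) (u k + v k - (u m + v m)) < e" by blast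
  qed
  moreover have "(\<lambda>k. u k + v k) \<longlonglongrightarrow> x + y" by (intro tendsto_intros u v)
  moreover have "x + y \<in> X" using xy X_subspace by (simp add: subspace_add)
  ultimately show "x + y \<in> MF" unfolding MF_def by blast
next
  fix r x assume "x \<in> MF"
  then obtain u where x: "x \<in> X" and u: "form_cauchy u" "u \<longlonglongrightarrow> x" unfolding MF_def by blast
  have uD: "u k \<in> D0" for k using u(1) by (simp add: form_cauchy_def)
  have "form_cauchy (\<lambda>k. r *\<^sub>R u k)"
  proof (rule form_cauchyI(1))
    show "r *\<^sub>R u k \<in> D0" for k using uD D0_subspace by (simp add: subspace_scale)
    fix e :: real assume e: "0 < e"
    then have e': "0 < e / (r\<^sup>2 + 1)" by (simp add: add_nonneg_pos)
    obtain n where n: "\<forall>k\<ge>n. \<forall>m\<ge>n. sform (u k - u m) (u k - u m) < e / (r\<^sup>2 + 1)"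
      by (rule form_cauchy_sform[OF u e'])
    have "sform (r *\<^sub>R u k - r *\<^sub>R u m) (r *\<^sub>R u k - r *\<^sub>R u m) < e" if "k \<ge> n" "m \<ge> n" for k m
    proof -
      have d: "u k - u m \<in> D0" using uD D0_subspace by (simp add: subspace_diff)
      have eq: "r *\<^sub>R u k - r *\<^sub>R u m = r *\<^sub>R (u k - u m)" by (simp add: scaleR_diff_right)
      have hom: "sform (r *\<^sub>R w) (r *\<^sub>R w) = r\<^sup>2 * sform w w" for w
        by (simp add: S.simps power2_eq_square)
      have "sform (r *\<^sub>R u k - r *\<^sub>R u m) (r *\<^sub>R u k - r *\<^sub>R u m) = r\<^sup>2 * sform (u k - u m) (u k - u m)"
        unfolding eq hom ..
      also have "\<dots> \<le> (r\<^sup>2 + 1) * sform (u k - u m) (u k - u m)"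
        using S.nonneg[OF d] by (simp add: distrib_right)
      also have "\<dots> < (r\<^sup>2 + 1) * (e / (r\<^sup>2 + 1))"
        using n that by (intro mult_strict_left_mono) (simp_all add: add_nonneg_pos)
      also have "\<dots> = e" using add_nonneg_pos[of "r\<^sup>2" 1] by simp
      finally show ?thesis .
    qed
    then show "\<exists>n. \<forall>k\<ge>n. \<forall>m\<ge>n. sform (r *\<^sub>R u k - r *\<^sub>R u m) (r *\<^sub>R u k - r *\<^sub>R u m) < e" by blast
  qed
  moreover have "(\<lambda>k. r *\<^sub>R u k) \<longlonglongrightarrow> r *\<^sub>R x" by (intro tendsto_intros u)
  moreover have "r *\<^sub>R x \<in> X" using x X_subspace by (simp add: subspace_scale)
  ultimately show "r *\<^sub>R x \<in> MF" unfolding MF_def by blast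
qed

lemma MF_sym: assumes "x \<in> MF" "y \<in> MF" shows "inner (A x) y = inner x (A y)"
proof -
  obtain u v where xy: "x \<in> X" "y \<in> X" and u: "form_cauchy u" "u \<longlonglongrightarrow> x"
    and v: "form_cauchy v" "v \<longlonglongrightarrow> y" using assms unfolding MF_def by blast
  have uD: "u k \<in> D0" and vD: "v k \<in> D0" for k using u(1) v(1) by (simp_all add: form_cauchy_def)
  have "inner (A (v k)) (u k) = inner (A (u k)) (v k)" for k
    using sym_D0[of "v k" "u k"] uD vD D0_X by (auto simp: inner_commute)
  then have "(\<lambda>k. inner (A (u k)) (v k)) \<longlonglongrightarrow> inner (A y) x"
    using form_limit[OF v xy(2) u] by simp
  then have "inner (A x) y = inner (A y) x"
    using form_limit[OF u xy(1) v] LIMSEQ_unique by blast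
  then show ?thesis by (simp add: inner_commute)
qed

text \<open>
  Dirichlet's principle: a minimising sequence of \<open>sform u u - 2 \<langle>w, u\<rangle>\<close> in \<open>D(L)\<close> is form
  Cauchy by the parallelogram identity, and its limit solves the Euler equation weakly, that is,
  in terms of \<open>L\<^sup>*\<close>.
\<close>

lemma MF_surjective: assumes w: "w \<in> H" shows "\<exists>x\<in>MF. A x + (1 - c) *\<^sub>R x = w"
proof -
  define J where "J u = sform u u - 2 * inner w u" for u
  have J0: "- (norm w)\<^sup>2 \<le> J u" if "u \<in> D0" for u
  proof -
    have "0 \<le> (norm (u - w))\<^sup>2" by simp
    also have "\<dots> = (norm u)\<^sup>2 - 2 * inner w u + (norm w)\<^sup>2"
      by (simp add: power2_norm_eq_inner inner_diff_left inner_diff_right inner_commute)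
    finally show ?thesis using sform_ge[OF that] unfolding J_def by linarith
  qed
  define j where "j = (INF u\<in>D0. J u)"
  have ne: "D0 \<noteq> {}" using subspace_0[OF D0_subspace] by blast
  have bdd: "bdd_below (J ` D0)" using J0 by (intro bdd_belowI2)
  have jle: "j \<le> J u" if "u \<in> D0" for u unfolding j_def by (rule cINF_lower[OF bdd that])
  have "\<exists>u. u \<in> D0 \<and> J u < j + 1 / real (Suc k)" for k
  proof -
    have "j < j + 1 / real (Suc k)" by simp
    then show ?thesis unfolding j_def using cINF_less_iff[OF ne bdd] by blast
  qed
  then obtain u where u: "\<And>k. u k \<in> D0" "\<And>k. J (u k) < j + 1 / real (Suc k)" by metis
  have cau: "\<exists>n. \<forall>k\<ge>n. \<forall>m\<ge>n. sform (u k - u m) (u k - u m) < e" if e: "0 < e" for e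
  proof -
    obtain n where n: "4 / e < real n" using reals_Archimedean2 by blast
    have n0: "0 < real n" using n e by (smt (verit) divide_pos_pos)
    have small: "1 / real (Suc k) < e / 4" if "k \<ge> n" for k
    proof -
      have "4 / e < real (Suc k)" using n that by linarith
      then show ?thesis using e by (simp add: field_simps)
    qed
    have "sform (u k - u m) (u k - u m) < e" if "k \<ge> n" "m \<ge> n" for k m
    proof -
      define h where "h = (1/2) *\<^sub>R (u k + u m)"
      have h: "h \<in> D0" unfolding h_def using u D0_subspace by (simp add: subspace_add subspace_scale)
      have "sform (u k - u m) (u k - u m) = 2 * J (u k) + 2 * J (u m) - 4 * J h"
        using S.sym[OF u(1) u(1), of m k] unfolding J_def h_def
        by (simp add: S.simps inner_add_right field_simps)
      also have "\<dots> \<le> 2 * J (u k) + 2 * J (u m) - 4 * j" using jle[OF h] by simp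
      also have "\<dots> < 2 / real (Suc k) + 2 / real (Suc m)" using u(2)[of k] u(2)[of m] by simp
      also have "\<dots> < e" using small[OF that(1)] small[OF that(2)] by simp
      finally show ?thesis .
    qed
    then show ?thesis by blast
  qed
  have fc: "form_cauchy u" by (rule form_cauchyI(1)[OF u(1) cau])
  have "Cauchy u" by (rule form_cauchyI(2)[OF u(1) cau])
  moreover have "u k \<in> H" for k using u(1) D0_X X_H(1) by blast
  ultimately obtain x where x: "x \<in> H" "u \<longlonglongrightarrow> x" using H.complete unfolding complete_def by meson
  have eq: "inner x (A v) + (1 - c) * inner x v = inner w v" if v: "v \<in> D0" for v
  proof -
    define \<beta> where "\<beta> = inner x (A v) + (1 - c) * inner x v - inner w v"
    have b: "(\<lambda>k. sform (u k) v - inner w v) \<longlonglongrightarrow> \<beta>"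
    proof -
      have "sform (u k) v - inner w v = inner (u k) (A v) + (1 - c) * inner (u k) v - inner w v" for k
        using sym_D0[of "u k" v] u(1) D0_X v by (auto simp: sform_def)
      then show ?thesis unfolding \<beta>_def by (simp only:) (intro tendsto_intros x(2))
    qed
    have "0 \<le> 2 * t * \<beta> + t\<^sup>2 * sform v v" for t
    proof -
      have ge: "0 \<le> 2 * t * (sform (u k) v - inner w v) + t\<^sup>2 * sform v v + 1 / real (Suc k)" for k
      proof -
        have "u k + t *\<^sub>R v \<in> D0" using u(1) v D0_subspace by (simp add: subspace_add subspace_scale)
        then have "j \<le> J (u k + t *\<^sub>R v)" by (rule jle)
        also have "\<dots> = J (u k) + 2 * t * (sform (u k) v - inner w v) + t\<^sup>2 * sform v v"
        proof -
          have "sform (u k + t *\<^sub>R v) (u k + t *\<^sub>R v) = sform (u k) (u k) + 2 * (t * sform (u k) v) + t * (t * sform v v)"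
            using S.sym[OF u(1) v, of k] by (simp add: S.simps distrib_left)
          then show ?thesis
            unfolding J_def by (simp add: inner_add_right power2_eq_square right_diff_distrib mult.assoc)
        qed
        finally show ?thesis using u(2)[of k] by linarith
      qed
      have lim: "(\<lambda>k. 2 * t * (sform (u k) v - inner w v) + t\<^sup>2 * sform v v + 1 / real (Suc k))
          \<longlonglongrightarrow> 2 * t * \<beta> + t\<^sup>2 * sform v v + 0"
        using LIMSEQ_inverse_real_of_nat by (intro tendsto_add tendsto_mult tendsto_const b) (simp add: inverse_eq_divide)
      have "0 \<le> 2 * t * \<beta> + t\<^sup>2 * sform v v + 0"
        by (rule LIMSEQ_le_const[OF lim]) (use ge in blast)
      then show ?thesis by simp
    qed
    note t = this
    have "\<beta> = 0"
    proof (rule ccontr)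
      assume n: "\<beta> \<noteq> 0"
      define s where "s = sform v v + 1"
      have s: "0 < s" using S.nonneg[OF v] by (simp add: s_def)
      have "2 * (- \<beta> / s) * \<beta> + (- \<beta> / s)\<^sup>2 * sform v v \<le> 2 * (- \<beta> / s) * \<beta> + (- \<beta> / s)\<^sup>2 * s"
        by (intro add_left_mono mult_left_mono) (simp_all add: s_def)
      also have "\<dots> = - (\<beta>\<^sup>2 / s)" using s by (simp add: power2_eq_square field_simps)
      finally have "0 \<le> - (\<beta>\<^sup>2 / s)" using t[of "- \<beta> / s"] by linarith
      moreover have "0 < \<beta>\<^sup>2 / s" using n s by simp
      ultimately show False by linarith
    qed
    then show ?thesis by (simp add: \<beta>_def)
  qed
  have "(x, w - (1 - c) *\<^sub>R x) \<in> Ladj" unfolding Ladj_iff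
  proof (intro conjI allI impI)
    show "x \<in> H" by (rule x(1))
    show "w - (1 - c) *\<^sub>R x \<in> H" using w x(1) H.subspace by (simp add: subspace_diff subspace_scale)
    fix v z assume "(v, z) \<in> L"
    then have "v \<in> D0" "z = A v" using L_A by blast+
    then show "inner z x = inner v (w - (1 - c) *\<^sub>R x)"
      using eq[of v] by (simp add: inner_diff_right inner_commute)
  qed
  then have "x \<in> X" "A x = w - (1 - c) *\<^sub>R x" using Ladj_A by metis+
  then show ?thesis using fc x(2) unfolding MF_def by (intro bexI[of _ x]) auto
qed

text \<open>
  Friedrichs' theorem: a symmetric operator \<open>B\<close> for which \<open>B + 1 - c\<close> is onto is self-adjoint.
  If \<open>y\<close> is \<open>\<omega>\<close>-orthogonal to \<open>MF\<close>, subtract the \<open>x \<in> MF\<close> with the same image under \<open>A + 1 - c\<close>;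
  the difference is orthogonal to the range of \<open>A + 1 - c\<close> on \<open>MF\<close>, which is everything.
\<close>

lemma lagr_MF: "lagr MF" unfolding lagr_def
proof (intro conjI ballI impI)
  show "subspace MF" by (rule MF_subspace)
  show "D0 \<subseteq> MF"
  proof
    fix x assume x: "x \<in> D0"
    then have "form_cauchy (\<lambda>_. x)" by (simp add: form_cauchy_def)
    moreover have "(\<lambda>_. x) \<longlonglongrightarrow> x" by simp
    ultimately show "x \<in> MF" using x D0_X unfolding MF_def by blast
  qed
  show sub: "MF \<subseteq> X" by (auto simp: MF_def)
  show om: "\<omega> x y = 0" if "x \<in> MF" "y \<in> MF" for x y using MF_sym[OF that] by (simp add: \<omega>_def)
  fix y assume y: "y \<in> X" "\<forall>x\<in>MF. \<omega> y x = 0"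
  have "A y + (1 - c) *\<^sub>R y \<in> H" using X_H[OF y(1)] H.subspace by (simp add: subspace_add subspace_scale)
  then obtain x where x: "x \<in> MF" "A x + (1 - c) *\<^sub>R x = A y + (1 - c) *\<^sub>R y" using MF_surjective by blast
  define z where "z = y - x"
  have zX: "z \<in> X" using y(1) x(1) sub X_subspace by (auto simp: z_def subspace_diff)
  have Az: "A z = - ((1 - c) *\<^sub>R z)"
    using x(2) by (simp add: z_def A_simps algebra_simps)
  obtain x' where x': "x' \<in> MF" "A x' + (1 - c) *\<^sub>R x' = z" using MF_surjective X_H(1)[OF zX] by blast
  have "\<omega> z x' = 0" using y(2) om[OF x(1) x'(1)] x'(1) by (simp add: z_def \<omega>_simps)
  then have "inner z (A x') = inner (A z) x'" by (simp add: \<omega>_def)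
  then have "inner z (A x' + (1 - c) *\<^sub>R x') = 0" by (simp add: Az inner_add_right)
  then have "inner z z = 0" unfolding x'(2) .
  then show "y \<in> MF" using x(1) by (simp add: z_def)
qed

end

section \<open>The index formula for self-adjoint extensions\<close>

lemma positive_index_eq_neg_index:
  assumes V: "subspace V" "fin_dim V" and q: "q 0 = 0"
  shows "enat (positive_index V q) = neg_index (\<lambda>u. - q u) V"
proof -
  define F where "F = {S. subspace S \<and> S \<subseteq> V \<and> (\<forall>u\<in>S. u \<noteq> 0 \<longrightarrow> 0 < q u)}"
  have F: "S \<in> F \<longleftrightarrow> neg_def (\<lambda>u. - q u) S \<and> S \<subseteq> V" for S
    using fin_dim_subset[OF V(2)] by (auto simp: neg_def_def F_def)
  have bound: "dim S \<le> dim V" if "S \<in> F" for S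
    using that by (intro dim_mono_fin[OF V(2,1)]) (simp_all add: F_def)
  have fin: "finite (dim ` F)"
    by (rule finite_subset[of _ "{..dim V}"]) (use bound in auto)
  have "{0} \<in> F" using subspace_0[OF V(1)] by (simp add: F_def)
  then have ne: "dim ` F \<noteq> {}" by blast
  have pi: "positive_index V q = Max (dim ` F)" by (simp add: positive_index_def F_def)
  show ?thesis unfolding pi
  proof (rule antisym)
    obtain S where S: "Max (dim ` F) = dim S" "S \<in> F"
      by (rule imageE[OF Max_in[OF fin ne]])
    have "neg_def (\<lambda>u. - q u) S" "S \<subseteq> V" using S(2) F by blast+
    then show "enat (Max (dim ` F)) \<le> neg_index (\<lambda>u. - q u) V"
      unfolding S(1) by (rule neg_index_upper)
    show "neg_index (\<lambda>u. - q u) V \<le> enat (Max (dim ` F))"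
    proof (rule neg_index_least)
      fix S assume "neg_def (\<lambda>u. - q u) S" "S \<subseteq> V"
      then have "S \<in> F" using F by blast
      then show "enat (dim S) \<le> enat (Max (dim ` F))" using Max_ge[OF fin] by simp
    qed
  qed
qed

lemma image_set_plus_linear: "linear f \<Longrightarrow> f ` (A + B) = f ` A + f ` B"
  by (force simp: set_plus_def linear_add image_iff)

lemma orthogonal_complement_exists:
  fixes V :: "'a::real_inner set"
  assumes V: "subspace V" "fin_dim V" and U: "subspace U" "U \<subseteq> V"
  obtains C where "subspace C" "fin_dim C" "C \<subseteq> V" "C \<inter> U = {0}" "V = C + U"
proof -
  define C where "C = {x\<in>V. \<forall>u\<in>U. inner x u = 0}"
  have sC: "subspace C" using V(1) unfolding C_def by (auto simp: subspace_def inner_add_left)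
  have CV: "C \<subseteq> V" by (auto simp: C_def)
  have int: "C \<inter> U = {0}" using subspace_0[OF sC] subspace_0[OF U(1)] by (auto simp: C_def)
  have bil: "bilinear (\<lambda>x y::'a. inner x y)"
    unfolding bilinear_def by (intro conjI allI linearI) (simp_all add: inner_add_left inner_add_right)
  have "V = C + U"
  proof
    show "V \<subseteq> C + U"
    proof
      fix x assume x: "x \<in> V"
      obtain u where u: "u \<in> U" "\<And>w. w \<in> U \<Longrightarrow> inner (x - u) w = 0"
        using form_projection[OF bil U(1) fin_dim_subset[OF V(2) U(2)], of x] by auto
      then have "x - u \<in> C" using x U(2) V(1) by (auto simp: C_def subspace_diff)
      then have "(x - u) + u \<in> C + U" using u(1) by (rule set_plus_intro)
      then show "x \<in> C + U" by simp
    qed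
    show "C + U \<subseteq> V" using CV U(2) V(1) by (auto simp: set_plus_def subset_iff subspace_add)
  qed
  then show ?thesis using that[OF sC fin_dim_subset[OF V(2) CV] CV int] by blast
qed

locale index_setting = semibounded_fredholm H L c for H L c +
  fixes W :: "'a set"
  assumes W: "complement_in X D0 W"
begin

lemma W_subspace: "subspace W" and W_int: "D0 \<inter> W = {0}" and W_sum: "D0 + W = X"
  using W by (simp_all add: complement_in_def)

lemma W_X: "W \<subseteq> X"
  using set_zero_plus2[OF subspace_0[OF D0_subspace], of W] unfolding W_sum .

lemma proj_along_eqI: assumes "w \<in> W" "x - w \<in> D0" shows "proj_along D0 W x = w"
  unfolding proj_along_def
proof (rule the_equality)
  show "w \<in> W \<and> x - w \<in> D0" using assms by blast
  fix v assume v: "v \<in> W \<and> x - v \<in> D0"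
  have "(x - w) - (x - v) \<in> D0" using assms(2) v subspace_diff[OF D0_subspace, of "x - w" "x - v"] by blast
  then have "v - w \<in> D0" by simp
  moreover have "v - w \<in> W" using v assms(1) W_subspace by (simp add: subspace_diff)
  ultimately have "v - w \<in> {0}" using W_int by blast
  then show "v = w" by simp
qed

lemma proj_along_mem: assumes "x \<in> X" shows "proj_along D0 W x \<in> W" "x - proj_along D0 W x \<in> D0"
proof -
  have "x \<in> D0 + W" using assms W_sum by simp
  then obtain d w where dw: "x = d + w" "d \<in> D0" "w \<in> W" by (rule set_plus_elim)
  then have "proj_along D0 W x = w" by (intro proj_along_eqI) simp_all
  then show "proj_along D0 W x \<in> W" "x - proj_along D0 W x \<in> D0" using dw by simp_all
qed

text \<open>
  The projection to \<open>W\<close> along \<open>D(L)\<close>, extended to a linear map of the whole type.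
\<close>

definition P :: "'a \<Rightarrow> 'a" where
  "P = (SOME g. linear g \<and> (\<forall>x\<in>X. g x = proj_along D0 W x))"

lemma P: "linear P" "x \<in> X \<Longrightarrow> P x = proj_along D0 W x"
proof -
  obtain g where "linear g" "\<forall>x\<in>X. g x = proj_along D0 W x"
  proof (rule linear_extension[OF X_subspace, of "proj_along D0 W"])
    fix x y assume xy: "x \<in> X" "y \<in> X"
    note m = proj_along_mem[OF xy(1)] proj_along_mem[OF xy(2)]
    have "x + y - (proj_along D0 W x + proj_along D0 W y) = (x - proj_along D0 W x) + (y - proj_along D0 W y)"
      by simp
    then show "proj_along D0 W (x + y) = proj_along D0 W x + proj_along D0 W y"
      using m W_subspace D0_subspace by (intro proj_along_eqI) (simp_all only: subspace_add)
  next
    fix k x assume x: "x \<in> X"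
    note m = proj_along_mem[OF x]
    have "k *\<^sub>R x - k *\<^sub>R proj_along D0 W x = k *\<^sub>R (x - proj_along D0 W x)"
      by (simp add: scaleR_diff_right)
    then show "proj_along D0 W (k *\<^sub>R x) = k *\<^sub>R proj_along D0 W x"
      using m W_subspace D0_subspace by (intro proj_along_eqI) (simp_all only: subspace_scale)
  qed
  then have "\<exists>g. linear g \<and> (\<forall>x\<in>X. g x = proj_along D0 W x)" by blast
  then have "linear P \<and> (\<forall>x\<in>X. P x = proj_along D0 W x)" unfolding P_def by (rule someI_ex)
  then show "linear P" "x \<in> X \<Longrightarrow> P x = proj_along D0 W x" by blast+
qed

lemmas P_simps = linear_add[OF P(1)] linear_diff[OF P(1)] linear_scale[OF P(1)] linear_0[OF P(1)]
  linear_neg[OF P(1)]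

lemma P_mem: "x \<in> X \<Longrightarrow> P x \<in> W" "x \<in> X \<Longrightarrow> x - P x \<in> D0"
  using proj_along_mem P(2) by simp_all

lemma P_eqI: "w \<in> W \<Longrightarrow> x - w \<in> D0 \<Longrightarrow> P x = w"
proof -
  assume *: "w \<in> W" "x - w \<in> D0"
  have "(x - w) + w \<in> X" using * D0_X W_X X_subspace by (intro subspace_add) auto
  then show ?thesis using P(2) proj_along_eqI[OF *] by simp
qed

lemma P_W: "w \<in> W \<Longrightarrow> P w = w" by (rule P_eqI) (simp_all add: subspace_0[OF D0_subspace])

lemma P_zero_iff: "x \<in> X \<Longrightarrow> P x = 0 \<longleftrightarrow> x \<in> D0"
  using P_mem(2)[of x] P_eqI[of 0 x] subspace_0[OF W_subspace] by auto

lemma P_mod: assumes "D0 \<subseteq> M" "subspace M" "x \<in> X" shows "P x \<in> M \<longleftrightarrow> x \<in> M"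
proof -
  have d: "x - P x \<in> M" using P_mem(2)[OF assms(3)] assms(1) by blast
  have "x - (x - P x) = P x" "(x - P x) + P x = x" by simp_all
  then show ?thesis using subspace_diff[OF assms(2) _ d, of x] subspace_add[OF assms(2) d, of "P x"] by auto
qed

lemma \<omega>_P: assumes "x \<in> X" "y \<in> X" shows "\<omega> (P x) y = \<omega> x y" "\<omega> x (P y) = \<omega> x y"
proof -
  have "\<omega> (x - P x) y = 0" "\<omega> x (y - P y) = 0" using \<omega>_D0 assms P_mem by blast+
  then show "\<omega> (P x) y = \<omega> x y" "\<omega> x (P y) = \<omega> x y" by (simp_all add: \<omega>_simps)
qed

text \<open>
  If \<open>A u\<close> is orthogonal to \<open>N\<close>, then \<open>A u = A d\<close> for some \<open>d \<in> D(L)\<close>, so \<open>u\<close> is the projection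
  of \<open>u - d \<in> N\<close>. This orthogonality amounts to \<open>dim N\<close> linear conditions on \<open>u\<close>.
\<close>

lemma W_fin_dim: "fin_dim W"
proof -
  obtain BN where BN: "finite BN" "independent BN" "span BN = N" "card BN = dim N"
    by (rule fin_dim_basis[OF N_subspace N_fin_dim])
  have sPN: "subspace (P ` N)" "fin_dim (P ` N)"
    using linear_subspace_image[OF P(1) N_subspace] fin_dim_linear_image[OF P(1) N_fin_dim] .
  show ?thesis
  proof (rule fin_dim_if_bounded[of W "dim (P ` N) + card BN"])
    fix B assume B: "finite B" "independent B" "B \<subseteq> W"
    let ?K = "{u\<in>span B. \<forall>n\<in>BN. inner (A u) n = 0}"
    have sW: "span B \<subseteq> W" by (rule span_minimal[OF B(3) W_subspace])
    have lin: "linear (\<lambda>u. inner (A u) n)" for n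
      by (rule linearI) (simp_all add: A_simps inner_add_left)
    have "dim (span B) \<le> dim ?K + card BN"
      by (rule dim_kernel_functionals[where f = "\<lambda>n u. inner (A u) n", OF subspace_span fin_dim_span[OF B(1)] BN(1) lin])
    moreover have "dim ?K \<le> dim (P ` N)"
    proof (rule dim_mono_fin[OF sPN(2,1)])
      show "subspace ?K" by (auto simp: subspace_def A_simps inner_add_left span_zero span_add span_scale)
      show "?K \<subseteq> P ` N"
      proof
        fix u assume u: "u \<in> ?K"
        then have uW: "u \<in> W" "u \<in> X" using sW W_X by blast+
        have "inner (A u) n = 0" if "n \<in> N" for n
          using that unfolding BN(3)[symmetric]
        proof (induction rule: span_induct_alt)
          case (step k y z)
          then show ?case using u by (simp add: inner_add_right)
        qed simp
        then obtain d where d: "d \<in> D0" "A d = A u" using perp_kernel_in_range X_H(2)[OF uW(2)] by blast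
        have "u - d \<in> N" unfolding N_def using uW d D0_X X_subspace by (auto simp: A_simps subspace_diff)
        moreover have "P (u - d) = u"
        proof (rule P_eqI[OF uW(1)])
          have "(u - d) - u = - d" by simp
          then show "(u - d) - u \<in> D0" using d(1) D0_subspace by (simp only: subspace_neg)
        qed
        ultimately show "u \<in> P ` N" by (metis imageI)
      qed
    qed
    ultimately show "card B \<le> dim (P ` N) + card BN"
      using real_vector.dim_span_eq_card_independent[OF B(2)] by simp
  qed
qed

lemma symmetric_form_lagr: "lagr M \<Longrightarrow> symmetric_form M (\<lambda>x y. inner (A x) y)"
  using lagrD(1,4)[of M] bilinear_inner_linear[OF A(1)]
  by unfold_locales (simp_all add: inner_commute)

text \<open>
  The form of \<open>A - c\<close> is nonnegative on \<open>D(L)\<close>, so a negative definite subspace of \<open>M\<close> projects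
  injectively to the finite-dimensional space \<open>W\<close>. Let \<open>V\<close> be a maximal one and \<open>v\<close> the
  component of \<open>x\<close> in \<open>V\<close>: the form at \<open>x\<close> is at least its value at \<open>v\<close>, which is
  \<open>\<langle>(A - c) v, x\<rangle>\<close>, and \<open>A - c\<close> is bounded on \<open>V\<close> in terms of the form.
\<close>

lemma lagr_bounded_below:
  assumes M: "lagr M" obtains c' where "\<forall>x\<in>M. c' * (norm x)\<^sup>2 \<le> inner (A x) x"
proof -
  note MD = lagrD[OF M]
  define g where "g x = A x - c *\<^sub>R x" for x
  have lin: "linear g" unfolding g_def by (rule linearI) (simp_all add: A_simps algebra_simps)
  define b where "b = (\<lambda>x y. inner (g x) y)"
  interpret symmetric_form M b
  proof
    show "subspace M" by (rule MD(1))
    show "bilinear b" unfolding b_def by (rule bilinear_inner_linear[OF lin])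
    show "b x y = b y x" if "x \<in> M" "y \<in> M" for x y
      using MD(4)[OF that] by (simp add: b_def g_def inner_diff_left inner_diff_right inner_commute)
  qed
  have pos: "0 \<le> b x x" if "x \<in> D0" for x
    using form_D0[OF that] by (simp add: b_def g_def inner_diff_left power2_norm_eq_inner)
  have "neg_index q M \<le> enat (dim W)"
  proof (rule neg_index_least)
    fix V assume V: "neg_def q V" "V \<subseteq> M"
    have "dim (P ` V) = dim V"
    proof (rule dim_linear_image_inj[OF P(1) neg_defD(1,2)[OF V(1)]])
      fix x assume x: "x \<in> V" "P x = 0"
      then have "x \<in> D0" using P_zero_iff V(2) MD(3) by blast
      then have "0 \<le> q x" by (rule pos)
      then show "x = 0" using neg_defD(3)[OF V(1) x(1)] by (cases "x = 0") simp_all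
    qed
    moreover have "dim (P ` V) \<le> dim W"
    proof (rule dim_mono_fin[OF W_fin_dim W_subspace])
      show "subspace (P ` V)" by (rule linear_subspace_image[OF P(1) neg_defD(1)[OF V(1)]])
      show "P ` V \<subseteq> W" using P_mem(1) V(2) MD(3) by blast
    qed
    ultimately show "enat (dim V) \<le> enat (dim W)" by simp
  qed
  then have fin: "neg_index q M \<noteq> \<infinity>" by (cases "neg_index q M") simp_all
  have nd0: "neg_def q {0}" by (auto simp: neg_def_def fin_dim_def intro: exI[of _ "{}"])
  have M0: "{0} \<subseteq> M" using subspace_0[OF MD(1)] by simp
  obtain V where V: "neg_def q V" "{0} \<subseteq> V" "V \<subseteq> M"
      "\<forall>x\<in>M. (\<forall>v\<in>V. b x v = 0) \<longrightarrow> q x \<ge> 0"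
    by (rule neg_def_maximal_extension[OF fin nd0 M0])
  have Vform: "symmetric_form V b" by (rule restrict[OF neg_defD(1)[OF V(1)] V(3)])
  obtain C where C: "0 \<le> C" "\<forall>v\<in>V. (norm (g v))\<^sup>2 \<le> C * (- b v v)"
    by (rule neg_def_bounds_linear_map[OF Vform V(1) lin])
  have def0: "u = 0" if "u \<in> V" "b u u = 0" for u
    using neg_defD(3)[OF V(1) that(1)] that(2) by (cases "u = 0") simp_all
  have "(c - C) * (norm x)\<^sup>2 \<le> inner (A x) x" if x: "x \<in> M" for x
  proof -
    obtain v where v: "v \<in> V" "\<forall>u\<in>V. b (x - v) u = 0"
      using form_projection[OF bilinear neg_defD(1,2)[OF V(1)] def0, of x] by metis
    have vM: "v \<in> M" using v V by blast
    have xv: "x - v \<in> M" using x vM MD(1) by (simp add: subspace_diff)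
    have "q x = q (x - v) + q v"
      using v sym[OF x vM] by (simp add: simps)
    moreover have "0 \<le> q (x - v)" using V(4) xv v(2) by blast
    ultimately have 1: "q v \<le> q x" by simp
    have "q v = b x v" using v by (simp add: simps)
    also have "\<dots> = inner (g v) x" using sym[OF x vM] by (simp add: b_def)
    finally have "- q v \<le> norm x * norm (g v)"
      using norm_cauchy_schwarz[of "g v" "- x"] by (simp add: mult.commute)
    moreover have "0 \<le> - q v" using neg_defD(3)[OF V(1) v(1)] by (cases "v = 0") (simp_all add: simps)
    ultimately have "- q v \<le> C * (norm x)\<^sup>2"
      using C v(1) by (intro le_of_quadratic_bounds[of "- q v" "norm x" "norm (g v)" C]) simp_all
    then have "- C * (norm x)\<^sup>2 \<le> q x" using 1 by simp
    then show ?thesis by (simp add: b_def g_def inner_diff_left power2_norm_eq_inner algebra_simps)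
  qed
  then show ?thesis using that by blast
qed

lemma morse_index_lagr:
  assumes M: "lagr M" shows "morse_index H (op_restrict Ladj M) = neg_index (\<lambda>x. inner (A x) x) M"
proof -
  obtain c' where c': "\<forall>x\<in>M. c' * (norm x)\<^sup>2 \<le> inner (A x) x" by (rule lagr_bounded_below[OF M])
  show ?thesis
    using c' op_restrict_iff[OF lagrD(3)[OF M]]
    by (intro morse_index_eq_neg_index[where c = c', OF H.complete_subspace_axioms selfadjoint_restrict[OF M]]) simp_all
qed

lemma lagr_of_lagrangian:
  assumes \<Lambda>: "lagrangian (boundary_form Ladj) W \<Lambda>" shows "lagr (D0 + \<Lambda>)" "P ` (D0 + \<Lambda>) = \<Lambda>"
proof -
  have s\<Lambda>: "subspace \<Lambda>" and \<Lambda>W: "\<Lambda> \<subseteq> W"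
    using \<Lambda> by (simp_all add: lagrangian_def)
  have mem: "w \<in> \<Lambda> \<longleftrightarrow> w \<in> W \<and> (\<forall>v\<in>\<Lambda>. boundary_form Ladj w v = 0)" for w
    using \<Lambda> unfolding lagrangian_def by blast
  have bf: "boundary_form Ladj w v = \<omega> w v" if "w \<in> W" "v \<in> \<Lambda>" for w v
    using that W_X \<Lambda>W by (intro boundary_form_\<omega>) auto
  have PM: "P x \<in> \<Lambda>" if x: "x \<in> D0 + \<Lambda>" for x
  proof -
    obtain d v where dv: "d \<in> D0" "v \<in> \<Lambda>" "x = d + v" using x by (auto simp: set_plus_def)
    then have "P x = v" using \<Lambda>W by (intro P_eqI) auto
    then show ?thesis using dv by simp
  qed
  have MX: "D0 + \<Lambda> \<subseteq> X" using set_plus_mono2[OF order_refl \<Lambda>W, of D0] W_sum by simp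
  have \<Lambda>M: "\<Lambda> \<subseteq> D0 + \<Lambda>" using set_zero_plus2[of D0 \<Lambda>] subspace_0[OF D0_subspace] by simp
  show "P ` (D0 + \<Lambda>) = \<Lambda>"
  proof
    show "P ` (D0 + \<Lambda>) \<subseteq> \<Lambda>" using PM by blast
    show "\<Lambda> \<subseteq> P ` (D0 + \<Lambda>)"
    proof
      fix v assume v: "v \<in> \<Lambda>"
      then have "v = P v" "v \<in> D0 + \<Lambda>" using P_W \<Lambda>W \<Lambda>M by auto
      then show "v \<in> P ` (D0 + \<Lambda>)" by (rule image_eqI)
    qed
  qed
  show "lagr (D0 + \<Lambda>)" unfolding lagr_def
  proof (intro conjI ballI impI)
    show "subspace (D0 + \<Lambda>)" by (rule subspace_set_plus[OF D0_subspace s\<Lambda>])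
    show "D0 \<subseteq> D0 + \<Lambda>" using set_zero_plus2[of \<Lambda> D0] subspace_0[OF s\<Lambda>] by (simp add: add.commute)
    show "D0 + \<Lambda> \<subseteq> X" by (rule MX)
    fix x y assume xy: "x \<in> D0 + \<Lambda>" "y \<in> D0 + \<Lambda>"
    have xyX: "x \<in> X" "y \<in> X" using xy MX by blast+
    have Pxy: "P x \<in> \<Lambda>" "P y \<in> \<Lambda>" using PM xy by blast+
    have PxW: "P x \<in> W" "P x \<in> X" using Pxy(1) \<Lambda>W W_X by blast+
    have "\<omega> x y = \<omega> (P x) y" by (rule \<omega>_P(1)[OF xyX, symmetric])
    also have "\<dots> = \<omega> (P x) (P y)" by (rule \<omega>_P(2)[OF PxW(2) xyX(2), symmetric])
    also have "\<dots> = boundary_form Ladj (P x) (P y)" by (rule bf[OF PxW(1) Pxy(2), symmetric])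
    also have "\<dots> = 0" using mem[of "P x"] Pxy by blast
    finally show "\<omega> x y = 0" .
  next
    fix x assume x: "x \<in> X" "\<forall>y\<in>D0 + \<Lambda>. \<omega> x y = 0"
    have "boundary_form Ladj (P x) v = 0" if v: "v \<in> \<Lambda>" for v
    proof -
      have vX: "v \<in> X" using v \<Lambda>W W_X by blast
      have "boundary_form Ladj (P x) v = \<omega> (P x) v" using bf P_mem(1)[OF x(1)] v by blast
      also have "\<dots> = \<omega> x v" by (rule \<omega>_P(1)[OF x(1) vX])
      also have "\<dots> = 0" using x(2) v \<Lambda>M by blast
      finally show ?thesis .
    qed
    then have "P x \<in> \<Lambda>" using mem P_mem(1)[OF x(1)] by blast
    then have "(x - P x) + P x \<in> D0 + \<Lambda>" using P_mem(2)[OF x(1)] by (rule_tac set_plus_intro)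
    then show "x \<in> D0 + \<Lambda>" by simp
  qed
qed

text \<open>
  The range of a self-adjoint operator with closed range is the orthogonal complement of its
  kernel. Up to the range of \<open>L\<close>, only the finite-dimensional space \<open>N\<close> matters: an element of
  \<open>N\<close> that is orthogonal to the part \<open>F\<close> of the range in \<open>N\<close> is \<open>\<omega>\<close>-orthogonal to \<open>M\<close>, hence
  belongs to the kernel \<open>N \<inter> M\<close>.
\<close>

lemma lagr_range:
  assumes M: "lagr M" and h: "h \<in> H" "\<And>n. n \<in> N \<Longrightarrow> n \<in> M \<Longrightarrow> inner h n = 0"
  shows "\<exists>y\<in>M. A y = h"
proof -
  note MD = lagrD[OF M]
  have cN: "complete_subspace N"
    by (rule complete_subspace_fin_dim[OF N_subspace N_fin_dim H.complete_subspace_axioms]) (auto simp: N_def X_H)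
  interpret CN: complete_subspace N by (rule cN)
  define F where "F = N \<inter> A ` M"
  have sF: "subspace F" unfolding F_def
    using N_subspace linear_subspace_image[OF A(1) MD(1)] by (simp add: subspace_inter)
  have cF: "complete_subspace F"
    by (rule complete_subspace_fin_dim[OF sF fin_dim_subset[OF N_fin_dim] H.complete_subspace_axioms])
       (auto simp: F_def N_def X_H)
  interpret CF: complete_subspace F by (rule cF)
  define n where "n = proj N h"
  have nN: "n \<in> N" unfolding n_def by (rule CN.proj(1))
  have nH: "n \<in> H" using nN X_H(1) unfolding N_def by blast
  obtain d where d: "d \<in> D0" "A d = h - n"
    using perp_kernel_in_range[of "h - n"] CN.proj(2)[of _ h] h(1) nH H.subspace unfolding n_def
    by (auto simp: subspace_diff)
  define g where "g = n - proj F n"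
  have gN: "g \<in> N" unfolding g_def using nN CF.proj(1)[of n] N_subspace by (auto simp: F_def subspace_diff)
  have gX: "g \<in> X" "A g = 0" using gN by (simp_all add: N_def)
  have gF: "inner g f = 0" if "f \<in> F" for f using CF.proj(2)[OF that] by (simp add: g_def)
  have "\<omega> g y = 0" if y: "y \<in> M" for y
  proof -
    have yX: "y \<in> X" using y MD(3) by blast
    define k where "k = proj N (A y)"
    have kN: "k \<in> N" unfolding k_def by (rule CN.proj(1))
    have kH: "k \<in> H" using kN X_H(1) unfolding N_def by blast
    have perp: "inner (A y - k) n' = 0" if "n' \<in> N" for n' unfolding k_def by (rule CN.proj(2)[OF that])
    obtain e where e: "e \<in> D0" "A e = A y - k"
      using perp_kernel_in_range[of "A y - k"] perp kH X_H(2)[OF yX] H.subspace by (auto simp: subspace_diff)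
    have "y - e \<in> M" using y e(1) MD(1,2) by (auto simp: subspace_diff)
    moreover have "A (y - e) = k" using e(2) by (simp add: A_simps)
    ultimately have "k \<in> F" using kN unfolding F_def by blast
    then have "inner g k = 0" by (rule gF)
    moreover have "inner (A y - k) g = 0" by (rule perp[OF gN])
    ultimately show ?thesis using gX(2) by (simp add: \<omega>_def inner_diff_left inner_diff_right inner_commute)
  qed
  then have "g \<in> M" using MD(5)[OF gX(1)] by blast
  then have "inner h g = 0" using h(2) gN by blast
  moreover have "inner (h - n) g = 0" unfolding n_def by (rule CN.proj(2)[OF gN])
  moreover have "inner g (proj F n) = 0" by (rule gF[OF CF.proj(1)])
  ultimately have "inner g g = 0" by (simp add: g_def inner_diff_left inner_diff_right inner_commute)
  then have "n \<in> F" using CF.proj(1)[of n] by (simp add: g_def)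
  then obtain y where y: "y \<in> M" "A y = n" unfolding F_def by blast
  have "d + y \<in> M" using d(1) y(1) MD(1,2) by (auto simp: subspace_add)
  moreover have "A (d + y) = h" using d(2) y(2) by (simp add: A_simps)
  ultimately show ?thesis by blast
qed

text \<open>
  The form that extends \<open>\<langle>Ax, x\<rangle>\<close> to \<open>M + MF\<close>, pulled back to \<open>M \<times> MF\<close> along the addition
  \<open>(x, y) \<mapsto> x + y\<close>. Working with pairs avoids the question whether the values depend on the
  decomposition of a vector.
\<close>

definition sum_form :: "'a \<times> 'a \<Rightarrow> 'a \<times> 'a \<Rightarrow> real" where
  "sum_form z z' = inner (A (fst z)) (fst z') + inner (A (fst z)) (snd z')
    + inner (snd z) (A (fst z')) + inner (A (snd z)) (snd z')"

lemma symmetric_form_sum_form: assumes M: "lagr M" shows "symmetric_form (M \<times> MF) sum_form"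
proof
  show "subspace (M \<times> MF)" using lagrD(1)[OF M] MF_subspace by (rule subspace_Times)
  show "bilinear sum_form" unfolding bilinear_def sum_form_def
    by (intro conjI allI linearI) (simp_all add: A_simps inner_add_left inner_add_right algebra_simps)
  show "sum_form z z' = sum_form z' z" if z: "z \<in> M \<times> MF" "z' \<in> M \<times> MF" for z z'
  proof -
    have "inner (A (fst z)) (fst z') = inner (A (fst z')) (fst z)"
      using lagrD(4)[OF M, of "fst z" "fst z'"] z by (auto simp: inner_commute)
    moreover have "inner (A (snd z)) (snd z') = inner (A (snd z')) (snd z)"
      using MF_sym[of "snd z" "snd z'"] z by (auto simp: inner_commute)
    ultimately show ?thesis unfolding sum_form_def by (simp add: inner_commute)
  qed
qed

text \<open>
  Let \<open>V\<close> be a maximal negative definite subspace of \<open>M\<close>; it remains maximal in the larger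
  space. Indeed, if \<open>(x, y)\<close> is orthogonal to \<open>V\<close>, approximate \<open>y\<close> by \<open>u k \<in> D(L)\<close>. Then
  \<open>w k = x + u k \<in> M\<close> is almost orthogonal to \<open>V\<close>, its component in \<open>V\<close> has a form value of
  order \<open>\<parallel>y - u k\<parallel>\<^sup>2\<close>, and its own form value tends to the one of \<open>(x, y)\<close>.
\<close>

lemma neg_index_sum_form:
  assumes M: "lagr M"
  shows "neg_index (\<lambda>z. sum_form z z) (M \<times> MF) = neg_index (\<lambda>x. inner (A x) x) M"
proof -
  note MD = lagrD[OF M]
  interpret Y: symmetric_form "M \<times> MF" sum_form by (rule symmetric_form_sum_form[OF M])
  interpret M: symmetric_form M "\<lambda>x y. inner (A x) y" by (rule symmetric_form_lagr[OF M])
  have linj: "linear (\<lambda>v::'a. (v, 0::'a))" by (rule linearI) simp_all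
  have qj: "sum_form (v, 0) (v, 0) = inner (A v) v" for v by (simp add: sum_form_def A_simps)
  show ?thesis
  proof (rule antisym)
    show "neg_index (\<lambda>x. inner (A x) x) M \<le> neg_index (\<lambda>z. sum_form z z) (M \<times> MF)"
    proof (rule neg_index_le_of_relation[of "range (\<lambda>v::'a. (v, (v, 0::'a)))"])
      have "linear (\<lambda>v::'a. (v, (v, 0::'a)))" by (rule linearI) simp_all
      then show "subspace (range (\<lambda>v::'a. (v, (v, 0::'a))))" by (intro linear_subspace_image) simp_all
      show "\<exists>y\<in>M \<times> MF. (x, y) \<in> range (\<lambda>v. (v, v, 0))" if "x \<in> M" for x
        using that subspace_0[OF MF_subspace] by (intro bexI[of _ "(x, 0)"]) auto
      show "sum_form y y = inner (A x) x" if "(x, y) \<in> range (\<lambda>v. (v, v, 0))" for x y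
        using that qj by auto
      show "subspace (M \<times> MF)" by (rule Y.subspace)
    qed (simp add: A_simps)
    show "neg_index (\<lambda>z. sum_form z z) (M \<times> MF) \<le> neg_index (\<lambda>x. inner (A x) x) M"
    proof (cases "neg_index (\<lambda>x. inner (A x) x) M = \<infinity>")
      case False
      have nd0: "neg_def (\<lambda>x. inner (A x) x) {0}"
        by (auto simp: neg_def_def fin_dim_def intro: exI[of _ "{}"])
      have M0: "{0} \<subseteq> M" using subspace_0[OF MD(1)] by simp
      obtain V where V: "neg_def (\<lambda>x. inner (A x) x) V" "{0} \<subseteq> V" "V \<subseteq> M"
          "\<forall>x\<in>M. (\<forall>v\<in>V. inner (A x) v = 0) \<longrightarrow> inner (A x) x \<ge> 0"
        by (rule M.neg_def_maximal_extension[OF False nd0 M0])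
      have Vform: "symmetric_form V (\<lambda>x y. inner (A x) y)"
        by (rule M.restrict[OF neg_defD(1)[OF V(1)] V(3)])
      obtain C where C: "0 \<le> C" "\<forall>v\<in>V. (norm (A v))\<^sup>2 \<le> C * (- inner (A v) v)"
        by (rule neg_def_bounds_linear_map[OF Vform V(1) A(1)])
      have def0: "u = 0" if "u \<in> V" "inner (A u) u = 0" for u
        using neg_defD(3)[OF V(1) that(1)] that(2) by (cases "u = 0") simp_all
      let ?V = "(\<lambda>v. (v, 0::'a)) ` V"
      have "neg_def (\<lambda>z. sum_form z z) ?V" unfolding neg_def_def
      proof (intro conjI ballI impI)
        show "subspace ?V" by (rule linear_subspace_image[OF linj neg_defD(1)[OF V(1)]])
        show "fin_dim ?V" by (rule fin_dim_linear_image[OF linj neg_defD(2)[OF V(1)]])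
        fix z assume "z \<in> ?V" "z \<noteq> 0"
        then obtain v where "v \<in> V" "z = (v, 0)" "v \<noteq> 0" by (auto simp: zero_prod_def)
        then show "sum_form z z < 0" using neg_defD(3)[OF V(1)] qj by simp
      qed
      moreover have "?V \<subseteq> M \<times> MF" using V(3) subspace_0[OF MF_subspace] by auto
      moreover have "0 \<le> sum_form z z" if z: "z \<in> M \<times> MF" and perp: "\<forall>v\<in>?V. sum_form z v = 0" for z
      proof -
        obtain x y where xy: "z = (x, y)" "x \<in> M" "y \<in> MF" using z by blast
        have xX: "x \<in> X" using xy(2) MD(3) by blast
        have perp': "inner x (A v) + inner y (A v) = 0" if v: "v \<in> V" for v
        proof -
          have "sum_form (x, y) (v, 0) = 0" using perp v xy(1) by blast
          moreover have "inner (A x) v = inner x (A v)" using MD(4)[OF xy(2), of v] v V(3) by blast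
          ultimately show ?thesis by (simp add: sum_form_def)
        qed
        obtain u where yX: "y \<in> X" and u: "form_cauchy u" "u \<longlonglongrightarrow> y"
          using xy(3) unfolding MF_def by blast
        have uD: "u k \<in> D0" for k using u(1) by (simp add: form_cauchy_def)
        define w where "w k = x + u k" for k
        have wM: "w k \<in> M" for k
          unfolding w_def using subspace_add[OF MD(1) xy(2)] subsetD[OF MD(2) uD] by blast
        have qw: "inner (A (w k)) (w k) = inner (A x) x + inner (A x) (u k) + inner (u k) (A x) + inner (A (u k)) (u k)" for k
          using sym_D0[OF xX uD, of k] by (simp add: w_def A_simps inner_add_left inner_add_right inner_commute)
        have "(\<lambda>k. inner (A (w k)) (w k)) \<longlonglongrightarrow> inner (A x) x + inner (A x) y + inner y (A x) + inner (A y) y"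
          unfolding qw by (intro tendsto_intros u(2) form_limit[OF u yX u])
        then have lim: "(\<lambda>k. inner (A (w k)) (w k)) \<longlonglongrightarrow> sum_form z z" by (simp add: sum_form_def xy(1))
        have low: "- C * (norm (y - u k))\<^sup>2 \<le> inner (A (w k)) (w k)" for k
        proof -
          obtain r where r: "r \<in> V" "\<forall>v\<in>V. inner (A (w k - r)) v = 0"
            using form_projection[OF M.bilinear neg_defD(1,2)[OF V(1)] def0, of "w k"] by metis
          have rM: "r \<in> M" using r(1) V(3) by blast
          have "w k - r \<in> M" using wM rM MD(1) by (simp add: subspace_diff)
          then have ge: "0 \<le> inner (A (w k - r)) (w k - r)" using V(4) r(2) by blast
          have Ar: "inner (A (w k)) r = inner (A r) r" using r by (simp add: A_simps inner_diff_left)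
          have "inner (A r) (w k) = inner (A (w k)) r"
            using MD(4)[OF rM wM, of k] by (simp add: inner_commute)
          then have "inner (A (w k - r)) (w k - r) = inner (A (w k)) (w k) - inner (A r) r"
            using Ar by (simp add: A_simps inner_diff_left inner_diff_right)
          then have 1: "inner (A r) r \<le> inner (A (w k)) (w k)" using ge by simp
          have "inner (A r) r = inner x (A r) + inner (u k) (A r)"
            using MD(4)[OF wM rM, of k] Ar by (simp add: w_def inner_add_left)
          then have "- inner (A r) r = inner (y - u k) (A r)"
            using perp'[OF r(1)] by (simp add: inner_diff_left)
          then have "- inner (A r) r \<le> norm (y - u k) * norm (A r)"
            using norm_cauchy_schwarz[of "y - u k" "A r"] by simp
          moreover have "0 \<le> - inner (A r) r"
            using neg_defD(3)[OF V(1) r(1)] by (cases "r = 0") simp_all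
          ultimately have "- inner (A r) r \<le> C * (norm (y - u k))\<^sup>2"
            using C r(1) by (intro le_of_quadratic_bounds[of _ _ "norm (A r)"]) simp_all
          then show ?thesis using 1 by simp
        qed
        have "(\<lambda>k. - C * (norm (y - u k))\<^sup>2) \<longlonglongrightarrow> - C * (norm (y - y))\<^sup>2"
          by (intro tendsto_intros u(2))
        then have "- C * (norm (y - y))\<^sup>2 \<le> sum_form z z"
          by (rule LIMSEQ_le[OF _ lim]) (use low in blast)
        then show ?thesis by simp
      qed
      ultimately have "neg_index (\<lambda>z. sum_form z z) (M \<times> MF) = enat (dim ?V)"
        by (intro Y.neg_index_eq_dim) blast+
      also have "dim ?V = dim V"
        by (rule dim_linear_image_inj[OF linj neg_defD(1,2)[OF V(1)]]) (simp add: zero_prod_def)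
      also have "enat (dim V) \<le> neg_index (\<lambda>x. inner (A x) x) M" by (rule neg_index_upper[OF V(1,3)])
      finally show ?thesis .
    qed simp
  qed
qed

text \<open>
  The pairs with sum in the kernel of \<open>L\<^sup>*\<close>; they form the orthogonal complement of \<open>{0} \<times> MF\<close>.
\<close>

definition kernel_pairs :: "'a set \<Rightarrow> ('a \<times> 'a) set" where
  "kernel_pairs M = {z \<in> M \<times> MF. A (fst z) + A (snd z) = 0}"

text \<open>
  The algebraic formula for \<open>Z = {0} \<times> MF\<close>, whose orthogonal complement is \<open>kernel_pairs M\<close> as
  \<open>D(L)\<close> is dense. An element \<open>s\<close> of \<open>N \<inter> MF\<close> is orthogonal to \<open>M\<close> if and only if \<open>\<omega>(s, x) = 0\<close>
  on \<open>M\<close>, that is, \<open>s \<in> M\<close>. If \<open>(x, y)\<close> is orthogonal to \<open>{0} \<times> R\<close>, then \<open>A x\<close> is orthogonal to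
  \<open>N \<inter> MF\<close>, so \<open>A x = A y'\<close> with \<open>y' \<in> MF\<close>, and \<open>(x, y) = (0, y + y') + (x, - y')\<close>.
\<close>

lemma index_decomposition:
  assumes M: "lagr M"
    and R: "subspace R" "fin_dim R" "R \<subseteq> N \<inter> MF" "R \<inter> (N \<inter> MF \<inter> M) = {0}"
      "N \<inter> MF = R + (N \<inter> MF \<inter> M)"
  shows "neg_index (\<lambda>x. inner (A x) x) M =
    neg_index (\<lambda>x. inner (A x) x) MF + neg_index (\<lambda>z. sum_form z z) (kernel_pairs M) + enat (dim R)"
proof -
  note MD = lagrD[OF M] and FD = lagrD[OF lagr_MF]
  interpret Y: symmetric_form "M \<times> MF" sum_form by (rule symmetric_form_sum_form[OF M])
  have lini: "linear (\<lambda>v::'a. (0::'a, v))" by (rule linearI) simp_all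
  define Z where "Z = (\<lambda>v. (0::'a, v)) ` MF"
  have Zsub: "subspace Z" unfolding Z_def by (rule linear_subspace_image[OF lini MF_subspace])
  have ZY: "Z \<subseteq> M \<times> MF" using subspace_0[OF MD(1)] by (auto simp: Z_def)
  have sum_formZ: "sum_form (x, y) (0, v) = inner (A x + A y) v" for x y v
    by (simp add: sum_form_def A_simps inner_add_left)
  have Zperp: "{z \<in> M \<times> MF. \<forall>v\<in>Z. sum_form z v = 0} = kernel_pairs M"
  proof (intro equalityI subsetI)
    fix z assume z: "z \<in> {z \<in> M \<times> MF. \<forall>v\<in>Z. sum_form z v = 0}"
    then obtain x y where xy: "z = (x, y)" "x \<in> M" "y \<in> MF" by blast
    have "A x + A y = 0"
    proof (rule D0_dense)
      show "A x + A y \<in> H" using X_H(2) xy MD(3) FD(3) H.subspace by (auto intro!: subspace_add)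
      fix v assume "v \<in> D0"
      then have "(0, v) \<in> Z" using FD(2) by (auto simp: Z_def)
      then have "sum_form (x, y) (0, v) = 0" using z xy(1) by blast
      then show "inner v (A x + A y) = 0" unfolding sum_formZ by (simp add: inner_commute)
    qed
    then show "z \<in> kernel_pairs M" using xy by (simp add: kernel_pairs_def)
  next
    fix z assume "z \<in> kernel_pairs M"
    then obtain x y where xy: "z = (x, y)" "x \<in> M" "y \<in> MF" "A x + A y = 0" by (auto simp: kernel_pairs_def)
    then show "z \<in> {z \<in> M \<times> MF. \<forall>v\<in>Z. sum_form z v = 0}"
      using sum_formZ[of x y] by (auto simp: Z_def)
  qed
  define R' where "R' = (\<lambda>v. (0::'a, v)) ` R"
  have "neg_index (\<lambda>z. sum_form z z) (M \<times> MF) = neg_index (\<lambda>z. sum_form z z) Z + neg_index (\<lambda>z. sum_form z z) (kernel_pairs M) + enat (dim R')"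
    unfolding Zperp[symmetric]
  proof (rule Y.neg_index_formula[OF Zsub ZY])
    show "subspace R'" unfolding R'_def by (rule linear_subspace_image[OF lini R(1)])
    show "fin_dim R'" unfolding R'_def by (rule fin_dim_linear_image[OF lini R(2)])
    show "R' \<subseteq> Z \<inter> {z \<in> M \<times> MF. \<forall>v\<in>Z. sum_form z v = 0}"
    proof -
      have "(0, r) \<in> kernel_pairs M" if "r \<in> R" for r
        using that R(3) subspace_0[OF MD(1)] by (auto simp: kernel_pairs_def N_def A_simps)
      then show ?thesis unfolding Zperp R'_def using R(3) by (auto simp: Z_def)
    qed
  next
    fix r assume r: "r \<in> R'" and zero: "\<And>x. x \<in> M \<times> MF \<Longrightarrow> sum_form r x = 0"
    then obtain s where s: "s \<in> R" "r = (0, s)" by (auto simp: R'_def)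
    then have sN: "s \<in> X" "A s = 0" "s \<in> N" "s \<in> MF" using R(3) by (auto simp: N_def)
    have "\<omega> s x = 0" if x: "x \<in> M" for x
    proof -
      have "sum_form r (x, 0) = 0" using zero x subspace_0[OF MF_subspace] by blast
      then show ?thesis using s(2) sN(2) by (simp add: sum_form_def \<omega>_def A_simps)
    qed
    then have "s \<in> M" using MD(5)[OF sN(1)] by blast
    then have "s \<in> R \<inter> (N \<inter> MF \<inter> M)" using s(1) sN by blast
    then have "s = 0" using R(4) by blast
    then show "r = 0" using s(2) by (simp add: zero_prod_def)
  next
    fix z assume z: "z \<in> M \<times> MF" and perp: "\<And>r. r \<in> R' \<Longrightarrow> sum_form z r = 0"
    obtain x y where xy: "z = (x, y)" "x \<in> M" "y \<in> MF" using z by blast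
    have xX: "x \<in> X" and yX: "y \<in> X" using xy MD(3) FD(3) by blast+
    have "inner (A x) n = 0" if n: "n \<in> N" "n \<in> MF" for n
    proof -
      have "n \<in> R + (N \<inter> MF \<inter> M)" using n R(5) by blast
      then obtain r m where rm: "n = r + m" "r \<in> R" "m \<in> N \<inter> MF \<inter> M" by (rule set_plus_elim)
      have "(0, r) \<in> R'" using rm(2) by (auto simp: R'_def)
      then have "inner (A x + A y) r = 0" using perp xy(1) sum_formZ by metis
      moreover have "inner (A y) r = 0"
      proof -
        have "r \<in> MF" "A r = 0" using rm(2) R(3) unfolding N_def by blast+
        then show ?thesis using MF_sym[OF xy(3)] by simp
      qed
      moreover have "inner (A x) m = 0" using MD(4)[OF xy(2), of m] rm(3) by (auto simp: N_def)
      ultimately show ?thesis unfolding rm(1) by (simp add: inner_add_left inner_add_right)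
    qed
    then obtain y' where y': "y' \<in> MF" "A y' = A x"
      using lagr_range[OF lagr_MF X_H(2)[OF xX]] by blast
    have "(0, y + y') \<in> Z" using xy(3) y'(1) MF_subspace by (auto simp: Z_def subspace_add)
    moreover have "(x, - y') \<in> kernel_pairs M"
      using xy(2) y' MF_subspace by (simp add: kernel_pairs_def A_simps subspace_neg)
    ultimately have "(0, y + y') + (x, - y') \<in> Z + kernel_pairs M" by (rule set_plus_intro)
    then show "z \<in> Z + {z \<in> M \<times> MF. \<forall>v\<in>Z. sum_form z v = 0}" unfolding Zperp xy(1) by simp
  qed
  moreover have "dim R' = dim R"
    unfolding R'_def by (rule dim_linear_image_inj[OF lini R(1,2)]) (simp add: zero_prod_def)
  moreover have "neg_index (\<lambda>z. sum_form z z) Z = neg_index (\<lambda>x. inner (A x) x) MF"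
  proof (rule antisym)
    have qi: "sum_form (0, v) (0, v) = inner (A v) v" for v by (simp add: sum_form_def A_simps)
    have l1: "linear (\<lambda>v::'a. ((0::'a, v), v))" and l2: "linear (\<lambda>v::'a. (v, (0::'a, v)))"
      by (rule linearI; simp)+
    show "neg_index (\<lambda>z. sum_form z z) Z \<le> neg_index (\<lambda>x. inner (A x) x) MF"
    proof (rule neg_index_le_of_relation[of "range (\<lambda>v::'a. ((0::'a, v), v))"])
      show "subspace (range (\<lambda>v::'a. ((0::'a, v), v)))" using l1 by (intro linear_subspace_image) simp_all
      show "\<exists>y\<in>MF. (x, y) \<in> range (\<lambda>v. ((0, v), v))" if "x \<in> Z" for x
        using that by (auto simp: Z_def)
      show "inner (A y) y = sum_form x x" if "(x, y) \<in> range (\<lambda>v. ((0, v), v))" for x y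
        using that qi by auto
    qed (simp_all add: MF_subspace sum_form_def A_simps)
    show "neg_index (\<lambda>x. inner (A x) x) MF \<le> neg_index (\<lambda>z. sum_form z z) Z"
    proof (rule neg_index_le_of_relation[of "range (\<lambda>v::'a. (v, (0::'a, v)))"])
      show "subspace (range (\<lambda>v::'a. (v, (0::'a, v))))" using l2 by (intro linear_subspace_image) simp_all
      show "\<exists>y\<in>Z. (x, y) \<in> range (\<lambda>v. (v, (0, v)))" if "x \<in> MF" for x
        using that by (auto simp: Z_def)
      show "sum_form y y = inner (A x) x" if "(x, y) \<in> range (\<lambda>v. (v, (0, v)))" for x y
        using that qi by auto
    qed (simp_all add: Zsub A_simps)
  qed
  ultimately show ?thesis using neg_index_sum_form[OF M] by simp
qed

text \<open>
  For \<open>(x, y)\<close> in \<open>kernel_pairs M\<close> put \<open>u = P (x + y)\<close>. Then \<open>v = - P x\<close> is admissible in the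
  definition of the triple form, and \<open>\<omega>(u, v) = - \<omega>(x + y, x)\<close>, which is minus the form of the
  pair because \<open>A y = - A x\<close>. The map \<open>(x, y) \<mapsto> u\<close> is onto \<open>\<alpha> \<inter> (\<Lambda> + \<gamma>)\<close>, so the positive index
  of the triple form is the negative index on pairs; and \<open>P\<close> is injective on \<open>R\<close>, since \<open>R\<close>
  meets \<open>M\<close> only in \<open>0\<close>.
\<close>

lemma triple_index_eq:
  assumes \<Lambda>: "lagrangian (boundary_form Ladj) W \<Lambda>"
  defines "M \<equiv> D0 + \<Lambda>"
  obtains R where "subspace R" "fin_dim R" "R \<subseteq> N \<inter> MF" "R \<inter> (N \<inter> MF \<inter> M) = {0}"
    "N \<inter> MF = R + (N \<inter> MF \<inter> M)"
    "enat (triple_index (boundary_form Ladj) (P ` N) \<Lambda> (P ` MF)) = neg_index (\<lambda>z. sum_form z z) (kernel_pairs M) + enat (dim R)"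
proof -
  have M: "lagr M" and PM: "P ` M = \<Lambda>" unfolding M_def by (rule lagr_of_lagrangian[OF \<Lambda>])+
  note MD = lagrD[OF M] and FD = lagrD[OF lagr_MF]
  have s\<Lambda>: "subspace \<Lambda>" and \<Lambda>W: "\<Lambda> \<subseteq> W" using \<Lambda> by (simp_all add: lagrangian_def)
  have NX: "N \<subseteq> X" by (auto simp: N_def)
  have \<Lambda>M: "\<Lambda> \<subseteq> M"
    unfolding M_def using set_zero_plus2[OF subspace_0[OF D0_subspace], of \<Lambda>] .
  define \<Gamma> where "\<Gamma> = P ` MF"
  have s\<Gamma>: "subspace \<Gamma>" unfolding \<Gamma>_def by (rule linear_subspace_image[OF P(1) MF_subspace])
  have P\<Gamma>: "P x \<in> \<Gamma> \<longleftrightarrow> x \<in> MF" if x: "x \<in> X" for x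
  proof
    assume "P x \<in> \<Gamma>"
    then obtain y where y: "y \<in> MF" "P x = P y" by (auto simp: \<Gamma>_def)
    then have "P y \<in> MF" using P_mod[OF FD(2,1)] FD(3) by blast
    then show "x \<in> MF" using P_mod[OF FD(2,1) x] y(2) by simp
  qed (auto simp: \<Gamma>_def)
  have P\<Lambda>: "P x \<in> \<Lambda> \<longleftrightarrow> x \<in> M" if x: "x \<in> X" for x
  proof
    assume "P x \<in> \<Lambda>"
    then have "P x \<in> M" using \<Lambda>M by blast
    then show "x \<in> M" using P_mod[OF MD(2,1) x] by simp
  qed (use PM in blast)
  have \<Gamma>W: "\<Gamma> \<subseteq> W" using P_mem(1) FD(3) by (auto simp: \<Gamma>_def)
  have \<Gamma>MF: "\<Gamma> \<subseteq> MF"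
  proof
    fix g assume "g \<in> \<Gamma>"
    then obtain y where "y \<in> MF" "g = P y" by (auto simp: \<Gamma>_def)
    then show "g \<in> MF" using P_mod[OF FD(2,1), of y] FD(3) by blast
  qed
  have sNF: "subspace (N \<inter> MF)" "fin_dim (N \<inter> MF)"
    using N_subspace MF_subspace fin_dim_subset[OF N_fin_dim] by (simp_all add: subspace_inter)
  have sNFM: "subspace (N \<inter> MF \<inter> M)" "N \<inter> MF \<inter> M \<subseteq> N \<inter> MF"
    using sNF(1) MD(1) by (auto simp: subspace_inter)
  obtain R where R: "subspace R" "fin_dim R" "R \<subseteq> N \<inter> MF" "R \<inter> (N \<inter> MF \<inter> M) = {0}"
      "N \<inter> MF = R + (N \<inter> MF \<inter> M)"
    by (rule orthogonal_complement_exists[OF sNF sNFM])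
  let ?\<alpha> = "P ` N"
  have s\<alpha>: "subspace ?\<alpha>" "fin_dim ?\<alpha>"
    using linear_subspace_image[OF P(1) N_subspace] fin_dim_linear_image[OF P(1) N_fin_dim] by simp_all
  have inter: "?\<alpha> \<inter> \<Gamma> = P ` (N \<inter> MF)" "?\<alpha> \<inter> \<Lambda> \<inter> \<Gamma> = P ` (N \<inter> MF \<inter> M)"
    using P\<Gamma> P\<Lambda> NX by blast+
  have dimR: "dim (?\<alpha> \<inter> \<Gamma>) = dim R + dim (?\<alpha> \<inter> \<Lambda> \<inter> \<Gamma>)"
  proof -
    have sPR: "subspace (P ` R)" "fin_dim (P ` R)"
      using linear_subspace_image[OF P(1) R(1)] fin_dim_linear_image[OF P(1) R(2)] by simp_all
    have sPI: "subspace (P ` (N \<inter> MF \<inter> M))" "fin_dim (P ` (N \<inter> MF \<inter> M))"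
      using linear_subspace_image[OF P(1) sNFM(1)]
        fin_dim_linear_image[OF P(1) fin_dim_subset[OF sNF(2) sNFM(2)]] by simp_all
    have RM: "r = 0" if "r \<in> R" "P r \<in> \<Lambda>" for r
    proof -
      have "r \<in> N \<inter> MF" using that(1) R(3) by blast
      then have "r \<in> N \<inter> MF \<inter> M" using that(2) P\<Lambda> NX by blast
      then show ?thesis using that(1) R(4) by blast
    qed
    have "?\<alpha> \<inter> \<Gamma> = P ` R + P ` (N \<inter> MF \<inter> M)"
    proof -
      have "P ` (R + (N \<inter> MF \<inter> M)) = P ` R + P ` (N \<inter> MF \<inter> M)"
        by (rule image_set_plus_linear[OF P(1)])
      then show ?thesis unfolding inter(1) using R(5) by metis
    qed
    moreover have "P ` R \<inter> P ` (N \<inter> MF \<inter> M) = {0}"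
    proof -
      have "z = 0" if z: "z \<in> P ` R" "z \<in> P ` (N \<inter> MF \<inter> M)" for z
      proof -
        have zL: "z \<in> \<Lambda>" using z(2) inter(2) by blast
        obtain r where r: "r \<in> R" "z = P r" using z(1) by blast
        then have "r = 0" using RM zL by blast
        then show ?thesis using r(2) by (simp add: P_simps)
      qed
      then show ?thesis using subspace_0[OF sPR(1)] subspace_0[OF sPI(1)] by blast
    qed
    moreover have "dim (P ` R) = dim R"
    proof (rule dim_linear_image_inj[OF P(1) R(1,2)])
      fix r assume "r \<in> R" "P r = 0"
      then show "r = 0" using RM subspace_0[OF s\<Lambda>] by simp
    qed
    ultimately show ?thesis using dim_direct_sum[OF sPR(1) sPI(1) sPR(2) sPI(2)] inter(2) by simp
  qed
  let ?V = "?\<alpha> \<inter> (\<Lambda> + \<Gamma>)"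
  let ?Q = "triple_form (boundary_form Ladj) \<Lambda> \<Gamma>"
  have sV: "subspace ?V" "fin_dim ?V"
    using s\<alpha> subspace_set_plus[OF s\<Lambda> s\<Gamma>] fin_dim_subset[OF s\<alpha>(2)] by (simp_all add: subspace_inter)
  have Q: "?Q (P (x + y)) = - sum_form (x, y) (x, y)" if z: "(x, y) \<in> kernel_pairs M" for x y
  proof -
    have xy: "x \<in> M" "y \<in> MF" "A x + A y = 0" using z by (simp_all add: kernel_pairs_def)
    have X: "x \<in> X" "y \<in> X" using xy MD(3) FD(3) by blast+
    have xyX: "x + y \<in> X" using X X_subspace by (simp add: subspace_add)
    define u where "u = P (x + y)"
    have uW: "u \<in> W" "u \<in> X" using P_mem(1)[OF xyX] W_X by (auto simp: u_def)
    have Px: "- P x \<in> \<Lambda>" using P\<Lambda>[OF X(1)] xy(1) s\<Lambda> by (simp add: subspace_neg)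
    have uPx: "u + - P x \<in> \<Gamma>" using P\<Gamma>[OF X(2)] xy(2) by (simp add: u_def P_simps)
    define v where "v = (SOME v. v \<in> \<Lambda> \<and> u + v \<in> \<Gamma>)"
    have v: "v \<in> \<Lambda> \<and> u + v \<in> \<Gamma>" unfolding v_def by (rule someI[of _ "- P x"]) (use Px uPx in blast)
    have vX: "v \<in> X" using v \<Lambda>W W_X by blast
    have d: "v + P x \<in> \<Lambda>" using v Px subspace_diff[OF s\<Lambda>, of v "- P x"] by simp
    have d': "v + P x \<in> MF"
    proof -
      have "(u + v) - (u + - P x) \<in> \<Gamma>" using v uPx s\<Gamma> by (simp only: subspace_diff)
      then show ?thesis using \<Gamma>MF by auto
    qed
    \<comment> \<open>Any other choice of \<open>v\<close> differs from \<open>- P x\<close> by an element of \<open>\<Lambda> \<inter> \<Gamma>\<close>, which is \<open>\<omega>\<close>-orthogonal to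
      \<open>\<Lambda> + \<Gamma>\<close>.\<close>
    have "\<omega> u (v + P x) = 0"
    proof -
      have "u + v \<in> MF" "v \<in> M" "v + P x \<in> M" using v d \<Gamma>MF \<Lambda>M by blast+
      then have "\<omega> (u + v) (v + P x) = 0" "\<omega> v (v + P x) = 0"
        using MF_sym[OF _ d', of "u + v"] MD(4)[of v "v + P x"] by (simp_all add: \<omega>_def)
      then show ?thesis by (simp add: \<omega>_simps)
    qed
    then have uv: "\<omega> u v = - \<omega> u (P x)" by (simp add: \<omega>_simps)
    have "?Q u = boundary_form Ladj u v" by (simp add: triple_form_def v_def)
    also have "\<dots> = \<omega> u v" by (rule boundary_form_\<omega>[OF uW(2) vX])
    also have "\<dots> = - \<omega> (x + y) x"
      unfolding uv using \<omega>_P(2)[OF uW(2) X(1)] \<omega>_P(1)[OF xyX X(1)] by (simp add: u_def)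
    also have "\<dots> = - sum_form (x, y) (x, y)"
    proof -
      have Ay: "A y = - A x" using xy(3) by (simp add: eq_neg_iff_add_eq_0 add.commute)
      show ?thesis by (simp add: \<omega>_def sum_form_def A_simps Ay inner_add_left inner_commute)
    qed
    finally show ?thesis by (simp add: u_def)
  qed
  have skernel_pairs: "subspace (kernel_pairs M)"
  proof -
    have lin: "linear (\<lambda>z. A (fst z + snd z))" by (rule linearI) (simp_all add: A_simps algebra_simps)
    have "kernel_pairs M = (M \<times> MF) \<inter> {z. A (fst z + snd z) = 0}" by (auto simp: kernel_pairs_def A_simps)
    then show ?thesis
      using subspace_inter[OF subspace_Times[OF MD(1) MF_subspace] linear_subspace_kernel[OF lin]] by simp
  qed
  have lin1: "linear (\<lambda>z. (z, P (fst z + snd z)))" by (rule linearI) (simp_all add: P_simps algebra_simps)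
  have lin2: "linear (\<lambda>z. (P (fst z + snd z), z))" by (rule linearI) (simp_all add: P_simps algebra_simps)
  have mem: "P (x + y) \<in> ?V" if z: "(x, y) \<in> kernel_pairs M" for x y
  proof -
    have xy: "x \<in> M" "y \<in> MF" "A x + A y = 0" using z by (simp_all add: kernel_pairs_def)
    have X: "x \<in> X" "y \<in> X" using xy MD(3) FD(3) by blast+
    have "x + y \<in> N" unfolding N_def using X xy(3) X_subspace by (simp add: subspace_add A_simps)
    moreover have "P x + P y \<in> \<Lambda> + \<Gamma>" using P\<Lambda>[OF X(1)] P\<Gamma>[OF X(2)] xy by (intro set_plus_intro) simp_all
    moreover have eq: "P (x + y) = P x + P y" by (simp add: P_simps)
    ultimately show ?thesis using imageI[of "x + y" N P] unfolding eq by blast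
  qed
  have surj: "\<exists>x y. (x, y) \<in> kernel_pairs M \<and> u = P (x + y)" if u: "u \<in> ?V" for u
  proof -
    obtain n where n: "n \<in> N" "u = P n" using u by blast
    have "u \<in> \<Lambda> + \<Gamma>" using u by blast
    then obtain l g where lg: "u = l + g" "l \<in> \<Lambda>" "g \<in> \<Gamma>" by (rule set_plus_elim)
    have nX: "n \<in> X" "A n = 0" using n(1) by (simp_all add: N_def)
    define x where "x = (n - P n) + l"
    have "n - P n \<in> M" "l \<in> M" using P_mem(2)[OF nX(1)] MD(2) \<Lambda>M lg(2) by blast+
    then have xM: "x \<in> M" unfolding x_def by (rule subspace_add[OF MD(1)])
    have xg: "x + g = n" using lg(1) n(2) by (simp add: x_def)
    have "A x + A g = 0" using nX(2) unfolding xg[symmetric] by (simp add: A_simps)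
    then have "(x, g) \<in> kernel_pairs M" using xM lg(3) \<Gamma>MF by (auto simp: kernel_pairs_def)
    then show ?thesis using xg n(2) by blast
  qed
  have "neg_index (\<lambda>z. sum_form z z) (kernel_pairs M) = neg_index (\<lambda>u. - ?Q u) ?V"
  proof (rule antisym)
    show "neg_index (\<lambda>z. sum_form z z) (kernel_pairs M) \<le> neg_index (\<lambda>u. - ?Q u) ?V"
    proof (rule neg_index_le_of_relation[of "(\<lambda>z. (z, P (fst z + snd z))) ` kernel_pairs M"])
      show "subspace ((\<lambda>z. (z, P (fst z + snd z))) ` kernel_pairs M)" by (rule linear_subspace_image[OF lin1 skernel_pairs])
      show "\<exists>u\<in>?V. (z, u) \<in> (\<lambda>z. (z, P (fst z + snd z))) ` kernel_pairs M" if "z \<in> kernel_pairs M" for z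
      proof (intro bexI[of _ "P (fst z + snd z)"])
        show "(z, P (fst z + snd z)) \<in> (\<lambda>z. (z, P (fst z + snd z))) ` kernel_pairs M"
          using that by (rule imageI)
        show "P (fst z + snd z) \<in> ?V" using mem[of "fst z" "snd z"] that by simp
      qed
      show "- ?Q u = sum_form z z" if "(z, u) \<in> (\<lambda>z. (z, P (fst z + snd z))) ` kernel_pairs M" for z u
      proof -
        have "z \<in> kernel_pairs M" "u = P (fst z + snd z)" using that by blast+
        then show ?thesis using Q[of "fst z" "snd z"] by simp
      qed
      show "subspace ?V" by (rule sV(1))
    qed (simp add: sum_form_def A_simps)
    show "neg_index (\<lambda>u. - ?Q u) ?V \<le> neg_index (\<lambda>z. sum_form z z) (kernel_pairs M)"
    proof (rule neg_index_le_of_relation[of "(\<lambda>z. (P (fst z + snd z), z)) ` kernel_pairs M"])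
      show "subspace ((\<lambda>z. (P (fst z + snd z), z)) ` kernel_pairs M)" by (rule linear_subspace_image[OF lin2 skernel_pairs])
      show "\<exists>z\<in>kernel_pairs M. (u, z) \<in> (\<lambda>z. (P (fst z + snd z), z)) ` kernel_pairs M" if uV: "u \<in> ?V" for u
      proof -
        obtain x y where xy: "(x, y) \<in> kernel_pairs M" "u = P (x + y)" using surj[OF uV] by blast
        have "(u, (x, y)) \<in> (\<lambda>z. (P (fst z + snd z), z)) ` kernel_pairs M"
          using imageI[OF xy(1), of "\<lambda>z. (P (fst z + snd z), z)"] xy(2) by simp
        then show ?thesis by (rule bexI[OF _ xy(1)])
      qed
      show "sum_form z z = - ?Q u" if "(u, z) \<in> (\<lambda>z. (P (fst z + snd z), z)) ` kernel_pairs M" for z u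
      proof -
        have "z \<in> kernel_pairs M" "u = P (fst z + snd z)" using that by blast+
        then show ?thesis using Q[of "fst z" "snd z"] by simp
      qed
      show "subspace (kernel_pairs M)" by (rule skernel_pairs)
      have "(0, 0) \<in> kernel_pairs M" using subspace_0[OF skernel_pairs] by (simp add: zero_prod_def)
      then show "- ?Q 0 = 0" using Q[of 0 0] by (simp add: P_simps sum_form_def A_simps)
    qed
  qed
  moreover have "?Q 0 = 0"
  proof -
    have "(0, 0) \<in> kernel_pairs M" using subspace_0[OF skernel_pairs] by (simp add: zero_prod_def)
    then show ?thesis using Q[of 0 0] by (simp add: P_simps sum_form_def A_simps)
  qed
  ultimately have "enat (positive_index ?V ?Q) = neg_index (\<lambda>z. sum_form z z) (kernel_pairs M)"
    using positive_index_eq_neg_index[OF sV, of ?Q] by simp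
  moreover have "triple_index (boundary_form Ladj) ?\<alpha> \<Lambda> \<Gamma> = positive_index ?V ?Q + dim R"
    using dimR by (simp add: triple_index_def)
  ultimately have "enat (triple_index (boundary_form Ladj) ?\<alpha> \<Lambda> \<Gamma>) = neg_index (\<lambda>z. sum_form z z) (kernel_pairs M) + enat (dim R)"
    by (simp flip: plus_enat_simps(1))
  then show ?thesis unfolding \<Gamma>_def by (rule that[OF R])
qed

theorem morse_index_difference:
  assumes \<Lambda>: "lagrangian (boundary_form Ladj) W \<Lambda>"
  shows "morse_index H (op_restrict Ladj (D0 + \<Lambda>)) =
    morse_index H (friedrichs_extension H L)
      + enat (triple_index (boundary_form Ladj) (P ` N) \<Lambda> (P ` MF))"
proof -
  have M: "lagr (D0 + \<Lambda>)" by (rule lagr_of_lagrangian(1)[OF \<Lambda>])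
  obtain R where R: "subspace R" "fin_dim R" "R \<subseteq> N \<inter> MF" "R \<inter> (N \<inter> MF \<inter> (D0 + \<Lambda>)) = {0}"
      "N \<inter> MF = R + (N \<inter> MF \<inter> (D0 + \<Lambda>))"
    and tri: "enat (triple_index (boundary_form Ladj) (P ` N) \<Lambda> (P ` MF))
      = neg_index (\<lambda>z. sum_form z z) (kernel_pairs (D0 + \<Lambda>)) + enat (dim R)"
    by (rule triple_index_eq[OF \<Lambda>])
  show ?thesis
    unfolding friedrichs_MF morse_index_lagr[OF M] morse_index_lagr[OF lagr_MF]
      index_decomposition[OF M R] tri by (simp add: add.assoc)
qed

end

section \<open>Completeness of the space of square-integrable functions\<close>

lemma l2_rel_self: "l2_rel f f \<longleftrightarrow> square_integrable f"
  by (simp add: l2_rel_def)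

lemma to_l2_add:
  fixes f g :: "real \<Rightarrow> 'v::euclidean_space"
  shows "square_integrable f \<Longrightarrow> square_integrable g \<Longrightarrow> to_l2 f + to_l2 g = to_l2 (\<lambda>t. f t + g t)"
  by (rule plus_l2.abs_eq) (simp_all add: l2_rel_self)

lemma to_l2_scaleR: "square_integrable f \<Longrightarrow> k *\<^sub>R to_l2 f = to_l2 (\<lambda>t. k *\<^sub>R f t)"
  by (rule scaleR_l2.abs_eq) (simp add: l2_rel_self)

lemma to_l2_zero: "(0::'a::euclidean_space l2) = to_l2 (\<lambda>t. 0)"
  by (simp add: zero_l2.abs_eq)

lemma norm_to_l2:
  assumes "square_integrable f" shows "(norm (to_l2 f))\<^sup>2 = (LINT t|lborel. (norm (f t))\<^sup>2)"
proof -
  have "inner (to_l2 f) (to_l2 f) = (LINT t|lborel. inner (f t) (f t))"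
    by (rule inner_l2.abs_eq) (simp_all add: l2_rel_self assms)
  then show ?thesis by (simp add: power2_norm_eq_inner)
qed

lemma square_integrable_diff:
  fixes f g :: "real \<Rightarrow> 'v::euclidean_space"
  assumes "square_integrable f" "square_integrable g" shows "square_integrable (\<lambda>t. f t - g t)"
  using square_integrable_add[OF assms(1) square_integrable_scaleR[OF assms(2), of "-1"]] by simp

lemma to_l2_diff:
  assumes "square_integrable f" "square_integrable g" shows "to_l2 f - to_l2 g = to_l2 (\<lambda>t. f t - g t)"
proof -
  have "to_l2 f + (-1) *\<^sub>R to_l2 g = to_l2 (\<lambda>t. f t + (-1) *\<^sub>R g t)"
    unfolding to_l2_scaleR[OF assms(2)]
    by (rule to_l2_add[OF assms(1) square_integrable_scaleR[OF assms(2)]])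
  also have "(\<lambda>t. f t + (-1) *\<^sub>R g t) = (\<lambda>t. f t - g t)" by simp
  finally show ?thesis unfolding minus_l2_def .
qed

lemma l2_onE:
  assumes "x \<in> l2_on I"
  obtains f where "x = to_l2 f" "square_integrable f" "\<forall>t. t \<notin> I \<longrightarrow> f t = 0"
proof -
  obtain f where "x = to_l2 f" "f \<in> {f. square_integrable f \<and> (\<forall>t. t \<notin> I \<longrightarrow> f t = 0)}"
    by (rule imageE[OF assms[unfolded l2_on_def]])
  then show ?thesis by (intro that[of f]) simp_all
qed

lemma subspace_l2_on: "subspace (l2_on I :: 'v::euclidean_space l2 set)"
proof (rule subspaceI)
  show "(0::'v l2) \<in> l2_on I" unfolding l2_on_def to_l2_zero
    by (intro imageI) (simp add: square_integrable_zero)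
next
  fix x y :: "'v l2" assume x: "x \<in> l2_on I" and y: "y \<in> l2_on I"
  obtain f where f: "x = to_l2 f" "square_integrable f" "\<forall>t. t \<notin> I \<longrightarrow> f t = 0"
    by (rule l2_onE[OF x])
  obtain g where g: "y = to_l2 g" "square_integrable g" "\<forall>t. t \<notin> I \<longrightarrow> g t = 0"
    by (rule l2_onE[OF y])
  have "to_l2 (\<lambda>t. f t + g t) \<in> l2_on I" unfolding l2_on_def
    using f g by (intro imageI) (simp add: square_integrable_add)
  then show "x + y \<in> l2_on I" unfolding f(1) g(1) to_l2_add[OF f(2) g(2)] .
next
  fix k and x :: "'v l2" assume x: "x \<in> l2_on I"
  obtain f where f: "x = to_l2 f" "square_integrable f" "\<forall>t. t \<notin> I \<longrightarrow> f t = 0"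
    by (rule l2_onE[OF x])
  have "to_l2 (\<lambda>t. k *\<^sub>R f t) \<in> l2_on I" unfolding l2_on_def
    using f by (intro imageI) (simp add: square_integrable_scaleR)
  then show "k *\<^sub>R x \<in> l2_on I" unfolding f(1) to_l2_scaleR[OF f(2)] .
qed

text \<open>
  The weighted sum of the squared increments, with weights \<open>4\<^sup>k\<close>, has a finite integral. So it is
  finite almost everywhere, and there the increments are dominated by a geometric series.
\<close>

lemma fast_Cauchy_converges_AE:
  fixes g :: "nat \<Rightarrow> real \<Rightarrow> 'v::euclidean_space"
  assumes g: "\<And>k. square_integrable (g k)"
    and fast: "\<And>k. (LINT t|lborel. (norm (g (Suc k) t - g k t))\<^sup>2) \<le> (1/16) ^ k"
  shows "AE t in lborel. convergent (\<lambda>k. g k t)"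
proof -
  have meas[measurable]: "g k \<in> borel_measurable lborel" for k using g[of k] by (simp add: square_integrable_def)
  define d where "d k t = g (Suc k) t - g k t" for k t
  have d: "square_integrable (d k)" for k unfolding d_def by (rule square_integrable_diff[OF g g])
  have dm[measurable]: "d k \<in> borel_measurable lborel" for k using d[of k] by (simp add: square_integrable_def)
  define a where "a k t = ennreal (4 ^ k * (norm (d k t))\<^sup>2)" for k t
  have am[measurable]: "a k \<in> borel_measurable lborel" for k unfolding a_def by measurable
  have int: "(\<integral>\<^sup>+t. a k t \<partial>lborel) \<le> ennreal ((1/4) ^ k)" for k
  proof -
    have i: "integrable lborel (\<lambda>t. 4 ^ k * (norm (d k t))\<^sup>2)"
      using d[of k] by (simp add: square_integrable_def)
    have "(\<integral>\<^sup>+t. a k t \<partial>lborel) = ennreal (LINT t|lborel. 4 ^ k * (norm (d k t))\<^sup>2)"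
      unfolding a_def by (rule nn_integral_eq_integral[OF i]) simp
    also have "\<dots> \<le> ennreal (4 ^ k * (1/16) ^ k)"
      using fast[of k] by (intro ennreal_leI) (simp add: d_def)
    also have "(4::real) ^ k * (1/16) ^ k = (1/4) ^ k" by (simp flip: power_mult_distrib)
    finally show ?thesis .
  qed
  have "(\<integral>\<^sup>+t. (\<Sum>k. a k t) \<partial>lborel) = (\<Sum>k. \<integral>\<^sup>+t. a k t \<partial>lborel)"
    by (rule nn_integral_suminf) (rule am)
  also have "\<dots> \<le> (\<Sum>k. ennreal ((1/4) ^ k))" by (rule suminf_le[OF int]) simp_all
  also have "\<dots> = ennreal (\<Sum>k. (1/4) ^ k)" by (rule suminf_ennreal2) (simp_all add: summable_geometric)
  finally have "(\<integral>\<^sup>+t. (\<Sum>k. a k t) \<partial>lborel) \<noteq> \<infinity>"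
    using ennreal_less_top le_less_trans by (metis infinity_ennreal_def less_irrefl)
  then have "AE t in lborel. (\<Sum>k. a k t) \<noteq> \<infinity>"
    by (intro nn_integral_noteq_infinite) simp_all
  then show ?thesis
  proof eventually_elim
    case (elim t)
    define C where "C = enn2real (\<Sum>k. a k t)"
    have Ca: "(\<Sum>k. a k t) = ennreal C" using elim by (simp add: C_def ennreal_enn2real less_top)
    have C0: "0 \<le> C" by (simp add: C_def)
    have le: "norm (d k t) \<le> sqrt C * (1/2) ^ k" for k
    proof -
      have "a k t \<le> (\<Sum>k. a k t)" using sum_le_suminf[of "\<lambda>k. a k t" "{k}"] by simp
      then have "a k t \<le> ennreal C" unfolding Ca .
      then have "4 ^ k * (norm (d k t))\<^sup>2 \<le> C" unfolding a_def using C0 by simp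
      moreover have "((2::real) ^ k)\<^sup>2 = 4 ^ k" by (simp add: power2_eq_square flip: power_mult_distrib)
      ultimately have "(2 ^ k * norm (d k t))\<^sup>2 \<le> C" by (simp add: power_mult_distrib)
      then have "2 ^ k * norm (d k t) \<le> sqrt C" using real_le_rsqrt by blast
      then show ?thesis by (simp add: field_simps power_divide)
    qed
    have "summable (\<lambda>k. d k t)"
      by (rule summable_comparison_test'[of "\<lambda>k. sqrt C * (1/2) ^ k" 0]) (use le in \<open>simp_all add: summable_geometric summable_mult\<close>)
    then have "convergent (\<lambda>n. \<Sum>k<n. d k t)" using summable_iff_convergent by blast
    moreover have "(\<Sum>k<n. d k t) = g n t - g 0 t" for n
      unfolding d_def by (rule sum_lessThan_telescope)
    ultimately have "convergent (\<lambda>n. g n t - g 0 t)" by simp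
    then have "convergent (\<lambda>n. (g n t - g 0 t) + g 0 t)" by (intro convergent_add convergent_const)
    then show "convergent (\<lambda>k. g k t)" by simp
  qed
qed

text \<open>
  Fatou's lemma.
\<close>

lemma square_integrable_limit:
  fixes g :: "nat \<Rightarrow> real \<Rightarrow> 'v::euclidean_space"
  assumes g: "\<And>k. square_integrable (g k)" and h: "h \<in> borel_measurable lborel"
    and lim: "AE t in lborel. (\<lambda>k. g k t) \<longlonglongrightarrow> h t"
    and bound: "\<And>k. m \<le> k \<Longrightarrow> (LINT t|lborel. (norm (g k t - g m t))\<^sup>2) \<le> e"
  shows "square_integrable h" "(LINT t|lborel. (norm (h t - g m t))\<^sup>2) \<le> e"
proof -
  have [measurable]: "g k \<in> borel_measurable lborel" for k using g[of k] by (simp add: square_integrable_def)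
  note h[measurable]
  have e0: "0 \<le> e" using bound[of m] by simp
  define F where "F k t = ennreal ((norm (g k t - g m t))\<^sup>2)" for k t
  have Fm: "F k \<in> borel_measurable lborel" for k unfolding F_def by measurable
  have Fint: "(\<integral>\<^sup>+t. F k t \<partial>lborel) \<le> ennreal e" if "m \<le> k" for k
  proof -
    have "integrable lborel (\<lambda>t. (norm (g k t - g m t))\<^sup>2)"
      using square_integrable_diff[OF g g, of k m] by (simp add: square_integrable_def)
    then have "(\<integral>\<^sup>+t. F k t \<partial>lborel) = ennreal (LINT t|lborel. (norm (g k t - g m t))\<^sup>2)"
      unfolding F_def by (rule nn_integral_eq_integral) simp
    then show ?thesis using bound[OF that] by (simp add: ennreal_leI)
  qed
  have "(\<integral>\<^sup>+t. ennreal ((norm (h t - g m t))\<^sup>2) \<partial>lborel) = (\<integral>\<^sup>+t. liminf (\<lambda>k. F k t) \<partial>lborel)"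
  proof (rule nn_integral_cong_AE)
    show "AE t in lborel. ennreal ((norm (h t - g m t))\<^sup>2) = liminf (\<lambda>k. F k t)"
      using lim
    proof eventually_elim
      case (elim t)
      have "(\<lambda>k. F k t) \<longlonglongrightarrow> ennreal ((norm (h t - g m t))\<^sup>2)"
        unfolding F_def by (intro tendsto_ennrealI tendsto_intros elim)
      then show ?case using lim_imp_Liminf[OF sequentially_bot] by metis
    qed
  qed
  also have "\<dots> \<le> liminf (\<lambda>k. \<integral>\<^sup>+t. F k t \<partial>lborel)" by (rule nn_integral_liminf[OF Fm])
  also have "\<dots> \<le> ennreal e"
  proof -
    have "liminf (\<lambda>k. \<integral>\<^sup>+t. F k t \<partial>lborel) \<le> liminf (\<lambda>k. ennreal e)"
      using Fint by (intro Liminf_mono) (auto simp: eventually_sequentially intro!: exI[of _ m])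
    then show ?thesis by (simp add: Liminf_const)
  qed
  finally have le: "(\<integral>\<^sup>+t. ennreal ((norm (h t - g m t))\<^sup>2) \<partial>lborel) \<le> ennreal e" .
  have int: "integrable lborel (\<lambda>t. (norm (h t - g m t))\<^sup>2)"
  proof (rule integrableI_nonneg)
    show "(\<integral>\<^sup>+t. ennreal ((norm (h t - g m t))\<^sup>2) \<partial>lborel) < \<infinity>"
      using le ennreal_less_top le_less_trans by (metis infinity_ennreal_def)
  qed simp_all
  then have "square_integrable (\<lambda>t. h t - g m t)" by (simp add: square_integrable_def)
  then show "square_integrable h" using square_integrable_add[OF _ g[of m], of "\<lambda>t. h t - g m t"] by simp
  have "ennreal (LINT t|lborel. (norm (h t - g m t))\<^sup>2) \<le> ennreal e"
    using le nn_integral_eq_integral[OF int] by simp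
  then show "(LINT t|lborel. (norm (h t - g m t))\<^sup>2) \<le> e" using e0 by simp
qed

text \<open>
  The Riesz--Fischer theorem. The subspace for \<open>I\<close> is closed because a representative of the
  limit is the pointwise limit of representatives that vanish outside \<open>I\<close>.
\<close>

lemma complete_l2_on: "complete (l2_on I :: 'v::euclidean_space l2 set)"
  unfolding complete_def
proof (intro allI impI)
  fix x :: "nat \<Rightarrow> 'v l2" assume x: "(\<forall>n. x n \<in> l2_on I) \<and> Cauchy x"
  then have "\<forall>n. \<exists>f. x n = to_l2 f \<and> square_integrable f \<and> (\<forall>t. t \<notin> I \<longrightarrow> f t = 0)"
    by (metis l2_onE)
  then obtain f where f: "\<And>n. x n = to_l2 (f n)" "\<And>n. square_integrable (f n)"
      "\<And>n t. t \<notin> I \<Longrightarrow> f n t = 0" by metis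
  have "\<forall>k. \<exists>N. \<forall>m\<ge>N. \<forall>n\<ge>N. dist (x m) (x n) < (1/4) ^ k"
    using x metric_CauchyD[of x] by simp
  then obtain N where N: "\<And>k m n. N k \<le> m \<Longrightarrow> N k \<le> n \<Longrightarrow> dist (x m) (x n) < (1/4) ^ k" by metis
  define r where "r k = (\<Sum>i\<le>k. N i) + k" for k
  have r: "strict_mono r" by (rule strict_monoI_Suc) (simp add: r_def)
  have Nr: "N k \<le> r k" for k
  proof -
    have "N k \<le> (\<Sum>i\<le>k. N i)" by (rule member_le_sum) simp_all
    then show ?thesis by (simp add: r_def)
  qed
  define g where "g k = f (r k)" for k
  have g: "square_integrable (g k)" for k using f(2) by (simp add: g_def)
  have gm[measurable]: "g k \<in> borel_measurable lborel" for k using g[of k] by (simp add: square_integrable_def)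
  have close: "(LINT t|lborel. (norm (g k t - g m t))\<^sup>2) \<le> (1/16) ^ m" if "m \<le> k" for k m
  proof -
    have "N m \<le> r k" using Nr[of m] strict_mono_less_eq[OF r, of m k] that by simp
    then have "norm (x (r k) - x (r m)) \<le> (1/4) ^ m" using N Nr by (simp add: dist_norm less_imp_le)
    then have "(norm (x (r k) - x (r m)))\<^sup>2 \<le> ((1/4) ^ m)\<^sup>2" by (intro power_mono) simp_all
    also have "((1/4::real) ^ m)\<^sup>2 = (1/16) ^ m" by (simp add: power2_eq_square flip: power_mult_distrib)
    finally show ?thesis
      unfolding f(1) to_l2_diff[OF f(2) f(2)] norm_to_l2[OF square_integrable_diff[OF f(2) f(2)]] g_def .
  qed
  define h where "h t = lim (\<lambda>k. g k t)" for t
  have h: "h \<in> borel_measurable lborel" unfolding h_def by measurable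
  have "AE t in lborel. convergent (\<lambda>k. g k t)"
    by (rule fast_Cauchy_converges_AE[OF g close]) simp
  then have lim: "AE t in lborel. (\<lambda>k. g k t) \<longlonglongrightarrow> h t"
    by eventually_elim (simp add: h_def convergent_LIMSEQ_iff)
  have hl: "square_integrable h" by (rule square_integrable_limit(1)[OF g h lim close])
  have hd: "(LINT t|lborel. (norm (h t - g m t))\<^sup>2) \<le> (1/16) ^ m" for m
    by (rule square_integrable_limit(2)[OF g h lim close])
  have hI: "h t = 0" if "t \<notin> I" for t using f(3)[OF that] by (simp add: h_def g_def)
  have "to_l2 h \<in> l2_on I" unfolding l2_on_def using hl hI by blast
  moreover have "x \<longlonglongrightarrow> to_l2 h"
  proof (rule Cauchy_converges_subseq[OF _ r])
    show "Cauchy x" using x by blast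
    have le: "norm (x (r m) - to_l2 h) \<le> (1/4) ^ m" for m
    proof -
      have "(norm (to_l2 h - x (r m)))\<^sup>2 \<le> (1/16) ^ m"
        using hd[of m] unfolding f(1) to_l2_diff[OF hl f(2)] norm_to_l2[OF square_integrable_diff[OF hl f(2)]] g_def .
      also have "(1/16) ^ m = ((1/4::real) ^ m)\<^sup>2" by (simp add: power2_eq_square flip: power_mult_distrib)
      finally have "norm (to_l2 h - x (r m)) \<le> (1/4) ^ m" by (rule power2_le_imp_le) simp
      then show ?thesis by (simp add: norm_minus_commute)
    qed
    have lim0: "(\<lambda>m. (1/4::real) ^ m) \<longlonglongrightarrow> 0" by (rule LIMSEQ_realpow_zero) simp_all
    have "(\<lambda>m. x (r m) - to_l2 h) \<longlonglongrightarrow> 0"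
      by (rule Lim_null_comparison[OF _ lim0]) (simp only: le eventually_True)
    then show "(x \<circ> r) \<longlonglongrightarrow> to_l2 h" by (simp add: LIM_zero_iff o_def)
  qed
  ultimately show "\<exists>l\<in>l2_on I. x \<longlonglongrightarrow> l" by blast
qed

section \<open>The index theorem for Sturm--Liouville operators\<close>

text \<open>
  The inequality is a closed condition on the points of the graph.
\<close>

lemma sl_minimal_bounded_below:
  assumes "sl_bounded_below a b P Q R"
  obtains c where "\<forall>(x, z)\<in>sl_minimal a b P Q R. c * (norm x)\<^sup>2 \<le> inner z x"
proof -
  obtain c where c: "\<forall>u\<in>test_functions (einterval a b).
      c * (norm (to_l2 u))\<^sup>2 \<le> inner (to_l2 (sl_expr P Q R u)) (to_l2 u)"
    using assms[unfolded sl_bounded_below_def] by (rule exE)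
  define S where "S = {p::(real^'a) l2 \<times> (real^'a) l2. c * (norm (fst p))\<^sup>2 \<le> inner (snd p) (fst p)}"
  have "closed S" unfolding S_def by (intro closed_Collect_le continuous_intros)
  moreover have "(\<lambda>u. (to_l2 u, to_l2 (sl_expr P Q R u))) ` test_functions (einterval a b) \<subseteq> S"
    using c by (auto simp: S_def)
  ultimately have "sl_minimal a b P Q R \<subseteq> S" unfolding sl_minimal_def by (simp add: closure_minimal)
  then have "\<forall>(x, z)\<in>sl_minimal a b P Q R. c * (norm x)\<^sup>2 \<le> inner z x"
    unfolding S_def by fastforce
  then show ?thesis by (rule that)
qed

theorem theorem6p1:
  fixes a b :: ereal
    and P Q R :: "real \<Rightarrow> real^'n^'n"
    and H W \<Lambda> :: "(real^'n) l2 set"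
    and L L_adj L_\<Lambda> L_F :: "((real^'n) l2 \<times> (real^'n) l2) set"
    and p :: "(real^'n) l2 \<Rightarrow> (real^'n) l2"
    and \<omega> :: "(real^'n) l2 \<Rightarrow> (real^'n) l2 \<Rightarrow> real"
  assumes "a < b"
    and "sl_coefficients a b P Q R"
    and "regular_right_endpoint b P Q R"
    and "sl_bounded_below a b P Q R"
    and "H = l2_on (einterval a b)"
    and "L = sl_minimal a b P Q R"
    and "closed_operator H L" and "symmetric_operator H L" and "fredholm_operator H L"
    and "L_adj = op_adjoint H L"
    and "complement_in (Domain L_adj) (Domain L) W"
    and "p = proj_along (Domain L) W"
    and "\<omega> = boundary_form L_adj"
    and "lagrangian \<omega> W \<Lambda>"
    and "L_\<Lambda> = op_restrict L_adj (Domain L + \<Lambda>)"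
    and "L_F = friedrichs_extension H L"
  shows "morse_index H L_\<Lambda> =
           morse_index H L_F +
           enat (triple_index \<omega> (p ` op_kernel L_adj) (p ` Domain L_\<Lambda>) (p ` Domain L_F))"
proof -
  obtain c where c: "\<forall>(x, z)\<in>L. c * (norm x)\<^sup>2 \<le> inner z x"
    unfolding assms(6) by (rule sl_minimal_bounded_below[OF assms(4)])
  have H: "complete_subspace H"
    unfolding assms(5) by (simp add: complete_subspace_def complete_l2_on subspace_l2_on)
  interpret F: semibounded_fredholm H L c
  proof (intro semibounded_fredholm.intro semibounded_fredholm_axioms.intro)
    show "complete_subspace H" by (rule H)
    show "closed_operator H L" "symmetric_operator H L" "fredholm_operator H L" by (rule assms(7-9))+
    show "c * (norm x)\<^sup>2 \<le> inner z x" if "(x, z) \<in> L" for x z using bspec[OF c that] by simp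
  qed
  have adj: "L_adj = F.Ladj" by (simp add: assms(10) F.Ladj_def)
  interpret S: index_setting H L c W
  proof (intro index_setting.intro index_setting_axioms.intro)
    show "semibounded_fredholm H L c" by (rule F.semibounded_fredholm_axioms)
    show "complement_in F.X F.D0 W" using assms(11) unfolding adj F.X_def F.D0_def .
  qed
  have \<Lambda>: "lagrangian (boundary_form F.Ladj) W \<Lambda>" using assms(13,14) adj by simp
  have M: "F.lagr (F.D0 + \<Lambda>)" and PM: "S.P ` (F.D0 + \<Lambda>) = \<Lambda>"
    by (rule S.lagr_of_lagrangian[OF \<Lambda>])+
  have L\<Lambda>: "L_\<Lambda> = op_restrict F.Ladj (F.D0 + \<Lambda>)" by (simp add: assms(15) adj F.D0_def)
  have LF: "L_F = op_restrict F.Ladj F.MF" by (simp add: assms(16) F.friedrichs_MF)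
  \<comment> \<open>The two projections agree on the domain of the adjoint only; outside of it \<open>p\<close> has no meaning.\<close>
  have pP: "p ` V = S.P ` V" if "V \<subseteq> F.X" for V
    using that S.P(2) by (intro image_cong) (auto simp: assms(12) F.D0_def)
  have dom: "Domain (op_restrict F.Ladj M) = M" if "F.lagr M" for M
    using F.op_restrict_iff[OF F.lagrD(3)[OF that]] by (auto simp: Domain_iff)
  have "p ` op_kernel L_adj = S.P ` F.N"
    unfolding adj F.N_kernel by (rule pP) (auto simp: F.N_def)
  moreover have "p ` Domain L_\<Lambda> = \<Lambda>"
    unfolding L\<Lambda> dom[OF M] pP[OF F.lagrD(3)[OF M]] by (rule PM)
  moreover have "p ` Domain L_F = S.P ` F.MF"
    unfolding LF dom[OF F.lagr_MF] by (rule pP[OF F.lagrD(3)[OF F.lagr_MF]])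
  ultimately show ?thesis
    using S.morse_index_difference[OF \<Lambda>] by (simp add: L\<Lambda> assms(13,16) adj)
qed

end
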